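(* Let $p>0$, let $k>1$ be an integer and let $z\in\mathbb{H}=\{z\in\mathbb{C}:\mathrm{Im}(z)>0\}$. Then $$E_{2k}^{(p)}\left(-\frac1z\right)=z^{2k}E_{2k}^{(p)}(z).$$
   Context: Fix a real number $p>0$. Let $0<\lambda_1<\lambda_2<\cdots$ be the positive roots of $p\sin(\pi\lambda)+\lambda\cos(\pi\lambda)=0$. For $\nu>0$, $k$ a positive integer and $\mathrm{Re}(s)>0$ put $$(s,\nu k)_k:=\frac1{\Gamma(s)}\int_0^\infty e^{-x}\left(\frac{k\nu-x}{k\nu+x}\right)^kx^{s-1}\,dx ;$$ as a function of $s$ this extends to an entire function, denoted by the same symbol. The second Koshliakov zeta function is $\eta_p(s):=\sum_{k=1}^\infty\frac{(s,2\pi pk)_k}{k^s}$ for $\mathrm{Re}(s)>1$, continued meromorphically to $\mathbb{C}$ (its only singularity is a simple pole at $s=1$). The $p$-exponential function is, for $z\in\mathbb{R}$ and $k$ a positive integer, $$\exp_p(-x;z,k):=\sum_{n=0}^\infty\frac{(-1)^n}{n!}(z-n,2\pi pk)_k\,x^n\qquad(|x|<2\pi pk),$$ extended analytically to all $x$ with $\mathrm{Re}(x)>0$ by $$\exp_p(-x;z,k)=\frac1{2\pi i}\int_{c-i\infty}^{c+i\infty}\Gamma(s)\,(s+z,2\pi pk)_k\,x^{-s}\,ds\qquad(c>0).$$ For an integer $m$ and $\mathrm{Re}(x)>0$, $$\Omega_p(x,m):=\sum_{k=1}^\infty\frac{\exp_p(-xk;2m+1,k)}{k^{2m+1}}.$$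 For an even integer $w\ge2$ the $p$-analogue of the Eisenstein series of weight $w$ is, for $z\in\mathbb{H}$, $$E_w^{(p)}(z):=1+\frac{2\left(1+\frac1{\pi p}\right)}{\eta_p(1-w)}\sum_{j=1}^\infty\frac{p^2+\lambda_j^2}{p\left(p+\frac1\pi\right)+\lambda_j^2}\,\Omega_p\left(-2\lambda_j\pi iz,-\frac w2\right)$$ (if $\eta_p(1-w)=0$, the right-hand side is multiplied by $\eta_p(1-w)$, i.e. $E_w^{(p)}(z):=\eta_p(1-w)+2(1+\frac1{\pi p})\sum_j\cdots$). *)

theory Defs
  imports "HOL-Complex_Analysis.Complex_Analysis"
begin

text \<open>
  The positive roots of \<open>p sin(\<pi>\<lambda>) + \<lambda> cos(\<pi>\<lambda>) = 0\<close> in increasing order, enumerated from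
  index 0: \<open>koshliakov_root p j\<close> is \<open>\<lambda>\<^sub>j\<^sub>+\<^sub>1\<close>.
\<close>

definition koshliakov_root :: "real \<Rightarrow> nat \<Rightarrow> real" where
  "koshliakov_root p = (THE l. strict_mono l \<and>
     range l = {x. x > 0 \<and> p * sin (pi * x) + x * cos (pi * x) = 0})"

text \<open>
  The function \<open>s \<mapsto> (s, \<nu>k)\<^sub>k\<close>: the integral for \<open>Re s > 0\<close>, and its entire extension.
\<close>

definition koshliakov_integral :: "real \<Rightarrow> nat \<Rightarrow> complex \<Rightarrow> complex" where
  "koshliakov_integral \<nu> k s = 1 / Gamma s *
     (LINT x:{0<..}|lborel. of_real (exp (- x) * ((k * \<nu> - x) / (k * \<nu> + x)) ^ k) *
        of_real x powr (s - 1))"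

definition koshliakov_entire :: "real \<Rightarrow> nat \<Rightarrow> complex \<Rightarrow> complex" where
  "koshliakov_entire \<nu> k = (THE f. f holomorphic_on UNIV \<and>
     (\<forall>s. Re s > 0 \<longrightarrow> f s = koshliakov_integral \<nu> k s))"

text \<open>
  The second Koshliakov zeta function as a meromorphic function on the plane. A
  \<^const>\<open>nicely_meromorphic_on\<close> function has no removable discontinuities and takes the value 0
  at its poles, so the continuation is unique as a total function.
\<close>

definition koshliakov_eta :: "real \<Rightarrow> complex \<Rightarrow> complex" where
  "koshliakov_eta p = (THE f. f nicely_meromorphic_on UNIV \<and>
     (\<forall>s. Re s > 1 \<longrightarrow>
        f s = (\<Sum>n. koshliakov_entire (2 * pi * p) (Suc n) s / of_nat (Suc n) powr s)))"

text \<open>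
  \<open>vertical_integral c f\<close> is the integral of \<open>f\<close> along the line from \<open>c - \<i>\<infinity>\<close> to \<open>c + \<i>\<infinity>\<close>.
\<close>

definition vertical_integral :: "real \<Rightarrow> (complex \<Rightarrow> complex) \<Rightarrow> complex" where
  "vertical_integral c f = (LINT t|lborel. f (Complex c t) * \<i>)"

text \<open>
  \<open>p_exp p y z k\<close> is \<open>exp\<^sub>p(y; z, k)\<close>; with \<open>y = -x\<close> it is given by the power series in \<open>x\<close> inside
  its disc of convergence and by the Mellin integral at the other points with \<open>Re x > 0\<close>. The
  latter does not depend on the abscissa \<open>c > 0\<close>, so it is taken to be the common value.
  Elsewhere the value is irrelevant.
\<close>

definition p_exp :: "real \<Rightarrow> complex \<Rightarrow> real \<Rightarrow> nat \<Rightarrow> complex" where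
  "p_exp p y z k = (let x = - y in
     if norm x < 2 * pi * p * k
     then (\<Sum>n. (-1) ^ n / fact n *
             koshliakov_entire (2 * pi * p) k (of_real z - of_nat n) * x ^ n)
     else (THE v. \<forall>c>0. v = 1 / (2 * pi * \<i>) *
             vertical_integral c (\<lambda>s.
               Gamma s * koshliakov_entire (2 * pi * p) k (s + of_real z) * x powr (- s))))"

definition koshliakov_Omega :: "real \<Rightarrow> complex \<Rightarrow> int \<Rightarrow> complex" where
  "koshliakov_Omega p x m =
     (\<Sum>n. p_exp p (- (x * of_nat (Suc n))) (of_int (2 * m + 1)) (Suc n) /
            of_nat (Suc n) powi (2 * m + 1))"

definition p_Eisenstein :: "real \<Rightarrow> nat \<Rightarrow> complex \<Rightarrow> complex" where
  "p_Eisenstein p w z =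
     (let e = koshliakov_eta p (1 - of_nat w);
          S = (\<Sum>j. let l = koshliakov_root p j in
                 of_real ((p\<^sup>2 + l\<^sup>2) / (p * (p + 1 / pi) + l\<^sup>2)) *
                 koshliakov_Omega p (- 2 * of_real l * of_real pi * \<i> * z) (- (int w div 2)));
          C = 2 * (1 + 1 / (of_real pi * of_real p))
      in if e = 0 then e + C * S else 1 + C / e * S)"

end

theory Submission
  imports Defs "HOL-Probability.Probability" "HOL-Real_Asymp.Real_Asymp"
begin

text \<open>
  Write \<open>\<nu> = 2\<pi>p\<close> and \<open>f(x) = \<Sum>\<^sub>n\<^sub>\<ge>\<^sub>1 q(x)\<^sup>n\<close> with \<open>q(x) = e\<^sup>-\<^sup>x (\<nu> - x) / (\<nu> + x)\<close>, so that
  \<open>f(x) = (\<nu> - x) / ((\<nu> + x) e\<^sup>x - (\<nu> - x))\<close>. This one meromorphic function carries the whole theorem;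
  for \<open>p \<rightarrow> \<infinity>\<close> it becomes \<open>1 / (e\<^sup>x - 1)\<close>, and the proof becomes the proof by Lipschitz's formula
  that the classical Eisenstein series is a sum over a lattice.

  The ingredients of the series are integrals and derivatives of \<open>f\<close>. With \<open>a = \<nu>n\<close>, the function
  \<open>e\<^sup>-\<^sup>x ((a - x) / (a + x))\<^sup>n\<close> is the Laplace transform of a signed measure \<open>\<mu>\<close> that lives on
  \<open>[1, \<infinity>)\<close>: a point mass at 1 and a density of the form polynomial times exponential. Hence
  \<open>(s, a)\<^sub>n = \<integral> t\<^sup>-\<^sup>s d\<mu>(t)\<close>, which is visibly entire in \<open>s\<close>, and \<open>exp\<^sub>p(-x; z, n) = \<integral> t\<^sup>-\<^sup>z e\<^sup>-\<^sup>x\<^sup>t d\<mu>(t)\<close>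
  (\<open>p_exp_eq\<close>): inside the disc \<open>\<bar>x\<bar> < a\<close> the defining power series is the Taylor series of
  the right-hand side, and elsewhere the defining contour integral is evaluated by Mellin inversion of
  the exponential function (\<open>Mellin_inversion_exp\<close>). For \<open>z = 1 - 2k\<close> the factor
  \<open>t\<^sup>2\<^sup>k\<^sup>-\<^sup>1\<close> is a \<open>(2k-1)\<close>-fold differentiation in \<open>x\<close>, so summation over \<open>n\<close> gives
  \<open>\<Omega>\<^sub>p(x, -k) = - f\<^sup>(\<^sup>2\<^sup>k\<^sup>-\<^sup>1\<^sup>)(x)\<close> (\<open>koshliakov_Omega_eq\<close>). In the same way \<open>\<Gamma>(s) \<eta>\<^sub>p(s)\<close> is the Mellin
  transform of \<open>f\<close>, whose continuation shows that \<open>\<eta>\<^sub>p(1 - 2k)\<close> is, up to sign, the derivative of order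
  \<open>2k - 1\<close> at 0 of \<open>f\<close> without its principal part (\<open>koshliakov_eta_minus_nat\<close>).

  The poles of \<open>f\<close> are the points \<open>2\<pi>i l\<^sub>m\<close>, where \<open>l\<^sub>m\<close>, for \<open>m \<in> \<int>\<close>, enumerates all real solutions of
  \<open>p sin(\<pi>l) + l cos(\<pi>l) = 0\<close> (thus \<open>l\<^sub>0 = 0\<close> and \<open>l\<^sub>-\<^sub>m = - l\<^sub>m\<close>), and the residues \<open>w\<^sub>m\<close> are exactly the
  weights in the definition of the series. As \<open>f\<close> is bounded on large squares, the residue theorem
  expands its derivatives in partial fractions (\<open>kosh_regular_partial_fractions\<close>).

  Everything combines to: up to a constant factor, the Eisenstein series is the sum of
  \<open>w\<^sub>a w\<^sub>b / (l\<^sub>a z + l\<^sub>b)\<^sup>2\<^sup>k\<close> over all pairs of integers \<open>(a, b) \<noteq> (0, 0)\<close> (\<open>p_Eisenstein_eq\<close>). The value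
  \<open>\<eta>\<^sub>p(1 - 2k)\<close> supplies the pairs with \<open>a = 0\<close>. Since \<open>\<bar>l\<^sub>m - m\<bar> < 1/2\<close>, the sum converges absolutely for
  \<open>k > 1\<close>, and replacing \<open>z\<close> by \<open>-1/z\<close> amounts to the permutation \<open>(a, b) \<mapsto> (b, -a)\<close> of the pairs
  (\<open>kosh_lattice_sum_modular\<close>).
\<close>

section \<open>Integrals depending holomorphically on a parameter\<close>

abbreviation lborel_pos :: "real measure" where
  "lborel_pos \<equiv> restrict_space lborel {0<..}"

lemma borel_measurable_lborel_pos:
  fixes f :: "real \<Rightarrow> 'a::topological_space"
  assumes "continuous_on {0<..} f"
  shows "f \<in> borel_measurable lborel_pos"
proof -
  have "f \<in> borel_measurable (restrict_space borel {0<..})"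
    using assms by (rule borel_measurable_continuous_on_restrict)
  also have "borel_measurable (restrict_space borel {0<..}) = (borel_measurable lborel_pos :: (real \<Rightarrow> 'a) set)"
    by (intro measurable_cong_sets sets_restrict_space_cong) auto
  finally show ?thesis .
qed

lemma space_lborel_pos [simp]: "space lborel_pos = {0<..}"
  by (simp add: space_restrict_space)

lemma sigma_finite_lborel_pos: "sigma_finite_measure lborel_pos"
  by (rule sigma_finite_measure_restrict_space) (auto intro: lborel.sigma_finite_measure_axioms)

lemma integral_lborel_pos:
  fixes f :: "real \<Rightarrow> 'a::{banach, second_countable_topology}"
  shows "(LINT x:{0<..}|lborel. f x) = (LINT x|lborel_pos. f x)"
  by (subst integral_restrict_space) (auto simp: set_lebesgue_integral_def)

lemma integrable_lborel_pos:
  fixes f :: "real \<Rightarrow> 'a::{banach, second_countable_topology}"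
  shows "integrable lborel_pos f \<longleftrightarrow> set_integrable lborel {0<..} f"
  by (subst integrable_restrict_space) (auto simp: set_integrable_def)

text \<open>
  The difference quotients are dominated because Cauchy's inequality turns the local bound on the
  integrand into a bound on its derivative; dominated convergence does the rest.
\<close>

lemma has_field_derivative_integral:
  fixes f :: "complex \<Rightarrow> 'a \<Rightarrow> complex"
  assumes holo: "\<And>x. x \<in> space M \<Longrightarrow> (\<lambda>s. f s x) holomorphic_on ball s e"
    and meas: "\<And>w. w \<in> ball s e \<Longrightarrow> f w \<in> borel_measurable M"
    and e: "e > 0"
    and g: "integrable M g"
    and bound: "\<And>w x. w \<in> ball s e \<Longrightarrow> x \<in> space M \<Longrightarrow> norm (f w x) \<le> g x"
  shows "integrable M (\<lambda>x. deriv (\<lambda>s. f s x) s)"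
    and "((\<lambda>s. LINT x|M. f s x) has_field_derivative (LINT x|M. deriv (\<lambda>s. f s x) s)) (at s)"
proof -
  define r where "r = e / 2"
  have r: "r > 0" using e by (simp add: r_def)
  have lip: "norm (f w x - f s x) \<le> 2 * g x / r * norm (w - s)"
    if w: "w \<in> ball s r" and x: "x \<in> space M" for w x
  proof (rule field_differentiable_bound)
    show "convex (ball s r)" by simp
    show "((\<lambda>s. f s x) has_field_derivative deriv (\<lambda>s. f s x) v) (at v within ball s r)" if "v \<in> ball s r" for v
    proof (rule has_field_derivative_at_within, rule holomorphic_derivI[OF holo[OF x]])
      show "v \<in> ball s e" using that e by (auto simp: r_def)
    qed auto
    show "norm (deriv (\<lambda>s. f s x) v) \<le> 2 * g x / r" if v: "v \<in> ball s r" for v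
    proof -
      have sub: "cball v (r / 2) \<subseteq> ball s e"
      proof
        fix y assume "y \<in> cball v (r / 2)"
        hence "dist v y \<le> r / 2" by simp
        moreover have "dist s v < r" using v by simp
        ultimately show "y \<in> ball s e"
          using dist_triangle[of s y v] e by (auto simp: r_def)
      qed
      have "norm ((deriv ^^ 1) (\<lambda>s. f s x) v) \<le> fact 1 * g x / (r / 2) ^ 1"
      proof (rule Cauchy_inequality)
        show "(\<lambda>s. f s x) holomorphic_on ball v (r / 2)"
          by (rule holomorphic_on_subset[OF holo[OF x]]) (use sub in auto)
        show "continuous_on (cball v (r / 2)) (\<lambda>s. f s x)"
          by (rule continuous_on_subset[OF holomorphic_on_imp_continuous_on[OF holo[OF x]] sub])
        show "norm (f w x) \<le> g x" if "norm (v - w) = r / 2" for w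
          using sub that by (intro bound x) (auto simp: dist_norm)
      qed (use r in auto)
      thus ?thesis by (simp add: field_simps)
    qed
  qed (use w r in auto)
  have key: "integrable M (\<lambda>x. deriv (\<lambda>s. f s x) s) \<and>
     (\<lambda>n. LINT x|M. (f (s + h n) x - f s x) / h n) \<longlonglongrightarrow> (LINT x|M. deriv (\<lambda>s. f s x) s)"
    if h: "\<And>n. h n \<noteq> 0" "\<And>n. norm (h n) < r" "h \<longlonglongrightarrow> 0" for h :: "nat \<Rightarrow> complex"
  proof -
    have shb: "s + h n \<in> ball s r" for n using h(2)[of n] by (simp add: dist_norm)
    have she: "s + h n \<in> ball s e" for n using shb[of n] e by (auto simp: r_def)
    have se: "s \<in> ball s e" using e by simp
    have lim: "(\<lambda>n. (f (s + h n) x - f s x) / h n) \<longlonglongrightarrow> deriv (\<lambda>s. f s x) s" if x: "x \<in> space M" for x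
    proof -
      have "((\<lambda>s. f s x) has_field_derivative deriv (\<lambda>s. f s x) s) (at s)"
        by (rule holomorphic_derivI[OF holo[OF x]]) (use se in auto)
      hence "(\<lambda>h. (f (s + h) x - f s x) / h) \<midarrow>0\<rightarrow> deriv (\<lambda>s. f s x) s"
        by (simp add: DERIV_def)
      thus ?thesis
        unfolding tendsto_at_iff_sequentially using h by (auto simp: o_def)
    qed
    have m: "(\<lambda>x. (f (s + h n) x - f s x) / h n) \<in> borel_measurable M" for n
      using meas[OF she[of n]] meas[OF se] by measurable
    have m': "(\<lambda>x. deriv (\<lambda>s. f s x) s) \<in> borel_measurable M"
      by (rule borel_measurable_LIMSEQ_metric[OF m lim])
    have gi: "integrable M (\<lambda>x. 2 * g x / r)" using g by simp
    have b: "norm ((f (s + h n) x - f s x) / h n) \<le> 2 * g x / r" if x: "x \<in> space M" for n x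
    proof -
      have "norm (f (s + h n) x - f s x) \<le> 2 * g x / r * norm (h n)"
        using lip[OF shb[of n] x] by simp
      thus ?thesis using h(1)[of n] unfolding norm_divide by (subst pos_divide_le_eq) auto
    qed
    have "AE x in M. (\<lambda>n. (f (s + h n) x - f s x) / h n) \<longlonglongrightarrow> deriv (\<lambda>s. f s x) s"
      using lim by (rule AE_I2)
    moreover have "AE x in M. norm ((f (s + h n) x - f s x) / h n) \<le> 2 * g x / r" for n
      using b by (rule AE_I2)
    ultimately show ?thesis
      by (intro conjI integrable_dominated_convergence[where s = "\<lambda>n x. (f (s + h n) x - f s x) / h n" and w = "\<lambda>x. 2 * g x / r"]
          integral_dominated_convergence[where s = "\<lambda>n x. (f (s + h n) x - f s x) / h n" and w = "\<lambda>x. 2 * g x / r"] m m' gi)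
  qed
  show "integrable M (\<lambda>x. deriv (\<lambda>s. f s x) s)"
  proof -
    define h :: "nat \<Rightarrow> complex" where "h = (\<lambda>n. of_real (r / 2 / (real n + 1)))"
    have "norm (h n) < r" for n
    proof -
      have "norm (h n) = r / 2 / (real n + 1)"
        unfolding h_def norm_of_real using r by simp
      also have "\<dots> \<le> r / 2 / 1"
        using r by (intro divide_left_mono) auto
      finally show ?thesis using r by linarith
    qed
    moreover have "h \<longlonglongrightarrow> of_real (r/2 * 0)"
      unfolding h_def divide_inverse[of "r/2"]
      by (intro tendsto_intros) (use LIMSEQ_inverse_real_of_nat in \<open>simp add: add.commute\<close>)
    moreover have "h n \<noteq> 0" for n
    proof -
      have "real n + 1 \<noteq> 0" by linarith
      hence "r / 2 / (real n + 1) \<noteq> 0" using r by simp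
      thus ?thesis unfolding h_def of_real_eq_0_iff .
    qed
    ultimately show ?thesis using key[of h] by simp
  qed
  show "((\<lambda>s. LINT x|M. f s x) has_field_derivative (LINT x|M. deriv (\<lambda>s. f s x) s)) (at s)"
    unfolding DERIV_def tendsto_at_iff_sequentially
  proof (intro allI impI)
    fix h :: "nat \<Rightarrow> complex"
    assume h: "\<forall>i. h i \<in> UNIV - {0}" "h \<longlonglongrightarrow> 0"
    from h(2) r have "eventually (\<lambda>n. norm (h n) < r) sequentially"
      by (auto simp: tendsto_iff)
    then obtain N where N: "\<And>n. n \<ge> N \<Longrightarrow> norm (h n) < r"
      by (auto simp: eventually_sequentially)
    have int: "integrable M (f w)" if "w \<in> ball s e" for w
    proof (rule Bochner_Integration.integrable_bound[OF g meas[OF that]], rule AE_I2)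
      show "norm (f w x) \<le> norm (g x)" if "x \<in> space M" for x
        using order.trans[OF bound[OF \<open>w \<in> ball s e\<close> that] abs_ge_self] by simp
    qed
    have "(\<lambda>n. LINT x|M. (f (s + h (n + N)) x - f s x) / h (n + N)) \<longlonglongrightarrow> (LINT x|M. deriv (\<lambda>s. f s x) s)"
    proof (rule conjunct2[OF key[of "\<lambda>n. h (n + N)"]])
      show "h (n + N) \<noteq> 0" "norm (h (n + N)) < r" for n
        using h(1) N by auto
      show "(\<lambda>n. h (n + N)) \<longlonglongrightarrow> 0"
        by (rule LIMSEQ_ignore_initial_segment[OF h(2)])
    qed
    moreover have eq: "(LINT x|M. (f (s + h (n + N)) x - f s x) / h (n + N)) =
        ((LINT x|M. f (s + h (n + N)) x) - (LINT x|M. f s x)) / h (n + N)" for n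
    proof -
      have "s + h (n + N) \<in> ball s e"
        using N[of "n + N"] r by (simp add: dist_norm r_def)
      hence "integrable M (f (s + h (n + N)))" "integrable M (f s)"
        using int e by auto
      thus ?thesis by (simp only: integral_divide_zero Bochner_Integration.integral_diff)
    qed
    ultimately have "(\<lambda>n. ((LINT x|M. f (s + h (n + N)) x) - (LINT x|M. f s x)) / h (n + N)) \<longlonglongrightarrow> (LINT x|M. deriv (\<lambda>s. f s x) s)"
      by (simp only: eq)
    thus "((\<lambda>h. ((LINT x|M. f (s + h) x) - (LINT x|M. f s x)) / h) \<circ> h) \<longlonglongrightarrow> (LINT x|M. deriv (\<lambda>s. f s x) s)"
      unfolding o_def by (rule LIMSEQ_offset[where k = N])
  qed
qed

lemma holomorphic_on_integral:
  fixes f :: "complex \<Rightarrow> 'a \<Rightarrow> complex"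
  assumes "open S"
    and holo: "\<And>x. x \<in> space M \<Longrightarrow> (\<lambda>s. f s x) holomorphic_on S"
    and meas: "\<And>s. s \<in> S \<Longrightarrow> f s \<in> borel_measurable M"
    and bound: "\<And>s. s \<in> S \<Longrightarrow> \<exists>e>0. \<exists>g. ball s e \<subseteq> S \<and> integrable M g \<and>
                   (\<forall>w\<in>ball s e. \<forall>x\<in>space M. norm (f w x) \<le> g x)"
  shows "(\<lambda>s. LINT x|M. f s x) holomorphic_on S"
proof -
  have "\<exists>D. ((\<lambda>s. LINT x|M. f s x) has_field_derivative D) (at s)" if s: "s \<in> S" for s
  proof -
    obtain e where e: "e > 0" and "\<exists>g. ball s e \<subseteq> S \<and> integrable M g \<and>
                   (\<forall>w\<in>ball s e. \<forall>x\<in>space M. norm (f w x) \<le> g x)"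
      using bound[OF s] by blast
    then obtain g where sub: "ball s e \<subseteq> S" and g: "integrable M g"
      and b: "\<forall>w\<in>ball s e. \<forall>x\<in>space M. norm (f w x) \<le> g x"
      by (elim exE conjE)
    have "((\<lambda>s. LINT x|M. f s x) has_field_derivative (LINT x|M. deriv (\<lambda>s. f s x) s)) (at s)"
    proof (rule has_field_derivative_integral(2)[where e = e and g = g])
      show "(\<lambda>s. f s x) holomorphic_on ball s e" if "x \<in> space M" for x
        by (rule holomorphic_on_subset[OF holo[OF that] sub])
      show "f w \<in> borel_measurable M" if "w \<in> ball s e" for w
        using that sub by (intro meas) auto
      show "norm (f w x) \<le> g x" if "w \<in> ball s e" "x \<in> space M" for w x
        using b that by blast
    qed fact+
    thus ?thesis ..
  qed
  thus ?thesis using assms(1) by (simp add: holomorphic_on_open)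
qed

section \<open>The Gamma integral and Mellin inversion of the exponential\<close>

lemma integral_lborel_pos_scale:
  fixes f :: "real \<Rightarrow> complex"
  assumes "c > 0"
  shows "(LINT x|lborel_pos. f x) = of_real c * (LINT y|lborel_pos. f (c * y))"
proof -
  have "(LINT x|lborel_pos. f x) = (LINT x|lborel. indicator {0<..} x *\<^sub>R f x)"
    unfolding integral_lborel_pos[symmetric] set_lebesgue_integral_def ..
  also have "\<dots> = \<bar>c\<bar> *\<^sub>R (LINT y|lborel. indicator {0<..} (0 + c * y) *\<^sub>R f (0 + c * y))"
    by (rule lborel_integral_real_affine) (use assms in auto)
  also have "(\<lambda>y. indicator {0<..} (0 + c * y) *\<^sub>R f (0 + c * y)) = (\<lambda>y. indicator {0<..} y *\<^sub>R f (c * y))"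
    using assms by (auto simp: fun_eq_iff indicator_def zero_less_mult_iff)
  also have "(LINT y|lborel. indicator {0<..} y *\<^sub>R f (c * y)) = (LINT y|lborel_pos. f (c * y))"
    unfolding integral_lborel_pos[symmetric] set_lebesgue_integral_def ..
  finally show ?thesis using assms by (simp add: scaleR_conv_of_real)
qed

lemma powr_pos_real: "r > 0 \<Longrightarrow> complex_of_real r powr w = exp (w * of_real (ln r))"
  by (simp add: powr_def Ln_of_real)

lemma norm_powr_pos_real: "r > 0 \<Longrightarrow> norm (complex_of_real r powr w) = exp (Re w * ln r)"
  by (simp add: powr_pos_real)

lemma integrable_Gamma_kernel_real:
  assumes "a > (0::real)" "c > 0"
  shows "integrable lborel_pos (\<lambda>r. exp (- a * r) * r powr (c - 1))"
proof -
  have "(\<lambda>t. complex_of_real t powr (of_real c - 1) / of_real (exp (a * t))) absolutely_integrable_on {0<..}"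
    by (rule absolutely_integrable_Gamma_integral) (use assms in auto)
  hence "integrable lebesgue (\<lambda>t. indicator {0<..} t *\<^sub>R (complex_of_real t powr (of_real c - 1) / of_real (exp (a * t))))"
    by (simp add: set_integrable_def)
  hence "integrable lebesgue (\<lambda>t. norm (indicator {0<..} t *\<^sub>R (complex_of_real t powr (of_real c - 1) / of_real (exp (a * t)))))"
    by (rule integrable_norm)
  also have "(\<lambda>t. norm (indicator {0<..} t *\<^sub>R (complex_of_real t powr (of_real c - 1) / of_real (exp (a * t))))) =
      (\<lambda>t. indicator {0<..} t *\<^sub>R (exp (- a * t) * t powr (c - 1)))"
    by (auto simp: fun_eq_iff indicator_def norm_divide norm_powr_pos_real powr_def exp_minus field_simps)
  finally have "integrable lborel (\<lambda>t. indicator {0<..} t *\<^sub>R (exp (- a * t) * t powr (c - 1)))"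
    by (subst (asm) integrable_completion) auto
  thus ?thesis by (simp add: integrable_lborel_pos set_integrable_def)
qed

lemma integrable_Gamma_kernel:
  assumes "Re x > 0" "Re s > 0"
  shows "integrable lborel_pos (\<lambda>r. exp (- (x * of_real r)) * complex_of_real r powr (s - 1))"
proof (rule Bochner_Integration.integrable_bound[OF integrable_Gamma_kernel_real[OF assms]])
  show "(\<lambda>r. exp (- (x * of_real r)) * complex_of_real r powr (s - 1)) \<in> borel_measurable lborel_pos"
    by (rule borel_measurable_lborel_pos) (auto intro!: continuous_intros)
  show "AE r in lborel_pos. norm (exp (- (x * of_real r)) * complex_of_real r powr (s - 1)) \<le>
      norm (exp (- Re x * r) * r powr (Re s - 1))"
    by (intro AE_I2) (auto simp: norm_mult norm_powr_pos_real powr_def)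
qed

lemma Gamma_kernel_integral_real:
  assumes "a > 0" "Re s > 0"
  shows "(LINT r|lborel_pos. exp (- (of_real a * of_real r)) * complex_of_real r powr (s - 1)) =
           Gamma s * of_real a powr (- s)"
proof -
  define g :: "real \<Rightarrow> complex" where "g = (\<lambda>r. exp (- of_real r) * of_real r powr (s - 1))"
  have "integrable lborel_pos g"
    using integrable_Gamma_kernel[of 1 s] assms by (simp add: g_def)
  hence "set_integrable lborel {0<..} g"
    by (simp add: integrable_lborel_pos)
  hence "(LINT r|lborel_pos. g r) = integral {0<..} g"
    unfolding integral_lborel_pos[symmetric] by (rule set_borel_integral_eq_integral)
  also have "(g has_integral Gamma s) {0<..}"
    using Gamma_integral_complex'[OF assms(2)]
    by (rule has_integral_eq[rotated]) (auto simp: g_def exp_minus field_simps exp_of_real)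
  hence "integral {0<..} g = Gamma s"
    by (rule integral_unique)
  finally have one: "(LINT r|lborel_pos. g r) = Gamma s" .
  define I where "I = (LINT r|lborel_pos. exp (- (of_real a * of_real r)) * complex_of_real r powr (s - 1))"
  have "Gamma s = of_real a * (LINT r|lborel_pos. g (a * r))"
    unfolding one[symmetric] by (rule integral_lborel_pos_scale) (rule assms)
  also have "(LINT r|lborel_pos. g (a * r)) =
      (LINT r|lborel_pos. of_real a powr (s - 1) * (exp (- (of_real a * of_real r)) * complex_of_real r powr (s - 1)))"
  proof (rule Bochner_Integration.integral_cong)
    fix r assume "r \<in> space lborel_pos"
    hence "complex_of_real (a * r) powr (s - 1) = of_real a powr (s - 1) * of_real r powr (s - 1)"
      using assms unfolding of_real_mult by (intro powr_times_real) auto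
    thus "g (a * r) = of_real a powr (s - 1) * (exp (- (of_real a * of_real r)) * complex_of_real r powr (s - 1))"
      by (simp add: g_def)
  qed simp
  also have "of_real a * \<dots> = of_real a * of_real a powr (s - 1) * I"
    unfolding I_def by (simp only: integral_mult_right_zero mult.assoc)
  also have "complex_of_real a * of_real a powr (s - 1) = of_real a powr s"
    using assms powr_add[of "of_real a" 1 "s - 1"] by simp
  finally have "Gamma s * of_real a powr (- s) = (of_real a powr (- s) * of_real a powr s) * I"
    by (simp only: mult_ac)
  also have "complex_of_real a powr (- s) * of_real a powr s = 1"
    using assms powr_add[of "of_real a" "- s" s] by simp
  finally show ?thesis by (simp add: I_def)
qed

text \<open>
  Both sides are holomorphic in \<open>x\<close> on the right half-plane, and on the positive axis the formula is the
  substitution \<open>r \<mapsto> r / x\<close> in Euler's integral.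
\<close>

lemma Gamma_kernel_integral:
  assumes "Re x > 0" "Re s > 0"
  shows "(LINT r|lborel_pos. exp (- (x * of_real r)) * complex_of_real r powr (s - 1)) =
           Gamma s * x powr (- s)"
proof -
  define F where "F = (\<lambda>x. (LINT r|lborel_pos. exp (- (x * of_real r)) * complex_of_real r powr (s - 1)))"
  have holF: "F holomorphic_on {x. Re x > 0}"
    unfolding F_def
  proof (rule holomorphic_on_integral)
    show "open {x. Re x > 0}" by (rule open_halfspace_Re_gt)
    show "(\<lambda>x. exp (- (x * of_real r)) * complex_of_real r powr (s - 1)) holomorphic_on {x. 0 < Re x}" for r
      by (intro holomorphic_intros)
    show "(\<lambda>r. exp (- (x * of_real r)) * complex_of_real r powr (s - 1)) \<in> borel_measurable lborel_pos" for x
      by (rule borel_measurable_lborel_pos) (auto intro!: continuous_intros)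
    fix x0 assume "x0 \<in> {x. 0 < Re x}"
    hence x0: "Re x0 > 0" by simp
    have half: "Re w > Re x0 / 2" if "w \<in> ball x0 (Re x0 / 2)" for w
      using that abs_Re_le_cmod[of "x0 - w"] by (simp add: dist_norm)
    show "\<exists>e>0. \<exists>g. ball x0 e \<subseteq> {x. 0 < Re x} \<and> integrable lborel_pos g \<and>
       (\<forall>w\<in>ball x0 e. \<forall>r\<in>space lborel_pos. norm (exp (- (w * of_real r)) * complex_of_real r powr (s - 1)) \<le> g r)"
    proof (intro exI conjI ballI)
      show "Re x0 / 2 > 0" using x0 by simp
      show "ball x0 (Re x0 / 2) \<subseteq> {x. 0 < Re x}" using half x0 by fastforce
      show "integrable lborel_pos (\<lambda>r. exp (- (Re x0 / 2) * r) * r powr (Re s - 1))"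
        using x0 assms by (intro integrable_Gamma_kernel_real) auto
      show "norm (exp (- (w * of_real r)) * complex_of_real r powr (s - 1)) \<le> exp (- (Re x0 / 2) * r) * r powr (Re s - 1)"
        if "w \<in> ball x0 (Re x0 / 2)" "r \<in> space lborel_pos" for w r
      proof -
        have "exp (- (Re w * r)) \<le> exp (- (Re x0 / 2) * r)"
          using half[OF that(1)] that(2) by simp
        thus ?thesis using that(2) by (simp add: norm_mult norm_powr_pos_real powr_def)
      qed
    qed
  qed
  have "F x - Gamma s * x powr (- s) = 0"
  proof (rule analytic_continuation[of "\<lambda>x. F x - Gamma s * x powr (- s)" "{x. Re x > 0}" "of_real ` {0<..}" 1])
    have "\<And>x. Re x > 0 \<Longrightarrow> x \<notin> \<real>\<^sub>\<le>\<^sub>0"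
      by (auto simp: complex_nonpos_Reals_iff)
    thus "(\<lambda>x. F x - Gamma s * x powr (- s)) holomorphic_on {x. Re x > 0}"
      by (intro holomorphic_intros holF) auto
    show "connected {x. Re x > 0}"
      by (intro convex_connected convex_halfspace_Re_gt)
    show "(1::complex) islimpt of_real ` {0<..}"
    proof (subst islimpt_approachable, intro allI impI)
      fix e :: real assume "e > 0"
      thus "\<exists>x'\<in>of_real ` {0<..}. x' \<noteq> 1 \<and> dist x' (1::complex) < e"
        by (intro bexI[of _ "of_real (1 + e / 2)"] imageI) (auto simp: dist_norm norm_divide)
    qed
  qed (use assms Gamma_kernel_integral_real open_halfspace_Re_gt[of 0] in \<open>auto simp: F_def\<close>)
  thus ?thesis by (simp add: F_def)
qed

lemma integrable_exp_substitution:
  fixes f :: "real \<Rightarrow> real"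
  assumes f: "integrable lborel_pos f"
  shows "integrable lborel (\<lambda>v. exp v * f (exp v))"
    and "(LINT v|lborel. exp v * f (exp v)) = (LINT r|lborel_pos. f r)"
proof -
  have [measurable]: "f \<in> borel_measurable lborel_pos" using f by auto
  have [measurable]: "exp \<in> lborel \<rightarrow>\<^sub>M lborel_pos"
    by (rule measurable_restrict_space2) auto
  have m: "(\<lambda>v. exp v * f (exp v)) \<in> borel_measurable lborel"
    by measurable
  have si: "set_integrable lborel {0<..} f"
    using f by (simp add: integrable_lborel_pos)
  have ai: "f absolutely_integrable_on {0<..}"
    using si unfolding set_integrable_def
    by (subst integrable_completion) (auto dest: borel_measurable_integrable)
  have img: "exp ` UNIV = {0::real<..}"
    by (auto simp: image_iff intro: exI[of _ "ln _"] dest: exp_ln[symmetric])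
  have "(\<lambda>v. \<bar>exp v\<bar> * f (exp v)) absolutely_integrable_on UNIV \<and>
      integral UNIV (\<lambda>v. \<bar>exp v\<bar> * f (exp v)) = integral {0<..} f"
    by (subst has_absolute_integral_change_of_variables_1'[where g = exp and S = UNIV])
       (use ai img in \<open>auto intro!: derivative_eq_intros simp: inj_on_def\<close>)
  hence *: "(\<lambda>v. exp v * f (exp v)) absolutely_integrable_on UNIV"
      "integral UNIV (\<lambda>v. exp v * f (exp v)) = integral {0<..} f" by auto
  from *(1) show int: "integrable lborel (\<lambda>v. exp v * f (exp v))"
    using m by (simp add: set_integrable_def integrable_completion)
  have "(LINT v|lborel. exp v * f (exp v)) = integral UNIV (\<lambda>v. exp v * f (exp v))"
    using set_borel_integral_eq_integral(2)[of UNIV "\<lambda>v. exp v * f (exp v)"] int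
    by (simp add: set_integrable_def set_lebesgue_integral_def)
  also have "\<dots> = (LINT r|lborel_pos. f r)"
    using set_borel_integral_eq_integral(2)[OF si] *(2) by (simp add: integral_lborel_pos)
  finally show "(LINT v|lborel. exp v * f (exp v)) = (LINT r|lborel_pos. f r)" .
qed

text \<open>
  The logarithmic substitution turns Mellin transforms into Fourier transforms.
\<close>

lemma integral_exp_substitution:
  fixes f :: "real \<Rightarrow> complex"
  assumes f: "integrable lborel_pos f"
  shows "(LINT v|lborel. of_real (exp v) * f (exp v)) = (LINT r|lborel_pos. f r)"
proof -
  have [measurable]: "f \<in> borel_measurable lborel_pos" using f by auto
  have [measurable]: "exp \<in> lborel \<rightarrow>\<^sub>M lborel_pos"
    by (rule measurable_restrict_space2) auto
  have "integrable lborel (\<lambda>v. exp v * norm (f (exp v)))"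
    by (rule integrable_exp_substitution) (use f in auto)
  hence int: "integrable lborel (\<lambda>v. of_real (exp v) * f (exp v))"
    by (rule Bochner_Integration.integrable_bound) (auto simp: norm_mult)
  show ?thesis
  proof (rule complex_eqI)
    show "Re (LINT v|lborel. of_real (exp v) * f (exp v)) = Re (LINT r|lborel_pos. f r)"
      using integrable_exp_substitution(2)[of "\<lambda>r. Re (f r)"] f int
      by (simp flip: integral_Re)
    show "Im (LINT v|lborel. of_real (exp v) * f (exp v)) = Im (LINT r|lborel_pos. f r)"
      using integrable_exp_substitution(2)[of "\<lambda>r. Im (f r)"] f int
      by (simp flip: integral_Im)
  qed
qed

lemma (in pair_sigma_finite) integrable_pair_product_bound:
  fixes h :: "'a \<Rightarrow> 'b \<Rightarrow> 'c::{banach, second_countable_topology}" and f :: "'a \<Rightarrow> real"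
  assumes h: "case_prod h \<in> borel_measurable (M1 \<Otimes>\<^sub>M M2)"
    and f: "integrable M1 f" and g: "integrable M2 g"
    and b: "\<And>x y. x \<in> space M1 \<Longrightarrow> y \<in> space M2 \<Longrightarrow> norm (h x y) \<le> f x * g y"
  shows "integrable (M1 \<Otimes>\<^sub>M M2) (case_prod h)"
proof (rule Bochner_Integration.integrable_bound)
  have [measurable]: "f \<in> borel_measurable M1" "g \<in> borel_measurable M2"
    using f g by auto
  show "integrable (M1 \<Otimes>\<^sub>M M2) (\<lambda>(x, y). f x * g y)"
  proof (rule Fubini_integrable)
    show "integrable M1 (\<lambda>x. LINT y|M2. norm (case (x, y) of (x, y) \<Rightarrow> f x * g y))"
      using f g by (simp add: abs_mult)
    show "AE x in M1. integrable M2 (\<lambda>y. case (x, y) of (x, y) \<Rightarrow> f x * g y)"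
      using g by simp
  qed measurable
  show "AE x in M1 \<Otimes>\<^sub>M M2. norm (case_prod h x) \<le> norm (case x of (x, y) \<Rightarrow> f x * g y)"
  proof (rule AE_I2)
    fix z assume z: "z \<in> space (M1 \<Otimes>\<^sub>M M2)"
    then obtain x y where "z = (x, y)" "x \<in> space M1" "y \<in> space M2"
      by (auto simp: space_pair_measure)
    thus "norm (case_prod h z) \<le> norm (case z of (x, y) \<Rightarrow> f x * g y)"
      using order.trans[OF b abs_ge_self] by simp
  qed
qed (rule h)

lemma gaussian_fourier:
  assumes "\<epsilon> > 0"
  shows "integrable lborel (\<lambda>t. exp (- (\<epsilon> * t)\<^sup>2 / 2))"
    and "(LINT t|lborel. exp (\<i> * of_real (t * v)) * of_real (exp (- (\<epsilon> * t)\<^sup>2 / 2))) =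
           of_real (sqrt (2 * pi) / \<epsilon> * exp (- (v / \<epsilon>)\<^sup>2 / 2))"
proof -
  have one: "integrable lborel (\<lambda>t. exp (- t\<^sup>2 / 2 :: real))"
  proof -
    have "integrable lborel (\<lambda>t. sqrt (2 * pi) * std_normal_density t)"
      using integrable_normal_density[of 1 0] by (intro integrable_mult_right) auto
    thus ?thesis by (simp add: std_normal_density_def)
  qed
  show "integrable lborel (\<lambda>t. exp (- (\<epsilon> * t)\<^sup>2 / 2))"
    using lborel_integrable_real_affine[OF one, of \<epsilon> 0] assms by simp
  have "(LINT t|lborel. exp (\<i> * of_real (t * w)) * of_real (exp (- t\<^sup>2 / 2))) =
      of_real (sqrt (2 * pi) * exp (- w\<^sup>2 / 2))" for w
  proof -
    have "of_real (exp (- w\<^sup>2 / 2)) = char std_normal_distribution w"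
      by (simp add: char_std_normal_distribution)
    also have "\<dots> = (LINT t|lborel. std_normal_density t *\<^sub>R iexp (w * t))"
      unfolding char_def by (rule integral_density) (auto simp: normal_density_nonneg)
    also have "\<dots> = (LINT t|lborel. of_real (1 / sqrt (2 * pi)) * (exp (\<i> * of_real (t * w)) * of_real (exp (- t\<^sup>2 / 2))))"
      by (rule Bochner_Integration.integral_cong)
         (auto simp: std_normal_density_def scaleR_conv_of_real mult_ac)
    also have "\<dots> = of_real (1 / sqrt (2 * pi)) * (LINT t|lborel. exp (\<i> * of_real (t * w)) * of_real (exp (- t\<^sup>2 / 2)))"
      by (rule integral_mult_right_zero)
    finally show ?thesis by (simp add: field_simps)
  qed
  note * = this[of "v / \<epsilon>"]
  have "(LINT t|lborel. exp (\<i> * of_real (t * (v / \<epsilon>))) * of_real (exp (- t\<^sup>2 / 2))) =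
     \<bar>\<epsilon>\<bar> *\<^sub>R (LINT t|lborel. exp (\<i> * of_real ((0 + \<epsilon> * t) * (v / \<epsilon>))) * of_real (exp (- (0 + \<epsilon> * t)\<^sup>2 / 2)))"
    by (rule lborel_integral_real_affine) (use assms in auto)
  also have "(\<lambda>t. exp (\<i> * of_real ((0 + \<epsilon> * t) * (v / \<epsilon>))) * complex_of_real (exp (- (0 + \<epsilon> * t)\<^sup>2 / 2))) =
     (\<lambda>t. exp (\<i> * of_real (t * v)) * of_real (exp (- (\<epsilon> * t)\<^sup>2 / 2)))"
    using assms by (simp add: fun_eq_iff)
  finally show "(LINT t|lborel. exp (\<i> * of_real (t * v)) * of_real (exp (- (\<epsilon> * t)\<^sup>2 / 2))) =
           of_real (sqrt (2 * pi) / \<epsilon> * exp (- (v / \<epsilon>)\<^sup>2 / 2))"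
    unfolding * using assms by (simp add: scaleR_conv_of_real field_simps)
qed

text \<open>
  Turning \<open>x\<close> by a small angle \<open>\<plusminus>\<delta>\<close> keeps it in the right half-plane and multiplies the modulus of
  \<open>x\<^sup>-\<^sup>s\<close>, at \<open>s = c + i t\<close>, by \<open>exp (\<plusminus>\<delta>t)\<close>. Euler's integral bounds both turned quantities independently
  of \<open>t\<close>, so the original one is \<open>O(1 / cosh (\<delta>t))\<close> and hence integrable in \<open>t\<close>.
\<close>

lemma Gamma_vertical_bound:
  assumes x: "Re x > 0" and c: "c > 0"
  obtains B where "\<And>t. norm (Gamma (Complex c t) * x powr (- Complex c t)) \<le> B * inverse (1 + t\<^sup>2)"
proof -
  \<comment> \<open>Half of the room that the argument of \<open>x\<close> leaves to the imaginary axis.\<close>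
  define \<delta> where "\<delta> = (pi / 2 - \<bar>Im (Ln x)\<bar>) / 2"
  have x0: "x \<noteq> 0" using x by auto
  have \<delta>: "\<delta> > 0" using Re_Ln_pos_lt[OF x0] x by (simp add: \<delta>_def)
  define B where "B = (\<lambda>\<sigma>. LINT r|lborel_pos. exp (- Re (exp (Ln x + \<i> * of_real (\<sigma> * \<delta>))) * r) * r powr (c - 1))"
  have side: "norm (Gamma (Complex c t) * x powr (- Complex c t)) * exp (\<sigma> * \<delta> * t) \<le> B \<sigma>"
    if \<sigma>: "\<sigma> \<in> {1, -1}" for \<sigma> t
  proof -
    define y where "y = exp (Ln x + \<i> * of_real (\<sigma> * \<delta>))"
    have im: "\<bar>Im (Ln x + \<i> * of_real (\<sigma> * \<delta>))\<bar> < pi / 2"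
      using \<sigma> \<delta> by (auto simp: \<delta>_def abs_if field_simps split: if_splits)
    have lny: "Ln y = Ln x + \<i> * of_real (\<sigma> * \<delta>)"
      unfolding y_def using im by (intro Ln_exp) linarith+
    have y: "Re y > 0" using Re_Ln_pos_lt[of y] im lny by (simp add: y_def)
    have "y powr (- Complex c t) = x powr (- Complex c t) * exp (- (Complex c t) * (\<i> * of_real (\<sigma> * \<delta>)))"
      using x0 lny by (simp add: powr_def y_def flip: exp_add) (simp add: algebra_simps)
    hence "norm (y powr (- Complex c t)) = norm (x powr (- Complex c t)) * exp (\<sigma> * \<delta> * t)"
      by (simp add: norm_mult mult_ac)
    hence "norm (Gamma (Complex c t) * x powr (- Complex c t)) * exp (\<sigma> * \<delta> * t) =
        norm (Gamma (Complex c t) * y powr (- Complex c t))"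
      by (simp add: norm_mult)
    also have "\<dots> = norm (LINT r|lborel_pos. exp (- (y * of_real r)) * complex_of_real r powr (Complex c t - 1))"
      by (subst Gamma_kernel_integral) (use y c in auto)
    also have "\<dots> \<le> (LINT r|lborel_pos. norm (exp (- (y * of_real r)) * complex_of_real r powr (Complex c t - 1)))"
      by (rule integral_norm_bound)
    also have "\<dots> = B \<sigma>"
      unfolding B_def y_def[symmetric]
      by (rule Bochner_Integration.integral_cong) (auto simp: norm_mult norm_powr_pos_real powr_def)
    finally show ?thesis .
  qed
  define m where "m = min 2 (\<delta>\<^sup>2 / 2)"
  have m: "m > 0" using \<delta> by (simp add: m_def)
  have cosh: "m * (1 + t\<^sup>2) \<le> exp (1 * \<delta> * t) + exp (- 1 * \<delta> * t)" for t
  proof -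
    have "exp (\<delta> * \<bar>t\<bar>) \<ge> 1 + \<delta> * \<bar>t\<bar> + (\<delta> * \<bar>t\<bar>)\<^sup>2 / 2"
      using \<delta> by (intro exp_lower_Taylor_quadratic) auto
    moreover have "exp (- (\<delta> * \<bar>t\<bar>)) \<ge> 1 + - (\<delta> * \<bar>t\<bar>)"
      by (rule exp_ge_add_one_self)
    ultimately have "2 + \<delta>\<^sup>2 / 2 * t\<^sup>2 \<le> exp (\<delta> * \<bar>t\<bar>) + exp (- (\<delta> * \<bar>t\<bar>))"
      by (simp add: power_mult_distrib)
    also have "\<dots> = exp (1 * \<delta> * t) + exp (- 1 * \<delta> * t)"
      by (simp add: abs_if)
    finally have "2 + \<delta>\<^sup>2 / 2 * t\<^sup>2 \<le> exp (1 * \<delta> * t) + exp (- 1 * \<delta> * t)" .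
    moreover have "m * 1 \<le> 2"
      by (simp add: m_def)
    moreover have "m * t\<^sup>2 \<le> \<delta>\<^sup>2 / 2 * t\<^sup>2"
      by (intro mult_right_mono) (simp_all add: m_def)
    ultimately show ?thesis by (simp add: distrib_left)
  qed
  show ?thesis
  proof (rule that[of "(B 1 + B (-1)) / m"])
    fix t
    let ?N = "norm (Gamma (Complex c t) * x powr (- Complex c t))"
    have "?N * (m * (1 + t\<^sup>2)) \<le> ?N * (exp (1 * \<delta> * t) + exp (- 1 * \<delta> * t))"
      by (intro mult_left_mono cosh) auto
    also have "\<dots> \<le> B 1 + B (-1)"
      using side[of 1 t] side[of "-1" t] by (simp add: distrib_left)
    finally have "?N * (m * (1 + t\<^sup>2)) \<le> B 1 + B (-1)" .
    moreover have "1 + t\<^sup>2 > 0" by (simp add: add_pos_nonneg)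
    ultimately have "?N \<le> (B 1 + B (-1)) / (m * (1 + t\<^sup>2))"
      using m by (subst pos_le_divide_eq) auto
    thus "?N \<le> (B 1 + B (-1)) / m * inverse (1 + t\<^sup>2)"
      by (simp add: divide_inverse mult.assoc)
  qed
qed

lemma continuous_Gamma_vertical:
  assumes x: "x \<noteq> 0" and c: "c > 0"
  shows "continuous_on UNIV (\<lambda>t. Gamma (Complex c t) * x powr (- Complex c t))"
proof -
  have pos: "s \<notin> \<int>\<^sub>\<le>\<^sub>0" if "Re s > 0" for s :: complex
    using that by (auto elim!: nonpos_Ints_cases)
  have "(\<lambda>s. Gamma s * x powr (- s)) holomorphic_on {s. Re s > 0}"
    using x pos by (intro holomorphic_intros) auto
  hence "continuous_on {s. Re s > 0} (\<lambda>s. Gamma s * x powr (- s))"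
    by (rule holomorphic_on_imp_continuous_on)
  moreover have "continuous_on UNIV (\<lambda>t. Complex c t)"
    by (intro continuous_intros)
  ultimately show ?thesis
    by (rule continuous_on_compose2) (use c in auto)
qed

lemma integrable_Gamma_vertical:
  assumes x: "Re x > 0" and c: "c > 0"
  shows "integrable lborel (\<lambda>t. Gamma (Complex c t) * x powr (- Complex c t))"
proof -
  obtain B where B: "\<And>t. norm (Gamma (Complex c t) * x powr (- Complex c t)) \<le> B * inverse (1 + t\<^sup>2)"
    using Gamma_vertical_bound[OF x c] by blast
  have "integrable lborel (\<lambda>t::real. inverse (1 + t\<^sup>2))"
    using integrable_inverse_1_plus_square by (simp add: set_integrable_def)
  hence "integrable lborel (\<lambda>t::real. B * inverse (1 + t\<^sup>2))" by simp
  thus ?thesis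
  proof (rule Bochner_Integration.integrable_bound)
    have "x \<noteq> 0" using x by auto
    from continuous_Gamma_vertical[OF this c]
    show "(\<lambda>t. Gamma (Complex c t) * x powr (- Complex c t)) \<in> borel_measurable lborel"
      by (simp add: borel_measurable_continuous_onI)
  qed (intro AE_I2, use order.trans[OF B abs_ge_self] in simp)
qed

text \<open>
  This is Fourier inversion for \<open>v \<mapsto> exp (c v - x exp v)\<close> at \<open>v = 0\<close>. The integrand on the line is damped by
  a Gaussian factor; then Fubini's theorem applies, the inner integral is again a Gaussian, and it
  concentrates at \<open>v = 0\<close> as the damping is removed. Dominated convergence is available on both sides.
\<close>

lemma Mellin_inversion_exp:
  assumes x: "Re x > 0" and c: "c > 0"
  shows "(LINT t|lborel. Gamma (Complex c t) * x powr (- Complex c t)) = 2 * of_real pi * exp (- x)"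
proof -
  define G where "G = (\<lambda>t. Gamma (Complex c t) * x powr (- Complex c t))"
  define K where "K = (\<lambda>r. exp (- (x * of_real r)) * complex_of_real r powr (of_real c - 1))"
  define k where "k = (\<lambda>v. exp (of_real (c * v) - x * of_real (exp v)))"
  define L where "L = (\<lambda>\<epsilon>. LINT t|lborel. G t * of_real (exp (- (\<epsilon> * t)\<^sup>2 / 2)))"
  have Gi: "integrable lborel G"
    unfolding G_def by (rule integrable_Gamma_vertical[OF x c])
  hence [measurable]: "G \<in> borel_measurable borel" by auto
  have Ki: "integrable lborel_pos K"
    unfolding K_def using x c by (intro integrable_Gamma_kernel) auto
  have [measurable]: "K \<in> borel_measurable lborel_pos" using Ki by auto
  have [measurable]: "ln \<in> borel_measurable lborel_pos"
    by (rule borel_measurable_lborel_pos) (auto intro!: continuous_intros)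
  have [measurable]: "k \<in> borel_measurable borel"
    unfolding k_def by (intro borel_measurable_continuous_onI continuous_intros)
  have GK: "G t = (LINT r|lborel_pos. K r * exp (\<i> * of_real (t * ln r)))" for t
  proof -
    have "G t = (LINT r|lborel_pos. exp (- (x * of_real r)) * complex_of_real r powr (Complex c t - 1))"
      unfolding G_def using x c by (subst Gamma_kernel_integral) auto
    also have "\<dots> = (LINT r|lborel_pos. K r * exp (\<i> * of_real (t * ln r)))"
    proof (rule Bochner_Integration.integral_cong)
      fix r assume "r \<in> space lborel_pos"
      hence r: "r > 0" by simp
      have "Complex c t - 1 = (of_real c - 1) + \<i> * of_real t" by (simp add: complex_eq_iff)
      hence "complex_of_real r powr (Complex c t - 1) = of_real r powr (of_real c - 1) * exp (\<i> * of_real (t * ln r))"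
        using r by (simp add: powr_pos_real algebra_simps flip: exp_add)
      thus "exp (- (x * of_real r)) * complex_of_real r powr (Complex c t - 1) = K r * exp (\<i> * of_real (t * ln r))"
        by (simp add: K_def)
    qed simp
    finally show ?thesis .
  qed
  have L1: "L \<epsilon> = of_real (sqrt (2 * pi)) * (LINT y|lborel. k (\<epsilon> * y) * of_real (exp (- y\<^sup>2 / 2)))"
    if \<epsilon>: "\<epsilon> > 0" for \<epsilon>
  proof -
    interpret P: pair_sigma_finite lborel lborel_pos
      by (intro pair_sigma_finite.intro sigma_finite_lborel_pos lborel.sigma_finite_measure_axioms)
    have "L \<epsilon> = (LINT t|lborel. LINT r|lborel_pos. K r * exp (\<i> * of_real (t * ln r)) * of_real (exp (- (\<epsilon> * t)\<^sup>2 / 2)))"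
      unfolding L_def GK by (simp only: integral_mult_left_zero)
    also have "\<dots> = (LINT r|lborel_pos. LINT t|lborel. K r * exp (\<i> * of_real (t * ln r)) * of_real (exp (- (\<epsilon> * t)\<^sup>2 / 2)))"
    proof (rule P.Fubini_integral[symmetric], rule P.integrable_pair_product_bound)
      show "integrable lborel (\<lambda>t. exp (- (\<epsilon> * t)\<^sup>2 / 2))" by (rule gaussian_fourier[OF \<epsilon>])
      show "integrable lborel_pos (\<lambda>r. norm (K r))" using Ki by simp
    qed (measurable, simp add: norm_mult mult_ac)
    also have "\<dots> = (LINT r|lborel_pos. K r * of_real (sqrt (2 * pi) / \<epsilon> * exp (- (ln r / \<epsilon>)\<^sup>2 / 2)))"
      unfolding mult.assoc by (simp only: integral_mult_right_zero gaussian_fourier(2)[OF \<epsilon>])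
    also have "\<dots> = (LINT v|lborel. of_real (exp v) * (K (exp v) * of_real (sqrt (2 * pi) / \<epsilon> * exp (- (ln (exp v) / \<epsilon>)\<^sup>2 / 2))))"
    proof (rule integral_exp_substitution[symmetric])
      have "integrable lborel_pos (\<lambda>r. norm (K r) * (sqrt (2 * pi) / \<epsilon>))" using Ki by simp
      thus "integrable lborel_pos (\<lambda>r. K r * of_real (sqrt (2 * pi) / \<epsilon> * exp (- (ln r / \<epsilon>)\<^sup>2 / 2)))"
      proof (rule Bochner_Integration.integrable_bound)
        show "AE r in lborel_pos. norm (K r * of_real (sqrt (2 * pi) / \<epsilon> * exp (- (ln r / \<epsilon>)\<^sup>2 / 2)))
            \<le> norm (norm (K r) * (sqrt (2 * pi) / \<epsilon>))"
        proof (rule AE_I2)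
          fix r :: real
          have "\<bar>sqrt (2 * pi) / \<epsilon> * exp (- (ln r / \<epsilon>)\<^sup>2 / 2)\<bar> \<le> sqrt (2 * pi) / \<epsilon> * 1"
            using \<epsilon> unfolding abs_mult by (intro mult_mono) auto
          from mult_left_mono[OF this, of "norm (K r)"]
          show "norm (K r * of_real (sqrt (2 * pi) / \<epsilon> * exp (- (ln r / \<epsilon>)\<^sup>2 / 2)))
            \<le> norm (norm (K r) * (sqrt (2 * pi) / \<epsilon>))"
            using \<epsilon> unfolding norm_mult[of "K r"] norm_of_real by simp
        qed
      qed measurable
    qed
    also have "\<dots> = (LINT v|lborel. k v * of_real (sqrt (2 * pi) / \<epsilon> * exp (- (v / \<epsilon>)\<^sup>2 / 2)))"
    proof (rule Bochner_Integration.integral_cong)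
      fix v :: real
      have "of_real (exp v) * K (exp v) = k v"
      proof -
        have "of_real (exp v) * (exp (- (x * of_real (exp v))) * complex_of_real (exp v) powr (of_real c - 1)) =
            exp (of_real v) * (exp (- (x * of_real (exp v))) * exp ((of_real c - 1) * of_real v))"
          by (subst powr_pos_real) (auto simp: exp_of_real)
        also have "\<dots> = exp (of_real v + (- (x * of_real (exp v)) + (of_real c - 1) * of_real v))"
          by (simp only: exp_add)
        finally show ?thesis by (simp add: K_def k_def algebra_simps)
      qed
      thus "of_real (exp v) * (K (exp v) * of_real (sqrt (2 * pi) / \<epsilon> * exp (- (ln (exp v) / \<epsilon>)\<^sup>2 / 2))) =
          k v * of_real (sqrt (2 * pi) / \<epsilon> * exp (- (v / \<epsilon>)\<^sup>2 / 2))"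
        unfolding mult.assoc[symmetric] by simp
    qed simp
    also have "\<dots> = \<bar>\<epsilon>\<bar> *\<^sub>R (LINT y|lborel. k (0 + \<epsilon> * y) * of_real (sqrt (2 * pi) / \<epsilon> * exp (- ((0 + \<epsilon> * y) / \<epsilon>)\<^sup>2 / 2)))"
      by (rule lborel_integral_real_affine) (use \<epsilon> in auto)
    also have "(\<lambda>y. k (0 + \<epsilon> * y) * complex_of_real (sqrt (2 * pi) / \<epsilon> * exp (- ((0 + \<epsilon> * y) / \<epsilon>)\<^sup>2 / 2))) =
        (\<lambda>y. of_real (sqrt (2 * pi) / \<epsilon>) * (k (\<epsilon> * y) * of_real (exp (- y\<^sup>2 / 2))))"
      using \<epsilon> by (simp add: fun_eq_iff)
    also have "\<bar>\<epsilon>\<bar> *\<^sub>R (LINT y|lborel. of_real (sqrt (2 * pi) / \<epsilon>) * (k (\<epsilon> * y) * of_real (exp (- y\<^sup>2 / 2)))) =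
       of_real (sqrt (2 * pi)) * (LINT y|lborel. k (\<epsilon> * y) * of_real (exp (- y\<^sup>2 / 2)))"
      unfolding integral_mult_right_zero using \<epsilon> by (simp add: scaleR_conv_of_real)
    finally show ?thesis .
  qed
  have kb: "norm (k v) \<le> exp (- c * (1 + ln (Re x / c)))" for v
  proof -
    have "1 + (v + ln (Re x / c)) \<le> exp (v + ln (Re x / c))" by (rule exp_ge_add_one_self)
    also have "\<dots> = exp v * (Re x / c)" using x c by (simp add: exp_add)
    finally have "c * (1 + (v + ln (Re x / c))) \<le> exp v * Re x" using c by (simp add: field_simps)
    thus ?thesis by (simp add: k_def algebra_simps)
  qed
  define e :: "nat \<Rightarrow> real" where "e = (\<lambda>n. inverse (real (Suc n)))"
  have e: "e n > 0" for n by (simp add: e_def)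
  have e0: "e \<longlonglongrightarrow> 0" unfolding e_def by (rule LIMSEQ_inverse_real_of_nat)
  have "(\<lambda>n. L (e n)) \<longlonglongrightarrow> (LINT t|lborel. G t * of_real (exp (- (0 * t)\<^sup>2 / 2)))"
    unfolding L_def
  proof (rule integral_dominated_convergence[where w = "\<lambda>t. norm (G t)"])
    show "AE t in lborel. (\<lambda>n. G t * of_real (exp (- (e n * t)\<^sup>2 / 2))) \<longlonglongrightarrow> G t * of_real (exp (- (0 * t)\<^sup>2 / 2))"
      by (intro AE_I2 tendsto_intros e0) auto
    show "AE t in lborel. norm (G t * of_real (exp (- (e n * t)\<^sup>2 / 2))) \<le> norm (G t)" for n
      by (intro AE_I2) (auto simp: norm_mult intro!: mult_left_le)
  qed (use Gi in \<open>measurable, simp\<close>)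
  moreover have "(\<lambda>n. L (e n)) \<longlonglongrightarrow> of_real (sqrt (2 * pi)) * (LINT y|lborel. k (0 * y) * of_real (exp (- y\<^sup>2 / 2)))"
    unfolding L1[OF e]
  proof (rule tendsto_mult[OF tendsto_const],
         rule integral_dominated_convergence[where w = "\<lambda>y. exp (- c * (1 + ln (Re x / c))) * exp (- y\<^sup>2 / 2)"])
    show "integrable lborel (\<lambda>y. exp (- c * (1 + ln (Re x / c))) * exp (- y\<^sup>2 / 2))"
      using gaussian_fourier(1)[of 1] by simp
    have "continuous_on UNIV k" unfolding k_def by (intro continuous_intros)
    hence kc: "isCont k v" for v by (simp add: continuous_on_eq_continuous_at)
    show "AE y in lborel. (\<lambda>n. k (e n * y) * of_real (exp (- y\<^sup>2 / 2))) \<longlonglongrightarrow> k (0 * y) * of_real (exp (- y\<^sup>2 / 2))"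
      by (intro AE_I2 tendsto_intros isCont_tendsto_compose[OF kc] e0)
    show "AE y in lborel. norm (k (e n * y) * of_real (exp (- y\<^sup>2 / 2))) \<le> exp (- c * (1 + ln (Re x / c))) * exp (- y\<^sup>2 / 2)" for n
    proof (rule AE_I2)
      fix y :: real
      show "norm (k (e n * y) * of_real (exp (- y\<^sup>2 / 2))) \<le> exp (- c * (1 + ln (Re x / c))) * exp (- y\<^sup>2 / 2)"
        unfolding norm_mult by (intro mult_mono kb) auto
    qed
  qed measurable
  ultimately have "(LINT t|lborel. G t * of_real (exp (- (0 * t)\<^sup>2 / 2))) =
     of_real (sqrt (2 * pi)) * (LINT y|lborel. k (0 * y) * of_real (exp (- y\<^sup>2 / 2)))"
    by (rule LIMSEQ_unique)
  also have "(LINT y|lborel. k (0 * y) * of_real (exp (- y\<^sup>2 / 2))) = k 0 * (LINT y|lborel. of_real (exp (- y\<^sup>2 / 2)))"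
    by simp
  also have "(LINT y|lborel. complex_of_real (exp (- y\<^sup>2 / 2))) = of_real (sqrt (2 * pi))"
    using gaussian_fourier(2)[of 1 0] by simp
  also have "of_real (sqrt (2 * pi)) * (k 0 * of_real (sqrt (2 * pi))) = 2 * of_real pi * exp (- x)"
  proof -
    have "complex_of_real (sqrt (2 * pi)) * of_real (sqrt (2 * pi)) = of_real (2 * pi)"
      unfolding of_real_mult[symmetric] by simp
    thus ?thesis by (simp add: k_def mult_ac)
  qed
  finally show ?thesis by (simp add: G_def)
qed

section \<open>The coefficient functions as Laplace transforms\<close>

text \<open>
  The inverse Laplace transform of \<open>((a - x) / (a + x))\<^sup>n - (-1)\<^sup>n\<close>, obtained from the binomial expansion of
  \<open>(-1 + 2a / (a + x))\<^sup>n\<close>.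
\<close>

definition laguerre_density :: "real \<Rightarrow> nat \<Rightarrow> real \<Rightarrow> real" where
  "laguerre_density a n u =
     (\<Sum>i=1..n. real (n choose i) * (-1) ^ (n - i) * (2 * a) ^ i * u ^ (i - 1) / fact (i - 1)) * exp (- a * u)"

lemma one_plus_of_real_nonzero: "u > 0 \<Longrightarrow> 1 + complex_of_real u \<noteq> 0"
proof
  assume "u > 0" "1 + complex_of_real u = 0"
  hence "Re (1 + complex_of_real u) = 0" by simp
  thus False using \<open>u > 0\<close> by simp
qed

lemma borel_measurable_laguerre_density [measurable]: "laguerre_density a n \<in> borel_measurable borel"
  unfolding laguerre_density_def by measurable

lemma integrable_exp_power:
  assumes "a > 0"
  shows "integrable lborel_pos (\<lambda>u. u ^ m * exp (- a * u))"
proof -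
  have "integrable lborel_pos (\<lambda>u. exp (- a * u) * u powr (real (Suc m) - 1))"
    by (rule integrable_Gamma_kernel_real) (use assms in auto)
  thus ?thesis
    by (rule Bochner_Integration.integrable_cong[THEN iffD1, rotated -1]) (auto simp: powr_realpow)
qed

lemma integrable_laguerre_density_exp:
  assumes "b < a"
  shows "integrable lborel_pos (\<lambda>u. exp (b * u) * laguerre_density a n u)"
proof -
  have "integrable lborel_pos (\<lambda>u. \<Sum>i=1..n. real (n choose i) * (-1) ^ (n - i) * (2 * a) ^ i / fact (i - 1) *
           (u ^ (i - 1) * exp (- (a - b) * u)))"
    by (intro Bochner_Integration.integrable_sum integrable_mult_right integrable_exp_power) (use assms in auto)
  also have "(\<lambda>u. \<Sum>i=1..n. real (n choose i) * (-1) ^ (n - i) * (2 * a) ^ i / fact (i - 1) *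
           (u ^ (i - 1) * exp (- (a - b) * u))) = (\<lambda>u. exp (b * u) * laguerre_density a n u)"
  proof
    fix u :: real
    have "exp (- (a - b) * u) = exp (b * u) * exp (- a * u)"
      by (simp add: left_diff_distrib flip: exp_add)
    thus "(\<Sum>i=1..n. real (n choose i) * (-1) ^ (n - i) * (2 * a) ^ i / fact (i - 1) *
           (u ^ (i - 1) * exp (- (a - b) * u))) = exp (b * u) * laguerre_density a n u"
      by (simp add: laguerre_density_def sum_distrib_left sum_distrib_right mult_ac)
  qed
  finally show ?thesis .
qed

text \<open>
  A power of \<open>1 + u\<close> costs an arbitrarily small exponential, because \<open>d (1 + u) \<le> exp (d u)\<close> for \<open>0 < d \<le> 1\<close>.
\<close>

lemma integrable_laguerre_density_weight:
  assumes "b < a"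
  shows "integrable lborel_pos (\<lambda>u. (1 + u) powr M * exp (b * u) * \<bar>laguerre_density a n u\<bar>)"
proof -
  define N where "N = max M 0"
  define d where "d = min 1 ((a - b) / (2 * (N + 1)))"
  have N: "N \<ge> 0" "M \<le> N" by (auto simp: N_def)
  have d: "d > 0" "d \<le> 1" using assms N by (auto simp: d_def)
  have "N * d \<le> N * ((a - b) / (2 * (N + 1)))" using N by (intro mult_left_mono) (auto simp: d_def)
  also have "\<dots> = (N / (N + 1)) * ((a - b) / 2)" by simp
  also have "\<dots> \<le> 1 * ((a - b) / 2)" using N assms by (intro mult_right_mono) auto
  also have "\<dots> < a - b" using assms by simp
  finally have lt: "b + N * d < a" by simp
  have "integrable lborel_pos (\<lambda>u. (1 / d) powr N * norm (exp ((b + N * d) * u) * laguerre_density a n u))"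
    using integrable_laguerre_density_exp[OF lt] by (intro integrable_mult_right integrable_norm)
  thus ?thesis
  proof (rule Bochner_Integration.integrable_bound)
    show "(\<lambda>u. (1 + u) powr M * exp (b * u) * \<bar>laguerre_density a n u\<bar>) \<in> borel_measurable lborel_pos"
      by (rule measurable_restrict_space1) measurable
    show "AE u in lborel_pos. norm ((1 + u) powr M * exp (b * u) * \<bar>laguerre_density a n u\<bar>) \<le>
        norm ((1 / d) powr N * norm (exp ((b + N * d) * u) * laguerre_density a n u))"
    proof (rule AE_I2)
      fix u assume "u \<in> space lborel_pos"
      hence u: "u > 0" by simp
      have "1 + d * u \<le> exp (d * u)" by (rule exp_ge_add_one_self)
      hence "d * (1 + u) \<le> exp (d * u)" using d unfolding distrib_left by linarith
      hence le: "1 + u \<le> (1 / d) * exp (d * u)"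
        using d by (simp add: field_simps)
      have "(1 + u) powr M \<le> (1 + u) powr N" using u N by (intro powr_mono) auto
      also have "\<dots> \<le> ((1 / d) * exp (d * u)) powr N"
        using u N le by (intro powr_mono2) auto
      also have "\<dots> = (1 / d) powr N * exp (d * u) powr N"
        by (rule powr_mult)
      also have "exp (d * u) powr N = exp (N * d * u)"
        by (simp add: powr_def)
      finally have "(1 + u) powr M \<le> (1 / d) powr N * exp (N * d * u)" .
      hence le: "(1 + u) powr M * (exp (b * u) * \<bar>laguerre_density a n u\<bar>) \<le>
          (1 / d) powr N * exp (N * d * u) * (exp (b * u) * \<bar>laguerre_density a n u\<bar>)"
        by (rule mult_right_mono) auto
      have "exp ((b + N * d) * u) = exp (N * d * u) * exp (b * u)"
        by (simp add: distrib_right flip: exp_add)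
      thus "norm ((1 + u) powr M * exp (b * u) * \<bar>laguerre_density a n u\<bar>) \<le>
        norm ((1 / d) powr N * norm (exp ((b + N * d) * u) * laguerre_density a n u))"
        using le by (simp add: abs_mult mult_ac)
    qed
  qed
qed

abbreviation kosh_integrand :: "real \<Rightarrow> nat \<Rightarrow> complex \<Rightarrow> complex \<Rightarrow> real \<Rightarrow> complex" where
  "kosh_integrand a n s x u \<equiv>
     of_real (1 + u) powr (- s) * exp (- (x * of_real (1 + u))) * of_real (laguerre_density a n u)"

text \<open>
  The integral of \<open>t\<^sup>-\<^sup>s exp (- x t)\<close> against the measure that consists of the mass \<open>(-1)\<^sup>n\<close> at \<open>t = 1\<close> and of
  the density \<open>laguerre_density a n\<close> in the variable \<open>u = t - 1 > 0\<close>. With \<open>a = 2\<pi>pn\<close> its values at \<open>s = 0\<close>,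
  at \<open>x = 0\<close> and in general are \<open>e\<^sup>-\<^sup>x ((a - x) / (a + x))\<^sup>n\<close>, \<open>(s, 2\<pi>pn)\<^sub>n\<close> and \<open>exp\<^sub>p(-x; s, n)\<close>.
\<close>

definition kosh_exp :: "real \<Rightarrow> nat \<Rightarrow> complex \<Rightarrow> complex \<Rightarrow> complex" where
  "kosh_exp a n s x = (-1) ^ n * exp (- x) +
     (LINT u|lborel_pos. of_real (1 + u) powr (- s) * exp (- (x * of_real (1 + u))) * of_real (laguerre_density a n u))"

lemma kosh_integrand_measurable:
  "(\<lambda>u. kosh_integrand a n s x u) \<in> borel_measurable lborel_pos"
  unfolding laguerre_density_def
  by (rule borel_measurable_lborel_pos)
     (auto intro!: continuous_intros dest: one_plus_of_real_nonzero)

lemma norm_kosh_integrand: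
  assumes "u > 0"
  shows "norm (kosh_integrand a n s x u) =
    exp (- Re x) * ((1 + u) powr (- Re s) * exp (- Re x * u) * \<bar>laguerre_density a n u\<bar>)"
proof -
  have "norm (exp (- (x * complex_of_real (1 + u)))) = exp (- Re x) * exp (- Re x * u)"
    by (simp add: distrib_left flip: exp_add)
  moreover have "norm (complex_of_real (1 + u) powr (- s)) = (1 + u) powr (- Re s)"
    using assms by (subst norm_powr_pos_real) (auto simp: powr_def)
  ultimately show ?thesis unfolding norm_mult norm_of_real by (simp only: mult_ac)
qed

lemma kosh_exp_0:
  assumes a: "a > 0" and x: "Re x > - a"
  shows "kosh_exp a n 0 x = exp (- x) * ((of_real a - x) / (of_real a + x)) ^ n"
proof -
  have ax: "Re (of_real a + x) > 0" using x by simp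
  hence ax0: "of_real a + x \<noteq> 0" by (metis less_irrefl zero_complex.sel(1))
  define cf where "cf = (\<lambda>i. complex_of_real (real (n choose i) * (-1) ^ (n - i) * (2 * a) ^ i / fact (i - 1)))"
  have "(LINT u|lborel_pos. kosh_integrand a n 0 x u) =
      (LINT u|lborel_pos. (\<Sum>i=1..n. exp (- x) * cf i * (exp (- ((of_real a + x) * of_real u)) * of_real u powr (of_nat i - 1))))"
  proof (rule Bochner_Integration.integral_cong)
    fix u assume "u \<in> space lborel_pos"
    hence u: "u > 0" by simp
    have pw: "of_real u powr (of_nat i - 1) = complex_of_real u ^ (i - 1)" if "i \<ge> 1" for i
    proof -
      have "(of_nat i - 1 :: complex) = of_nat (i - 1)" using that by (simp add: of_nat_diff)
      thus ?thesis using u by (simp add: powr_nat' del: of_nat_diff)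
    qed
    have "exp (- (x * of_real (1 + u))) * exp (complex_of_real (- a * u)) = exp (- x) * exp (- ((of_real a + x) * of_real u))"
      by (simp add: algebra_simps flip: exp_add)
    hence "exp (- (x * of_real (1 + u))) * complex_of_real (exp (- a * u)) = exp (- x) * exp (- ((of_real a + x) * of_real u))"
      by (simp only: exp_of_real)
    hence "kosh_integrand a n 0 x u =
       exp (- x) * exp (- ((of_real a + x) * of_real u)) * (\<Sum>i=1..n. cf i * of_real u ^ (i - 1))"
      using u unfolding laguerre_density_def of_real_mult of_real_sum
      by (simp add: cf_def mult_ac del: of_real_add)
    also have "(\<Sum>i=1..n. cf i * of_real u ^ (i - 1)) = (\<Sum>i=1..n. cf i * of_real u powr (of_nat i - 1))"
      by (intro sum.cong refl) (simp add: pw)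
    also have "exp (- x) * exp (- ((of_real a + x) * of_real u)) * (\<Sum>i=1..n. cf i * of_real u powr (of_nat i - 1)) =
       (\<Sum>i=1..n. exp (- x) * cf i * (exp (- ((of_real a + x) * of_real u)) * of_real u powr (of_nat i - 1)))"
      by (simp only: sum_distrib_left mult_ac)
    finally show "kosh_integrand a n 0 x u = \<dots>" .
  qed simp
  also have "\<dots> = (\<Sum>i=1..n. exp (- x) * cf i * (LINT u|lborel_pos. exp (- ((of_real a + x) * of_real u)) * of_real u powr (of_nat i - 1)))"
    by (subst Bochner_Integration.integral_sum)
       (auto intro!: integrable_mult_right integrable_Gamma_kernel ax[simplified])
  also have "\<dots> = (\<Sum>i=1..n. exp (- x) * (of_nat (n choose i) * (2 * of_real a / (of_real a + x)) ^ i * (-1) ^ (n - i)))"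
  proof (rule sum.cong)
    fix i assume i: "i \<in> {1..n}"
    hence G: "Gamma (of_nat i :: complex) = fact (i - 1)"
      by (metis Gamma_fact One_nat_def Suc_pred atLeastAtMost_iff not_less_eq_eq of_nat_Suc not_less0 le_add_diff_inverse plus_1_eq_Suc of_nat_add of_nat_1)
    have "(of_real a + x) powr (- of_nat i) = 1 / (of_real a + x) ^ i"
      using ax0 by (simp add: powr_minus powr_nat' divide_inverse)
    thus "exp (- x) * cf i * (LINT u|lborel_pos. exp (- ((of_real a + x) * of_real u)) * of_real u powr (of_nat i - 1)) =
       exp (- x) * (of_nat (n choose i) * (2 * of_real a / (of_real a + x)) ^ i * (-1) ^ (n - i))"
      using i ax G by (subst Gamma_kernel_integral) (auto simp: cf_def power_divide)
  qed simp
  finally have I: "(LINT u|lborel_pos. kosh_integrand a n 0 x u) =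
     exp (- x) * (\<Sum>i=1..n. of_nat (n choose i) * (2 * of_real a / (of_real a + x)) ^ i * (-1) ^ (n - i))"
    by (simp only: sum_distrib_left)
  have "(of_real a - x) / (of_real a + x) = 2 * of_real a / (of_real a + x) + (-1)"
    using ax0 by (simp add: field_simps)
  hence "((of_real a - x) / (of_real a + x)) ^ n = (\<Sum>i\<le>n. of_nat (n choose i) * (2 * of_real a / (of_real a + x)) ^ i * (-1) ^ (n - i))"
    by (simp only: binomial_ring)
  also have "{..n} = insert 0 {1..n}" by auto
  also have "(\<Sum>i\<in>insert 0 {1..n}. of_nat (n choose i) * (2 * of_real a / (of_real a + x)) ^ i * (-1) ^ (n - i)) =
     (-1) ^ n + (\<Sum>i=1..n. of_nat (n choose i) * (2 * of_real a / (of_real a + x)) ^ i * (-1) ^ (n - i))"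
    by simp
  finally show ?thesis unfolding kosh_exp_def I by (simp add: distrib_left)
qed

lemma kosh_exp_deriv:
  assumes x: "Re x > - a"
  shows "(kosh_exp a n s has_field_derivative - kosh_exp a n (s - 1) x) (at x)"
proof -
  define e where "e = (Re x + a) / 2"
  have e: "e > 0" using x by (simp add: e_def)
  define f where "f = (\<lambda>x u. kosh_integrand a n s x u)"
  define b where "b = Re x - e"
  have b: "- b < a" using x by (simp add: b_def e_def field_simps)
  have "((\<lambda>x. LINT u|lborel_pos. f x u) has_field_derivative (LINT u|lborel_pos. deriv (\<lambda>x. f x u) x)) (at x)"
  proof (rule has_field_derivative_integral(2)[OF _ _ e])
    show "(\<lambda>x. f x u) holomorphic_on ball x e" for u
      unfolding f_def by (intro holomorphic_intros)
    show "f w \<in> borel_measurable lborel_pos" for w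
      unfolding f_def by (rule kosh_integrand_measurable)
    show "integrable lborel_pos (\<lambda>u. (1 + u) powr (- Re s) * exp (- b * u) * \<bar>laguerre_density a n u\<bar> * exp (- b))"
      by (intro integrable_mult_left integrable_laguerre_density_weight b)
    fix w u assume w: "w \<in> ball x e" and "u \<in> space lborel_pos"
    hence u: "u > 0" by simp
    have "Re w > b" using w abs_Re_le_cmod[of "x - w"] by (auto simp: b_def dist_norm)
    hence "exp (- Re w) * exp (- Re w * u) \<le> exp (- b) * exp (- b * u)"
      using u by (intro mult_mono) auto
    hence "exp (- Re w) * exp (- Re w * u) * ((1 + u) powr (- Re s) * \<bar>laguerre_density a n u\<bar>) \<le>
       exp (- b) * exp (- b * u) * ((1 + u) powr (- Re s) * \<bar>laguerre_density a n u\<bar>)"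
      by (rule mult_right_mono) auto
    thus "norm (f w u) \<le> (1 + u) powr (- Re s) * exp (- b * u) * \<bar>laguerre_density a n u\<bar> * exp (- b)"
      unfolding f_def norm_kosh_integrand[OF u] by (simp only: mult_ac)
  qed
  also have "(LINT u|lborel_pos. deriv (\<lambda>x. f x u) x) = (LINT u|lborel_pos. -
      (kosh_integrand a n (s - 1) x u))"
  proof (rule Bochner_Integration.integral_cong)
    fix u assume "u \<in> space lborel_pos"
    hence u: "1 + u > 0" by simp
    have "((\<lambda>x. f x u) has_field_derivative - of_real (1 + u) * f x u) (at x)"
      unfolding f_def by (auto intro!: derivative_eq_intros)
    moreover have "of_real (1 + u) powr (- (s - 1)) = complex_of_real (1 + u) * of_real (1 + u) powr (- s)"
      using u powr_add[of "complex_of_real (1 + u)" 1 "- s"] by (simp del: of_real_add)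
    ultimately show "deriv (\<lambda>x. f x u) x =
       - (kosh_integrand a n (s - 1) x u)"
      by (simp add: DERIV_imp_deriv f_def mult_ac del: of_real_add)
  qed simp
  finally have D: "((\<lambda>x. LINT u|lborel_pos. f x u) has_field_derivative -
      (LINT u|lborel_pos. kosh_integrand a n (s - 1) x u)) (at x)"
    by (simp only: Bochner_Integration.integral_minus)
  have "((\<lambda>x. (-1) ^ n * exp (- x) + (LINT u|lborel_pos. f x u)) has_field_derivative - kosh_exp a n (s - 1) x) (at x)"
    unfolding kosh_exp_def by (rule derivative_eq_intros D refl)+ simp
  thus ?thesis by (simp add: kosh_exp_def[abs_def] f_def)
qed

lemma open_halfspace_neg: "open {x. Re x > - a}"
  by (rule open_halfspace_Re_gt)

lemma kosh_exp_holomorphic: "kosh_exp a n s holomorphic_on {x. Re x > - a}"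
  by (subst holomorphic_on_open[OF open_halfspace_neg]) (use kosh_exp_deriv in blast)

lemma kosh_exp_higher_deriv:
  assumes "Re x > - a"
  shows "(deriv ^^ m) (kosh_exp a n s) x = (-1) ^ m * kosh_exp a n (s - of_nat m) x"
  using assms
proof (induction m arbitrary: x)
  case (Suc m)
  have "((deriv ^^ m) (kosh_exp a n s) has_field_derivative (-1) ^ m * - kosh_exp a n (s - of_nat m - 1) x) (at x)"
  proof (rule has_field_derivative_transform_within_open[OF _ open_halfspace_neg])
    show "((\<lambda>x. (-1) ^ m * kosh_exp a n (s - of_nat m) x) has_field_derivative (-1) ^ m * - kosh_exp a n (s - of_nat m - 1) x) (at x)"
      by (rule DERIV_cmult[OF kosh_exp_deriv[OF Suc.prems]])
  qed (use Suc in auto)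
  thus ?case by (simp add: DERIV_imp_deriv algebra_simps)
qed simp

lemma kosh_exp_entire:
  assumes x: "Re x > - a"
  shows "(\<lambda>s. kosh_exp a n s x) holomorphic_on UNIV"
proof -
  have "(\<lambda>s. LINT u|lborel_pos. kosh_integrand a n s x u) holomorphic_on UNIV"
  proof (rule holomorphic_on_integral)
  show "(\<lambda>s. kosh_integrand a n s x u) holomorphic_on UNIV"
    if "u \<in> space lborel_pos" for u
  proof -
    have "complex_of_real (1 + u) \<noteq> 0" using that unfolding of_real_eq_0_iff by simp
    thus ?thesis by (intro holomorphic_intros)
  qed
  fix s :: complex
  define M where "M = \<bar>Re s\<bar> + 1"
  show "\<exists>e>0. \<exists>g. ball s e \<subseteq> UNIV \<and> integrable lborel_pos g \<and>
      (\<forall>w\<in>ball s e. \<forall>u\<in>space lborel_pos. norm (kosh_integrand a n w x u) \<le> g u)"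
  proof (intro exI conjI ballI)
    show "integrable lborel_pos (\<lambda>u. exp (- Re x) * ((1 + u) powr M * exp (- Re x * u) * \<bar>laguerre_density a n u\<bar>))"
      by (intro integrable_mult_right integrable_laguerre_density_weight) (use x in auto)
    fix w u assume w: "w \<in> ball s 1" and "u \<in> space lborel_pos"
    hence u: "u > 0" by simp
    have "- Re w \<le> M" using w abs_Re_le_cmod[of "s - w"] by (auto simp: M_def dist_norm)
    hence "(1 + u) powr (- Re w) \<le> (1 + u) powr M" using u by (intro powr_mono) auto
    thus "norm (kosh_integrand a n w x u) \<le>
       exp (- Re x) * ((1 + u) powr M * exp (- Re x * u) * \<bar>laguerre_density a n u\<bar>)"
      unfolding norm_kosh_integrand[OF u] by (intro mult_left_mono mult_right_mono) auto
  qed auto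
qed (simp_all only: open_UNIV kosh_integrand_measurable)
  thus ?thesis unfolding kosh_exp_def by (intro holomorphic_intros)
qed

text \<open>
  The Mellin transform of \<open>kosh_exp a n 0\<close> is computed under the integral sign: each exponential
  \<open>exp (- x (1 + u))\<close> contributes \<open>\<Gamma>(s) (1 + u)\<^sup>-\<^sup>s\<close>.
\<close>

lemma koshliakov_integral_eq:
  assumes "\<nu> > 0" "n > 0" "Re s > 0"
  shows "koshliakov_integral \<nu> n s = kosh_exp (\<nu> * real n) n s 0"
proof -
  define a where "a = \<nu> * real n"
  have a: "a > 0" using assms by (simp add: a_def)
  define q where "q = laguerre_density a n"
  have [measurable]: "q \<in> borel_measurable borel" by (simp add: q_def)
  define K where "K = (\<lambda>x. complex_of_real x powr (s - 1))"
  have K: "integrable lborel_pos (\<lambda>x. exp (- (w * of_real x)) * K x)"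
       "(LINT x|lborel_pos. exp (- (w * of_real x)) * K x) = Gamma s * w powr (- s)" if "Re w > 0" for w
    using that assms unfolding K_def by (intro integrable_Gamma_kernel Gamma_kernel_integral; simp)+
  have [measurable]: "K \<in> borel_measurable lborel_pos"
    unfolding K_def by (rule borel_measurable_lborel_pos) (auto intro!: continuous_intros)
  interpret P: pair_sigma_finite lborel_pos lborel_pos
    by (intro pair_sigma_finite.intro sigma_finite_lborel_pos)
  have q1: "integrable lborel_pos (\<lambda>u. \<bar>q u\<bar>)"
    using integrable_laguerre_density_exp[of 0 a n] a unfolding q_def by (simp add: integrable_abs)
  have pair: "integrable (lborel_pos \<Otimes>\<^sub>M lborel_pos) (\<lambda>(x, u). exp (- (of_real x * of_real (1 + u))) * of_real (q u) * K x)"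
  proof (rule P.integrable_pair_product_bound)
    show "(\<lambda>(x, u). exp (- (of_real x * of_real (1 + u))) * of_real (q u) * K x) \<in> borel_measurable (lborel_pos \<Otimes>\<^sub>M lborel_pos)"
    proof -
      have [measurable]: "(\<lambda>x. x) \<in> lborel_pos \<rightarrow>\<^sub>M (borel :: real measure)"
        by (rule measurable_restrict_space1) simp
      have [measurable]: "q \<in> borel_measurable lborel_pos"
        by (rule measurable_restrict_space1) simp
      show ?thesis by measurable
    qed
    show "integrable lborel_pos (\<lambda>x. norm (exp (- (1 * of_real x)) * K x))"
      by (intro integrable_norm K) simp
    fix x u assume "x \<in> space lborel_pos" "u \<in> space lborel_pos"
    hence xu: "x > 0" "u > 0" by auto
    have "exp (- (x * (1 + u))) \<le> exp (- x)" using xu by (simp add: algebra_simps)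
    hence "exp (- (x * (1 + u))) * (\<bar>q u\<bar> * norm (K x)) \<le> exp (- x) * (\<bar>q u\<bar> * norm (K x))"
      by (intro mult_right_mono) auto
    thus "norm (exp (- (of_real x * of_real (1 + u))) * of_real (q u) * K x) \<le> norm (exp (- (1 * of_real x)) * K x) * \<bar>q u\<bar>"
      by (simp add: norm_mult mult_ac)
  qed (rule q1)
  have "(LINT x:{0<..}|lborel. of_real (exp (- x) * ((n * \<nu> - x) / (n * \<nu> + x)) ^ n) * of_real x powr (s - 1)) =
      (LINT x|lborel_pos. kosh_exp a n 0 (of_real x) * K x)"
    unfolding integral_lborel_pos
  proof (rule Bochner_Integration.integral_cong)
    fix x assume "x \<in> space lborel_pos"
    hence "x > 0" by simp
    thus "of_real (exp (- x) * ((n * \<nu> - x) / (n * \<nu> + x)) ^ n) * of_real x powr (s - 1) = kosh_exp a n 0 (of_real x) * K x"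
      using a by (subst kosh_exp_0) (auto simp: K_def a_def exp_of_real mult_ac simp flip: exp_of_real)
  qed simp
  also have "\<dots> = (LINT x|lborel_pos. (-1) ^ n * (exp (- (1 * of_real x)) * K x) +
       (LINT u|lborel_pos. exp (- (of_real x * of_real (1 + u))) * of_real (q u) * K x))"
  proof (rule Bochner_Integration.integral_cong)
    fix x
    have "(LINT u|lborel_pos. of_real (1 + u) powr (- 0) * exp (- (of_real x * of_real (1 + u))) * complex_of_real (q u)) =
       (LINT u|lborel_pos. exp (- (of_real x * of_real (1 + u))) * of_real (q u))"
      by (rule Bochner_Integration.integral_cong) (auto dest: one_plus_of_real_nonzero)
    thus "kosh_exp a n 0 (of_real x) * K x = (-1) ^ n * (exp (- (1 * of_real x)) * K x) +
       (LINT u|lborel_pos. exp (- (of_real x * of_real (1 + u))) * of_real (q u) * K x)"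
      unfolding kosh_exp_def q_def[symmetric] integral_mult_left_zero by (simp add: algebra_simps)
  qed simp
  also have "\<dots> = (-1) ^ n * Gamma s +
      (LINT x|lborel_pos. LINT u|lborel_pos. exp (- (of_real x * of_real (1 + u))) * of_real (q u) * K x)"
  proof (subst Bochner_Integration.integral_add)
    show "integrable lborel_pos (\<lambda>x. (- 1) ^ n * (exp (- (1 * complex_of_real x)) * K x))"
      by (intro integrable_mult_right K) simp
    show "integrable lborel_pos (\<lambda>x. LINT u|lborel_pos. exp (- (of_real x * of_real (1 + u))) * of_real (q u) * K x)"
      using P.integrable_fst[OF pair] by simp
  qed (simp only: integral_mult_right_zero K(2)[of 1] one_complex.sel zero_less_one powr_one_eq_one mult_1_right)
  also have "(LINT x|lborel_pos. LINT u|lborel_pos. exp (- (of_real x * of_real (1 + u))) * of_real (q u) * K x) =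
      (LINT u|lborel_pos. LINT x|lborel_pos. exp (- (of_real x * of_real (1 + u))) * of_real (q u) * K x)"
    using P.Fubini_integral[OF pair] by simp
  also have "\<dots> = (LINT u|lborel_pos. Gamma s * (of_real (1 + u) powr (- s) * of_real (q u)))"
  proof (rule Bochner_Integration.integral_cong)
    fix u assume "u \<in> space lborel_pos"
    hence u: "Re (of_real (1 + u)) > 0" by simp
    have "(LINT x|lborel_pos. exp (- (of_real x * of_real (1 + u))) * of_real (q u) * K x) =
       (LINT x|lborel_pos. of_real (q u) * (exp (- (of_real (1 + u) * of_real x)) * K x))"
      by (simp only: mult_ac)
    also have "\<dots> = of_real (q u) * (Gamma s * of_real (1 + u) powr (- s))"
      by (simp only: integral_mult_right_zero K(2)[OF u])
    finally show "(LINT x|lborel_pos. exp (- (of_real x * of_real (1 + u))) * of_real (q u) * K x) =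
       Gamma s * (of_real (1 + u) powr (- s) * of_real (q u))" by (simp only: mult_ac)
  qed simp
  also have "(-1) ^ n * Gamma s + \<dots> = Gamma s * kosh_exp a n s 0"
    unfolding integral_mult_right_zero kosh_exp_def q_def by (simp add: distrib_left)
  finally have *: "(LINT x:{0<..}|lborel. of_real (exp (- x) * ((n * \<nu> - x) / (n * \<nu> + x)) ^ n) * of_real x powr (s - 1)) =
      Gamma s * kosh_exp a n s 0" .
  have "Gamma s \<noteq> 0" using assms by (auto simp: Gamma_eq_zero_iff elim!: nonpos_Ints_cases)
  thus ?thesis unfolding koshliakov_integral_def * by (simp add: a_def)
qed

lemma koshliakov_entire_eq:
  assumes "\<nu> > 0" "n > 0"
  shows "koshliakov_entire \<nu> n s = kosh_exp (\<nu> * real n) n s 0"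
proof -
  define F where "F = (\<lambda>s. kosh_exp (\<nu> * real n) n s 0)"
  have F: "F holomorphic_on UNIV"
    unfolding F_def by (rule kosh_exp_entire) (use assms in simp)
  have "koshliakov_entire \<nu> n = F"
    unfolding koshliakov_entire_def
  proof (rule the_equality)
    show "F holomorphic_on UNIV \<and> (\<forall>s. Re s > 0 \<longrightarrow> F s = koshliakov_integral \<nu> n s)"
      using F assms by (auto simp: F_def koshliakov_integral_eq)
    fix f assume f: "f holomorphic_on UNIV \<and> (\<forall>s. Re s > 0 \<longrightarrow> f s = koshliakov_integral \<nu> n s)"
    show "f = F"
    proof
      fix z
      show "f z = F z"
      proof (rule analytic_continuation_open[of "{s. Re s > 0}" UNIV f F])
        show "{s. Re s > 0} \<noteq> {}" by (auto intro: exI[of _ 1])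
      qed (use f F assms in \<open>auto simp: F_def koshliakov_integral_eq open_halfspace_Re_gt\<close>)
    qed
  qed
  thus ?thesis by (simp add: F_def)
qed

text \<open>
  After Fubini's theorem the inner integral is Mellin inversion of the exponential at the point
  \<open>x (1 + u)\<close>, since \<open>x\<^sup>-\<^sup>s (1 + u)\<^sup>-\<^sup>s = (x (1 + u))\<^sup>-\<^sup>s\<close>. Absolute integrability is clear because the modulus of the
  integrand is a function of \<open>t\<close> times a function of \<open>u\<close>.
\<close>

lemma Mellin_inversion_kosh_exp:
  assumes a: "a > 0" and x: "Re x > 0" and c: "c > 0"
  shows "vertical_integral c (\<lambda>s. Gamma s * kosh_exp a n (s + z) 0 * x powr (- s)) =
           2 * of_real pi * \<i> * kosh_exp a n z x"
proof -
  define G where "G = (\<lambda>t. Gamma (Complex c t) * x powr (- Complex c t))"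
  define q where "q = laguerre_density a n"
  define h where "h = (\<lambda>t u. G t * (of_real (1 + u) powr (- Complex c t - z) * complex_of_real (q u)))"
  have G: "integrable lborel G" unfolding G_def by (rule integrable_Gamma_vertical[OF x c])
  hence [measurable]: "G \<in> borel_measurable borel" by auto
  interpret P: pair_sigma_finite lborel lborel_pos
    by (intro pair_sigma_finite.intro sigma_finite_lborel_pos lborel.sigma_finite_measure_axioms)
  have pair: "integrable (lborel \<Otimes>\<^sub>M lborel_pos) (case_prod h)"
  proof (rule P.integrable_pair_product_bound)
    show "integrable lborel (\<lambda>t. norm (G t))" using G by simp
    show "integrable lborel_pos (\<lambda>u. (1 + u) powr (- c - Re z) * exp (0 * u) * \<bar>q u\<bar>)"
      unfolding q_def by (rule integrable_laguerre_density_weight[OF a])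
    have [measurable]: "q \<in> borel_measurable lborel_pos" "(\<lambda>u. ln (1 + u)) \<in> borel_measurable lborel_pos"
      unfolding q_def by (rule measurable_restrict_space1; measurable)+
    have "(\<lambda>(t, u). G t * (exp ((- (of_real c + \<i> * of_real t) - z) * of_real (ln (1 + u))) * complex_of_real (q u)))
        \<in> borel_measurable (lborel \<Otimes>\<^sub>M lborel_pos)"
      by measurable
    also have "?this \<longleftrightarrow> case_prod h \<in> borel_measurable (lborel \<Otimes>\<^sub>M lborel_pos)"
    proof (rule measurable_cong)
      fix w :: "real \<times> real" assume "w \<in> space (lborel \<Otimes>\<^sub>M lborel_pos)"
      then obtain t u where w: "w = (t, u)" and u: "u > 0"
        by (auto simp: space_pair_measure)
      have "of_real (1 + u) powr (- Complex c t - z) = exp ((- (of_real c + \<i> * of_real t) - z) * of_real (ln (1 + u)))"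
        using u by (subst powr_pos_real) (auto simp: Complex_eq)
      thus "(case w of (t, u) \<Rightarrow> G t * (exp ((- (of_real c + \<i> * of_real t) - z) * of_real (ln (1 + u))) * complex_of_real (q u))) = case_prod h w"
        by (simp add: w h_def del: of_real_add)
    qed
    finally show "case_prod h \<in> borel_measurable (lborel \<Otimes>\<^sub>M lborel_pos)" .
    fix t u assume "u \<in> space lborel_pos"
    hence u: "1 + u > 0" by simp
    have "norm (complex_of_real (1 + u) powr (- Complex c t - z)) = (1 + u) powr (- c - Re z)"
      using u by (subst norm_powr_pos_real) (auto simp: powr_def)
    thus "norm (h t u) \<le> norm (G t) * ((1 + u) powr (- c - Re z) * exp (0 * u) * \<bar>q u\<bar>)"
      by (simp add: h_def norm_mult del: of_real_add)
  qed
  have "vertical_integral c (\<lambda>s. Gamma s * kosh_exp a n (s + z) 0 * x powr (- s)) =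
      (LINT t|lborel. G t * kosh_exp a n (Complex c t + z) 0 * \<i>)"
    unfolding vertical_integral_def G_def by (simp add: mult_ac)
  also have "\<dots> = \<i> * (LINT t|lborel. (-1) ^ n * G t + (LINT u|lborel_pos. h t u))"
  proof -
    have "G t * kosh_exp a n (Complex c t + z) 0 = (-1) ^ n * G t + (LINT u|lborel_pos. h t u)" for t
    proof -
      have *: "- (Complex c t + z) = - Complex c t - z" by simp
      show ?thesis
        unfolding kosh_exp_def h_def q_def integral_mult_right_zero
        by (simp add: * distrib_left mult_ac del: of_real_add minus_add_distrib)
    qed
    thus ?thesis by (simp add: mult_ac)
  qed
  also have "(LINT t|lborel. (-1) ^ n * G t + (LINT u|lborel_pos. h t u)) =
      (-1) ^ n * (LINT t|lborel. G t) + (LINT t|lborel. LINT u|lborel_pos. h t u)"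
    using P.integrable_fst[OF pair] G by (subst Bochner_Integration.integral_add) auto
  also have "(LINT t|lborel. LINT u|lborel_pos. h t u) = (LINT u|lborel_pos. LINT t|lborel. h t u)"
    using P.Fubini_integral[OF pair] by simp
  also have "\<dots> = (LINT u|lborel_pos. 2 * of_real pi * (of_real (1 + u) powr (- z) * exp (- (x * of_real (1 + u))) * of_real (q u)))"
  proof (rule Bochner_Integration.integral_cong)
    fix u assume "u \<in> space lborel_pos"
    hence u: "1 + u > 0" by simp
    have xu: "Re (x * of_real (1 + u)) > 0" using x u by simp
    have x0: "x \<noteq> 0" using x by auto
    have "h t u = of_real (1 + u) powr (- z) * of_real (q u) * (Gamma (Complex c t) * (x * of_real (1 + u)) powr (- Complex c t))" for t
    proof -
      have "Ln (x * of_real (1 + u)) = Ln (of_real (1 + u)) + Ln x"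
        using Ln_times_of_real[OF u x0] u by (simp add: mult.commute Ln_of_real del: of_real_add)
      hence "(x * of_real (1 + u)) powr (- Complex c t) = x powr (- Complex c t) * of_real (1 + u) powr (- Complex c t)"
        using x0 u unfolding powr_def by (simp add: algebra_simps flip: exp_add del: of_real_add)
      moreover have "complex_of_real (1 + u) powr (- Complex c t - z) = of_real (1 + u) powr (- Complex c t) * of_real (1 + u) powr (- z)"
        using u powr_add[of "complex_of_real (1 + u)" "- Complex c t" "- z"] by (simp del: of_real_add)
      ultimately show ?thesis unfolding h_def G_def by (simp only: mult_ac)
    qed
    hence "(LINT t|lborel. h t u) = of_real (1 + u) powr (- z) * of_real (q u) * (2 * of_real pi * exp (- (x * of_real (1 + u))))"
      by (simp only: integral_mult_right_zero Mellin_inversion_exp[OF xu c])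
    thus "(LINT t|lborel. h t u) = 2 * of_real pi * (of_real (1 + u) powr (- z) * exp (- (x * of_real (1 + u))) * of_real (q u))"
      by (simp only: mult_ac)
  qed simp
  also have "(LINT t|lborel. G t) = 2 * of_real pi * exp (- x)"
    unfolding G_def by (rule Mellin_inversion_exp[OF x c])
  finally show ?thesis
    unfolding integral_mult_right_zero kosh_exp_def q_def by (simp only: algebra_simps)
qed

text \<open>
  Each differentiation in \<open>x\<close> lowers the exponent by one, so the Taylor coefficients at 0 are the values
  \<open>(z - m, 2\<pi>pn)\<^sub>n\<close> up to sign and factorial, and \<open>2\<pi>pn\<close> is the distance from 0 to the boundary of the half-plane
  of holomorphy. This settles the disc; outside it, Mellin inversion gives the same value on every line.
\<close>

lemma p_exp_eq:
  assumes p: "p > 0" and n: "n > 0" and x: "Re x > 0"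
  shows "p_exp p (- x) z n = kosh_exp (2 * pi * p * real n) n (of_real z) x"
proof -
  define a where "a = 2 * pi * p * real n"
  have a: "a > 0" using p n by (simp add: a_def)
  have E: "koshliakov_entire (2 * pi * p) n s = kosh_exp a n s 0" for s
    using koshliakov_entire_eq[of "2 * pi * p" n s] p n by (simp add: a_def)
  show ?thesis
  proof (cases "norm x < 2 * pi * p * real n")
    case True
    have "(\<lambda>m. (deriv ^^ m) (kosh_exp a n (of_real z)) 0 / fact m * (x - 0) ^ m) sums kosh_exp a n (of_real z) x"
    proof (rule holomorphic_power_series)
      have "ball 0 a \<subseteq> {x. Re x > - a}"
      proof
        fix w assume "w \<in> ball (0::complex) a"
        thus "w \<in> {x. Re x > - a}" using abs_Re_le_cmod[of w] by auto
      qed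
      thus "kosh_exp a n (of_real z) holomorphic_on ball 0 a"
        by (rule holomorphic_on_subset[OF kosh_exp_holomorphic])
      show "x \<in> ball 0 a" using True by (simp add: a_def)
    qed
    also have "(\<lambda>m. (deriv ^^ m) (kosh_exp a n (of_real z)) 0 / fact m * (x - 0) ^ m) =
       (\<lambda>m. (- 1) ^ m / fact m * koshliakov_entire (2 * pi * p) n (of_real z - of_nat m) * x ^ m)"
      using a by (simp add: fun_eq_iff kosh_exp_higher_deriv E)
    finally show ?thesis using True by (simp add: p_exp_def sums_iff a_def)
  next
    case False
    have "1 / (2 * of_real pi * \<i>) * vertical_integral c (\<lambda>s. Gamma s * koshliakov_entire (2 * pi * p) n (s + of_real z) * x powr (- s)) =
       kosh_exp a n (of_real z) x" if "c > 0" for c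
      unfolding E Mellin_inversion_kosh_exp[OF a x that] by simp
    hence "(THE v. \<forall>c>0. v = 1 / (2 * of_real pi * \<i>) * vertical_integral c (\<lambda>s. Gamma s * koshliakov_entire (2 * pi * p) n (s + of_real z) * x powr (- s))) =
       kosh_exp a n (of_real z) x"
      by (intro the_equality) (auto simp del: times_divide_eq_left dest!: spec[of _ "1::real"])
    thus ?thesis using False by (simp add: p_exp_def a_def)
  qed
qed

lemma p_exp_eq_higher_deriv:
  assumes p: "p > 0" and n: "n > 0" and x: "Re x > 0"
  shows "p_exp p (- x) (- real m) n =
    (-1) ^ m * (deriv ^^ m) (\<lambda>x. exp (- x) * ((of_real (2 * pi * p * n) - x) / (of_real (2 * pi * p * n) + x)) ^ n) x"
proof -
  define a where "a = 2 * pi * p * real n"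
  have a: "a > 0" using p n by (simp add: a_def)
  have "(deriv ^^ m) (\<lambda>x. exp (- x) * ((of_real a - x) / (of_real a + x)) ^ n) x = (deriv ^^ m) (kosh_exp a n 0) x"
  proof (rule higher_deriv_transform_within_open[OF _ _ open_halfspace_neg[of a]])
    show "kosh_exp a n 0 holomorphic_on {x. Re x > - a}" by (rule kosh_exp_holomorphic)
    show "(\<lambda>x. exp (- x) * ((of_real a - x) / (of_real a + x)) ^ n) holomorphic_on {x. Re x > - a}"
      by (rule holomorphic_transform[OF kosh_exp_holomorphic[of a n 0]]) (use a kosh_exp_0 in auto)
  qed (use x a kosh_exp_0 in auto)
  also have "\<dots> = (-1) ^ m * kosh_exp a n (- of_nat m) x"
    using x a by (subst kosh_exp_higher_deriv) auto
  finally show ?thesis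
    using p_exp_eq[OF p n x, of "- real m"] by (simp add: a_def flip: power_mult_distrib mult.assoc)
qed

section \<open>The roots of the transcendental equation\<close>

text \<open>
  The reason for this function is \<open>p sin(\<pi>x) + x cos(\<pi>x) = sqrt (p\<^sup>2 + x\<^sup>2) sin(\<pi>x + arctan(x / p))\<close>: the roots
  are the points where an increasing bijection of the real line takes a value in \<open>\<pi>\<int>\<close>.
\<close>

definition kosh_phase :: "real \<Rightarrow> real \<Rightarrow> real" where
  "kosh_phase p x = pi * x + arctan (x / p)"

definition kosh_node :: "real \<Rightarrow> int \<Rightarrow> real" where
  "kosh_node p m = (THE x. kosh_phase p x = pi * of_int m)"

lemma kosh_phase_strict_mono:
  assumes "p > 0" "x < y"
  shows "kosh_phase p x < kosh_phase p y"
  using assms unfolding kosh_phase_def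
  by (intro add_strict_mono arctan_monotone mult_strict_left_mono divide_strict_right_mono) auto

lemma kosh_phase_inj:
  assumes "p > 0" "kosh_phase p x = kosh_phase p y"
  shows "x = y"
  using kosh_phase_strict_mono[OF assms(1), of x y] kosh_phase_strict_mono[OF assms(1), of y x] assms(2)
  by (cases x y rule: linorder_cases) auto

lemma kosh_phase_surj:
  assumes "p > 0"
  shows "\<exists>x. kosh_phase p x = t"
proof -
  have "\<exists>x\<ge>t / pi - 1. x \<le> t / pi + 1 \<and> kosh_phase p x = t"
  proof (rule IVT')
    show "kosh_phase p (t / pi - 1) \<le> t"
    proof -
      have "arctan ((t / pi - 1) / p) \<le> pi"
        using arctan_ubound[of "(t / pi - 1) / p"] pi_gt_zero by linarith
      thus ?thesis by (simp add: kosh_phase_def right_diff_distrib)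
    qed
    show "t \<le> kosh_phase p (t / pi + 1)"
    proof -
      have "- pi \<le> arctan ((t / pi + 1) / p)"
        using arctan_lbound[of "(t / pi + 1) / p"] pi_gt_zero by linarith
      thus ?thesis by (simp add: kosh_phase_def distrib_left)
    qed
    show "continuous_on {t / pi - 1..t / pi + 1} (kosh_phase p)"
      unfolding kosh_phase_def using assms by (auto intro!: continuous_intros)
  qed auto
  thus ?thesis by blast
qed

lemma kosh_node_phase:
  assumes "p > 0"
  shows "kosh_phase p (kosh_node p m) = pi * of_int m"
  unfolding kosh_node_def
proof (rule theI', rule ex_ex1I)
  show "\<exists>x. kosh_phase p x = pi * of_int m" by (rule kosh_phase_surj[OF assms])
  show "x = y" if "kosh_phase p x = pi * of_int m" "kosh_phase p y = pi * of_int m" for x y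
    by (rule kosh_phase_inj[OF assms]) (simp only: that)
qed

lemma kosh_nodeI:
  assumes "p > 0" "kosh_phase p x = pi * of_int m"
  shows "kosh_node p m = x"
  by (rule kosh_phase_inj[OF assms(1)]) (simp only: kosh_node_phase[OF assms(1)] assms(2))

lemma kosh_node_0 [simp]: "p > 0 \<Longrightarrow> kosh_node p 0 = 0"
  by (rule kosh_nodeI) (auto simp: kosh_phase_def)

lemma kosh_node_minus:
  assumes "p > 0"
  shows "kosh_node p (- m) = - kosh_node p m"
  using kosh_node_phase[OF assms, of m] assms
  by (intro kosh_nodeI) (auto simp: kosh_phase_def arctan_minus)

lemma kosh_node_strict_mono:
  assumes "p > 0"
  shows "strict_mono (kosh_node p)"
proof
  fix m n :: int assume "m < n"
  hence "kosh_phase p (kosh_node p m) < kosh_phase p (kosh_node p n)"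
    using assms by (simp add: kosh_node_phase)
  thus "kosh_node p m < kosh_node p n"
    using kosh_phase_strict_mono[OF assms] by (metis less_asym linorder_less_linear)
qed

text \<open>
  The phase differs from \<open>\<pi>x\<close> by an arc tangent, which is less than \<open>\<pi>/2\<close> in modulus.
\<close>

lemma kosh_node_approx:
  assumes "p > 0"
  shows "\<bar>kosh_node p m - of_int m\<bar> < 1 / 2"
proof -
  have "pi * (kosh_node p m - of_int m) = - arctan (kosh_node p m / p)"
    using kosh_node_phase[OF assms, of m] by (simp add: kosh_phase_def algebra_simps)
  moreover have "\<bar>arctan (kosh_node p m / p)\<bar> < pi / 2"
    unfolding abs_less_iff
    using arctan_ubound[of "kosh_node p m / p"] arctan_lbound[of "kosh_node p m / p"]
    by (intro conjI) linarith+
  ultimately have "\<bar>pi * (kosh_node p m - of_int m)\<bar> < pi / 2"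
    by simp
  hence "pi * \<bar>kosh_node p m - of_int m\<bar> < pi * (1 / 2)"
    unfolding abs_mult by simp
  thus ?thesis by (subst (asm) mult_less_cancel_left_pos) auto
qed

lemma kosh_node_pos_iff: "p > 0 \<Longrightarrow> kosh_node p m > 0 \<longleftrightarrow> m > 0"
  using strict_mono_less[OF kosh_node_strict_mono, of p 0 m] by simp

lemma kosh_node_inj: "p > 0 \<Longrightarrow> kosh_node p m = kosh_node p n \<longleftrightarrow> m = n"
  using strict_mono_eq[OF kosh_node_strict_mono] by blast

lemma kosh_node_less:
  assumes "p > 0" "m > 0"
  shows "kosh_node p m < of_int m"
proof -
  have "arctan (kosh_node p m / p) > 0"
    using assms kosh_node_pos_iff[of p m] by (simp add: zero_less_arctan_iff)
  moreover have "pi * kosh_node p m + arctan (kosh_node p m / p) = pi * of_int m"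
    using kosh_node_phase[OF assms(1), of m] by (simp only: kosh_phase_def)
  ultimately have "pi * kosh_node p m < pi * of_int m" by linarith
  thus ?thesis by (subst (asm) mult_less_cancel_left_pos) auto
qed

lemma kosh_node_iff:
  assumes "p > 0"
  shows "p * sin (pi * x) + x * cos (pi * x) = 0 \<longleftrightarrow> (\<exists>m. x = kosh_node p m)"
proof -
  define y where "y = x / p"
  have x: "x = p * y" using assms by (simp add: y_def)
  have s: "sqrt (1 + y\<^sup>2) > 0" by (simp add: add_pos_nonneg)
  have "sin (kosh_phase p x) = (sin (pi * x) + y * cos (pi * x)) / sqrt (1 + y\<^sup>2)"
    by (simp add: kosh_phase_def sin_add cos_arctan sin_arctan y_def[symmetric] add_divide_distrib)
  hence "sqrt (1 + y\<^sup>2) * sin (kosh_phase p x) = sin (pi * x) + y * cos (pi * x)"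
    using s by simp
  hence "p * (sqrt (1 + y\<^sup>2) * sin (kosh_phase p x)) = p * sin (pi * x) + x * cos (pi * x)"
    using assms by (simp only: distrib_left) (simp add: y_def)
  hence "p * sin (pi * x) + x * cos (pi * x) = p * sqrt (1 + y\<^sup>2) * sin (kosh_phase p x)"
    by simp
  hence "p * sin (pi * x) + x * cos (pi * x) = 0 \<longleftrightarrow> sin (kosh_phase p x) = 0"
    using s assms by simp
  also have "\<dots> \<longleftrightarrow> (\<exists>m::int. kosh_phase p x = pi * of_int m)"
    by (simp add: sin_zero_iff_int2 mult.commute)
  also have "\<dots> \<longleftrightarrow> (\<exists>m. x = kosh_node p m)"
    using kosh_nodeI[OF assms] kosh_node_phase[OF assms] by metis
  finally show ?thesis .
qed

text \<open>
  Two increasing enumerations of the same set agree, by induction: if they agree below \<open>n\<close>, then each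
  \<open>n\<close>-th value must be at least the other one.
\<close>

lemma strict_mono_range_subset_le:
  fixes f g :: "nat \<Rightarrow> 'a::linorder"
  assumes f: "strict_mono f" and g: "strict_mono g" and range: "range f \<subseteq> range g"
    and eq: "\<forall>k<n. f k = g k"
  shows "g n \<le> f n"
proof -
  have "f n \<in> range g" using range by (rule subsetD) (rule rangeI)
  then obtain k where k: "f n = g k" by (rule rangeE)
  have "n \<le> k"
  proof (rule leI, rule notI)
    assume kn: "k < n"
    hence "f k = f n" by (simp add: k eq[rule_format])
    moreover have "f k < f n" by (rule strict_monoD[OF f kn])
    ultimately show False by simp
  qed
  thus ?thesis unfolding k by (rule monoD[OF strict_mono_mono[OF g]])
qed

lemma strict_mono_eq_if_range_eq:
  fixes f g :: "nat \<Rightarrow> 'a::linorder"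
  assumes f: "strict_mono f" and g: "strict_mono g" and range: "range f = range g"
  shows "f = g"
proof
  fix n show "f n = g n"
  proof (induction n rule: less_induct)
    case (less n)
    show ?case
    proof (rule order_antisym)
      show "g n \<le> f n"
        by (rule strict_mono_range_subset_le[OF f g]) (use range less in simp_all)
      show "f n \<le> g n"
        by (rule strict_mono_range_subset_le[OF g f]) (use range less in simp_all)
    qed
  qed
qed

text \<open>
  The positive roots are counted from 0, whereas index 0 of the two-sided enumeration is the root 0.
\<close>

lemma koshliakov_root_eq:
  assumes "p > 0"
  shows "koshliakov_root p j = kosh_node p (int j + 1)"
proof -
  define l where "l = (\<lambda>j. kosh_node p (int j + 1))"
  have "strict_mono l"
    unfolding l_def strict_mono_def using strict_mono_less[OF kosh_node_strict_mono[OF assms]] by simp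
  moreover have "range l = {x. x > 0 \<and> p * sin (pi * x) + x * cos (pi * x) = 0}"
  proof (intro equalityI subsetI)
    fix x assume "x \<in> range l"
    thus "x \<in> {x. x > 0 \<and> p * sin (pi * x) + x * cos (pi * x) = 0}"
      using assms by (auto simp: l_def kosh_node_pos_iff kosh_node_iff)
  next
    fix x assume "x \<in> {x. x > 0 \<and> p * sin (pi * x) + x * cos (pi * x) = 0}"
    then obtain m where m: "x = kosh_node p m" "m > 0"
      using assms by (auto simp: kosh_node_iff kosh_node_pos_iff)
    hence "x = l (nat (m - 1))" by (simp add: l_def)
    thus "x \<in> range l" by blast
  qed
  ultimately have "koshliakov_root p = l"
    unfolding koshliakov_root_def
    by (intro the_equality conjI) (auto intro!: strict_mono_eq_if_range_eq[of _ l])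
  thus ?thesis by (simp add: l_def)
qed

section \<open>The kernel and its poles\<close>

text \<open>
  The residue of the kernel at its pole \<open>2\<pi>i l\<close>.
\<close>

definition kosh_weight :: "real \<Rightarrow> real \<Rightarrow> real" where
  "kosh_weight p l = (p\<^sup>2 + l\<^sup>2) / (p * (p + 1 / pi) + l\<^sup>2)"

abbreviation kosh_pole :: "real \<Rightarrow> int \<Rightarrow> complex" where
  "kosh_pole p m \<equiv> 2 * of_real pi * \<i> * of_real (kosh_node p m)"

definition kosh_denom :: "real \<Rightarrow> complex \<Rightarrow> complex" where
  "kosh_denom \<nu> x = (of_real \<nu> + x) * exp x - (of_real \<nu> - x)"

definition kosh_kernel :: "real \<Rightarrow> complex \<Rightarrow> complex" where
  "kosh_kernel \<nu> x = (of_real \<nu> - x) / kosh_denom \<nu> x"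

lemma norm_diff_less_norm_add:
  assumes "\<nu> > 0" "Re x > 0"
  shows "norm (of_real \<nu> - x) < norm (of_real \<nu> + x)"
proof -
  have "(norm (of_real \<nu> - x))\<^sup>2 < (norm (of_real \<nu> + x))\<^sup>2"
    unfolding cmod_power2 using mult_pos_pos[OF assms] by (simp add: power2_eq_square algebra_simps)
  thus ?thesis by (rule power2_less_imp_less) simp
qed

text \<open>
  At a zero of the denominator \<open>\<bar>\<nu> + x\<bar> exp (Re x) = \<bar>\<nu> - x\<bar>\<close>, but off the imaginary axis both factors on the
  left push in the same direction.
\<close>

lemma kosh_denom_nonzero:
  assumes "\<nu> > 0" "Re x \<noteq> 0"
  shows "kosh_denom \<nu> x \<noteq> 0"
proof
  assume "kosh_denom \<nu> x = 0"
  hence "(of_real \<nu> + x) * exp x = of_real \<nu> - x" by (simp add: kosh_denom_def)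
  hence eq: "norm (of_real \<nu> + x) * exp (Re x) = norm (of_real \<nu> - x)"
    by (simp flip: norm_exp_eq_Re norm_mult)
  show False
  proof (cases "Re x > 0")
    case True
    have "norm (of_real \<nu> + x) * 1 \<le> norm (of_real \<nu> + x) * exp (Re x)"
      using True by (intro mult_left_mono) auto
    thus False using eq norm_diff_less_norm_add[OF assms(1) True] by simp
  next
    case False
    hence "Re (- x) > 0" using assms by simp
    from norm_diff_less_norm_add[OF assms(1) this]
    have "norm (of_real \<nu> + x) < norm (of_real \<nu> - x)" by simp
    moreover have "norm (of_real \<nu> + x) * exp (Re x) \<le> norm (of_real \<nu> + x) * 1"
      using False by (intro mult_left_mono) auto
    ultimately show False using eq by simp
  qed
qed

text \<open>
  At \<open>x = 2\<pi>i l\<close> the denominator factors as \<open>4\<pi>i exp(\<pi>i l) (p sin(\<pi>l) + l cos(\<pi>l))\<close>.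
\<close>

lemma kosh_denom_eq_0_iff:
  assumes p: "p > 0"
  shows "kosh_denom (2 * pi * p) x = 0 \<longleftrightarrow> (\<exists>m. x = kosh_pole p m)"
proof (cases "Re x = 0")
  case False
  hence "kosh_denom (2 * pi * p) x \<noteq> 0"
    using p by (intro kosh_denom_nonzero) auto
  moreover have "x \<noteq> kosh_pole p m" for m using False by auto
  ultimately show ?thesis by blast
next
  case True
  define l where "l = Im x / (2 * pi)"
  have x: "x = 2 * of_real pi * \<i> * of_real l"
    using True by (intro complex_eqI) (simp_all add: l_def)
  define C S where "C = complex_of_real (cos (pi * l))" and "S = complex_of_real (sin (pi * l))"
  have "C * C + S * S = of_real ((cos (pi * l))\<^sup>2 + (sin (pi * l))\<^sup>2)"
    unfolding C_def S_def of_real_add power2_eq_square of_real_mult ..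
  hence "C * C + S * S = 1" by simp
  hence CS: "(C + \<i> * S) * (C - \<i> * S) = 1"
    by (simp add: algebra_simps)
  have ex: "exp x = (C + \<i> * S) * (C + \<i> * S)"
  proof -
    have "exp (\<i> * of_real (pi * l)) = C + \<i> * S"
      by (simp add: complex_eq_iff Re_exp Im_exp C_def S_def)
    moreover have "x = \<i> * of_real (pi * l) + \<i> * of_real (pi * l)"
      by (simp add: x algebra_simps)
    ultimately show ?thesis by (simp only: exp_add)
  qed
  have "kosh_denom (2 * pi * p) x =
     (of_real (2 * pi * p) + x) * ((C + \<i> * S) * (C + \<i> * S)) - (of_real (2 * pi * p) - x) * ((C + \<i> * S) * (C - \<i> * S))"
    unfolding kosh_denom_def ex CS by simp
  also have "\<dots> = (C + \<i> * S) * (2 * \<i> * (2 * of_real pi)) * (of_real p * S + of_real l * C)"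
    by (simp add: x algebra_simps)
  also have "of_real p * S + of_real l * C = complex_of_real (p * sin (pi * l) + l * cos (pi * l))"
    by (simp add: C_def S_def)
  finally have "kosh_denom (2 * pi * p) x = (C + \<i> * S) * (2 * \<i> * (2 * of_real pi)) * complex_of_real (p * sin (pi * l) + l * cos (pi * l))" .
  moreover have "C + \<i> * S \<noteq> 0" using CS by auto
  ultimately have "kosh_denom (2 * pi * p) x = 0 \<longleftrightarrow> p * sin (pi * l) + l * cos (pi * l) = 0"
    by (simp del: of_real_add of_real_mult)
  also have "\<dots> \<longleftrightarrow> (\<exists>m. l = kosh_node p m)"
    by (rule kosh_node_iff[OF p])
  also have "\<dots> \<longleftrightarrow> (\<exists>m. x = kosh_pole p m)"
    by (simp add: x)
  finally show ?thesis .
qed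

lemma kosh_weight_bounds:
  assumes "p > 0"
  shows "0 < kosh_weight p l" "kosh_weight p l \<le> 1"
proof -
  have "p\<^sup>2 + l\<^sup>2 > 0" using assms by (simp add: add_pos_nonneg)
  moreover have "p\<^sup>2 + l\<^sup>2 \<le> p * (p + 1 / pi) + l\<^sup>2"
    using assms by (simp add: distrib_left power2_eq_square)
  ultimately show "0 < kosh_weight p l" "kosh_weight p l \<le> 1"
    unfolding kosh_weight_def by (auto simp del: distrib_left intro!: divide_pos_pos)
qed

lemma kosh_weight_0:
  assumes "p > 0"
  shows "kosh_weight p 0 = 1 / (1 + 1 / (pi * p))"
proof -
  have "kosh_weight p 0 = (p * p) / (p * (p + 1 / pi))"
    by (simp add: kosh_weight_def power2_eq_square)
  also have "\<dots> = p / (p + 1 / pi)"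
    using assms by (intro mult_divide_mult_cancel_left) auto
  also have "p + 1 / pi = p * (1 + 1 / (pi * p))"
    using assms by (simp add: distrib_left)
  also have "p / (p * (1 + 1 / (pi * p))) = 1 / (1 + 1 / (pi * p))"
    using assms by simp
  finally show ?thesis .
qed

lemma kosh_denom_has_field_derivative:
  "(kosh_denom \<nu> has_field_derivative (of_real \<nu> + x + 1) * exp x + 1) (at x)"
  unfolding kosh_denom_def[abs_def]
  by (auto intro!: derivative_eq_intros simp: algebra_simps)

text \<open>
  The residue is \<open>(\<nu> - x\<^sub>0) / D'(x\<^sub>0)\<close> for the denominator \<open>D\<close>, and \<open>exp x\<^sub>0 = (\<nu> - x\<^sub>0) / (\<nu> + x\<^sub>0)\<close> removes the
  exponential from \<open>D'(x\<^sub>0)\<close>.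
\<close>

lemma kosh_kernel_residue_limit:
  fixes p :: real and m :: int
  assumes p: "p > 0"
  defines "x0 \<equiv> kosh_pole p m"
  shows "((\<lambda>x. kosh_kernel (2 * pi * p) x * (x - x0)) \<longlongrightarrow> of_real (kosh_weight p (kosh_node p m))) (at x0)"
proof -
  define \<nu> where "\<nu> = 2 * pi * p"
  define l where "l = kosh_node p m"
  have \<nu>: "\<nu> > 0" using p by (simp add: \<nu>_def)
  define D' where "D' = (of_real \<nu> + x0 + 1) * exp x0 + 1"
  have re: "Re x0 = 0" by (simp add: x0_def)
  have nz: "of_real \<nu> + x0 \<noteq> 0" "of_real \<nu> - x0 \<noteq> 0"
    using re \<nu> by (auto simp: complex_eq_iff)
  have D0: "kosh_denom \<nu> x0 = 0"
    unfolding \<nu>_def using kosh_denom_eq_0_iff[OF p] x0_def by blast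
  hence ex: "exp x0 = (of_real \<nu> - x0) / (of_real \<nu> + x0)"
    using nz by (simp add: kosh_denom_def field_simps)
  have "D' = (of_real \<nu> - x0) + (of_real \<nu> - x0) / (of_real \<nu> + x0) + 1"
    unfolding D'_def ex using nz by (simp add: field_simps)
  hence "D' * (of_real \<nu> + x0) = (of_real \<nu> - x0) * (of_real \<nu> + x0) + 2 * of_real \<nu>"
    using nz by (simp add: field_simps)
  also have "\<dots> = of_real (\<nu>\<^sup>2 + (2 * pi * l)\<^sup>2 + 2 * \<nu>)"
    by (simp add: x0_def l_def algebra_simps power2_eq_square)
  finally have D1: "D' * (of_real \<nu> + x0) = of_real (\<nu>\<^sup>2 + (2 * pi * l)\<^sup>2 + 2 * \<nu>)" .
  have pos: "\<nu>\<^sup>2 + (2 * pi * l)\<^sup>2 + 2 * \<nu> > 0" using \<nu> by (intro add_nonneg_pos) auto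
  have D'0: "D' \<noteq> 0" using D1 pos by (metis mult_zero_left of_real_eq_0_iff order_less_irrefl)
  have w: "(of_real \<nu> - x0) / D' = of_real (kosh_weight p l)"
  proof -
    have "(of_real \<nu> - x0) / D' = (of_real \<nu> - x0) * (of_real \<nu> + x0) / (D' * (of_real \<nu> + x0))"
      using nz by simp
    also have "(of_real \<nu> - x0) * (of_real \<nu> + x0) = of_real (\<nu>\<^sup>2 + (2 * pi * l)\<^sup>2)"
      by (simp add: x0_def l_def algebra_simps power2_eq_square)
    also have "of_real (\<nu>\<^sup>2 + (2 * pi * l)\<^sup>2) / (D' * (of_real \<nu> + x0)) = complex_of_real ((\<nu>\<^sup>2 + (2 * pi * l)\<^sup>2) / (\<nu>\<^sup>2 + (2 * pi * l)\<^sup>2 + 2 * \<nu>))"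
      unfolding D1 by simp
    also have "\<nu>\<^sup>2 + (2 * pi * l)\<^sup>2 = (2 * pi)\<^sup>2 * (p\<^sup>2 + l\<^sup>2)"
      by (simp add: \<nu>_def power_mult_distrib algebra_simps)
    also have "(2 * pi)\<^sup>2 * (p\<^sup>2 + l\<^sup>2) + 2 * \<nu> = (2 * pi)\<^sup>2 * (p * (p + 1 / pi) + l\<^sup>2)"
      by (simp add: \<nu>_def power2_eq_square field_simps)
    also have "(2 * pi)\<^sup>2 * (p\<^sup>2 + l\<^sup>2) / ((2 * pi)\<^sup>2 * (p * (p + 1 / pi) + l\<^sup>2)) = kosh_weight p l"
      unfolding kosh_weight_def by (subst mult_divide_mult_cancel_left) auto
    finally show ?thesis .
  qed
  have "((\<lambda>x. (kosh_denom \<nu> x - kosh_denom \<nu> x0) / (x - x0)) \<longlongrightarrow> D') (at x0)"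
    using kosh_denom_has_field_derivative[of \<nu> x0] unfolding has_field_derivative_iff D'_def .
  hence "((\<lambda>x. (of_real \<nu> - x) / ((kosh_denom \<nu> x - kosh_denom \<nu> x0) / (x - x0))) \<longlongrightarrow> (of_real \<nu> - x0) / D') (at x0)"
    by (intro tendsto_intros D'0)
  also have "(\<lambda>x. (of_real \<nu> - x) / ((kosh_denom \<nu> x - kosh_denom \<nu> x0) / (x - x0))) =
     (\<lambda>x. kosh_kernel \<nu> x * (x - x0))"
    by (simp add: D0 kosh_kernel_def)
  finally show ?thesis unfolding w unfolding \<nu>_def l_def .
qed

section \<open>The partial fraction expansion of the kernel\<close>

abbreviation kosh_pole_weight :: "real \<Rightarrow> int \<Rightarrow> complex" where
  "kosh_pole_weight p m \<equiv> of_real (kosh_weight p (kosh_node p m))"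

abbreviation kosh_fraction :: "real \<Rightarrow> nat \<Rightarrow> complex \<Rightarrow> int \<Rightarrow> complex" where
  "kosh_fraction p n x m \<equiv> kosh_pole_weight p m / (kosh_pole p m - x) ^ n"

definition kosh_regular_set :: "real \<Rightarrow> complex set" where
  "kosh_regular_set p = - (kosh_pole p ` (- {0}))"

text \<open>
  The kernel without its principal part at 0. Writing it as a difference quotient of \<open>x f(x)\<close> fills in the
  value at 0, which is where the special values of the zeta function come from.
\<close>

definition kosh_regular :: "real \<Rightarrow> complex \<Rightarrow> complex" where
  "kosh_regular p =
     (let g = (\<lambda>x. if x = 0 then kosh_pole_weight p 0 else x * kosh_kernel (2 * pi * p) x)
      in (\<lambda>x. if x = 0 then deriv g 0 else (g x - g 0) / (x - 0)))"

lemma kosh_regular_eq: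
  assumes "x \<noteq> 0"
  shows "kosh_regular p x = kosh_kernel (2 * pi * p) x - kosh_pole_weight p 0 / x"
  using assms by (simp add: kosh_regular_def Let_def diff_divide_distrib)

lemma norm_kosh_pole_gt:
  assumes "p > 0" "m \<noteq> 0"
  shows "norm (kosh_pole p m) > pi"
proof -
  have "\<bar>of_int m\<bar> \<ge> (1 :: real)" using assms(2) by linarith
  hence "\<bar>kosh_node p m\<bar> > 1 / 2"
    using kosh_node_approx[OF assms(1), of m] by linarith
  thus ?thesis by (simp add: norm_mult)
qed

lemma kosh_regular_set_eq:
  assumes "p > 0"
  shows "kosh_regular_set p = {x. kosh_denom (2 * pi * p) x \<noteq> 0} \<union> ball 0 pi"
proof -
  have "kosh_pole p m \<notin> ball 0 pi" if "m \<noteq> 0" for m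
    using norm_kosh_pole_gt[OF assms that] by simp
  moreover have "kosh_pole p 0 \<in> ball 0 pi"
    using assms by simp
  ultimately show ?thesis
    unfolding kosh_regular_set_def kosh_denom_eq_0_iff[OF assms] by blast
qed

lemma continuous_on_kosh_denom: "continuous_on S (kosh_denom \<nu>)"
  unfolding kosh_denom_def[abs_def] by (intro continuous_intros)

lemma open_kosh_denom_nonzero: "open {x. kosh_denom \<nu> x \<noteq> 0}"
  by (intro open_Collect_neq continuous_on_kosh_denom continuous_intros)

lemma open_kosh_regular_set: "p > 0 \<Longrightarrow> open (kosh_regular_set p)"
  unfolding kosh_regular_set_eq by (intro open_Un open_kosh_denom_nonzero) auto

lemma kosh_regular_setD:
  assumes "p > 0" "x \<in> kosh_regular_set p" "x \<noteq> 0"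
  shows "kosh_denom (2 * pi * p) x \<noteq> 0"
proof
  assume "kosh_denom (2 * pi * p) x = 0"
  then obtain m where m: "x = kosh_pole p m"
    using kosh_denom_eq_0_iff[OF assms(1)] by blast
  hence "m \<noteq> 0" using assms by auto
  thus False using m assms(2) by (auto simp: kosh_regular_set_def)
qed

lemma kosh_kernel_holomorphic: "kosh_kernel \<nu> holomorphic_on {x. kosh_denom \<nu> x \<noteq> 0}"
  unfolding kosh_kernel_def[abs_def] kosh_denom_def[abs_def] by (intro holomorphic_intros) auto

lemma kosh_regular_holomorphic:
  assumes p: "p > 0"
  shows "kosh_regular p holomorphic_on kosh_regular_set p"
proof -
  let ?A = "kosh_regular_set p"
  define g where "g = (\<lambda>x. if x = 0 then kosh_pole_weight p 0 else x * kosh_kernel (2 * pi * p) x)"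
  have "g holomorphic_on ?A"
  proof (rule no_isolated_singularity'[of "{0}"])
    have "(\<lambda>x. x * kosh_kernel (2 * pi * p) x) holomorphic_on ?A - {0}"
      by (intro holomorphic_intros holomorphic_on_subset[OF kosh_kernel_holomorphic])
         (use kosh_regular_setD[OF p] in auto)
    thus "g holomorphic_on ?A - {0}"
      by (rule holomorphic_transform) (auto simp: g_def)
    show "open ?A" by (rule open_kosh_regular_set[OF p])
    fix z :: complex assume "z \<in> {0}"
    hence z: "z = 0" by simp
    have "((\<lambda>x. kosh_kernel (2 * pi * p) x * (x - 0)) \<longlongrightarrow> kosh_pole_weight p 0) (at 0)"
      using kosh_kernel_residue_limit[OF p, of 0] p by simp
    hence "(g \<longlongrightarrow> kosh_pole_weight p 0) (at 0)"
      by (rule Lim_transform_eventually) (auto simp: g_def eventually_at_filter)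
    hence "(g \<longlongrightarrow> g 0) (at 0)" by (simp add: g_def)
    thus "(g \<longlongrightarrow> g z) (at z within ?A)" unfolding z by (rule tendsto_within_subset) auto
  qed auto
  from pole_lemma_open[OF this open_kosh_regular_set[OF p], of 0]
  show ?thesis unfolding kosh_regular_def g_def Let_def .
qed

text \<open>
  Put \<open>\<sigma> = (\<nu> + x) / (\<nu> - x)\<close>, so that the kernel is \<open>1 / (\<sigma> exp x - 1)\<close>, and \<open>\<sigma>\<close> is close to \<open>-1\<close> for large \<open>x\<close>. On
  the horizontal sides of a square of half side length \<open>R \<in> 2\<pi>\<int>\<close> the exponential is positive, so \<open>\<sigma> exp x\<close> is
  nearly negative and stays away from 1; on the vertical sides it is very large or very small. The condition
  \<open>R \<ge> 5\<nu>\<close> makes \<open>\<bar>\<sigma> + 1\<bar> \<le> 1/2\<close>.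
\<close>

lemma kosh_kernel_bound:
  fixes x :: complex and R \<nu> :: real
  assumes \<nu>: "\<nu> > 0" and R: "R \<ge> 5 * \<nu>" "R \<ge> 4"
    and x: "\<bar>Re x\<bar> = R \<or> (\<bar>Im x\<bar> = R \<and> exp x = of_real (exp (Re x)))"
  shows "kosh_denom \<nu> x \<noteq> 0" "norm (kosh_kernel \<nu> x) \<le> 2"
proof -
  define \<sigma> where "\<sigma> = (of_real \<nu> + x) / (of_real \<nu> - x)"
  have "R \<le> norm x" using x abs_Re_le_cmod[of x] abs_Im_le_cmod[of x] by auto
  hence nx: "norm (of_real \<nu> - x) \<ge> 4 * \<nu>"
    using norm_triangle_ineq2[of x "of_real \<nu>"] \<nu> R by (simp add: norm_minus_commute)
  hence nz: "of_real \<nu> - x \<noteq> 0" using \<nu> by (intro notI) simp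
  have "\<sigma> + 1 = of_real (2 * \<nu>) / (of_real \<nu> - x)"
    using nz by (simp add: \<sigma>_def field_simps)
  hence "norm (\<sigma> + 1) = 2 * \<nu> / norm (of_real \<nu> - x)"
    using \<nu> by (simp add: norm_divide)
  also have "\<dots> \<le> 2 * \<nu> / (4 * \<nu>)" using nx \<nu> by (intro divide_left_mono mult_pos_pos) linarith+
  finally have s1: "norm (\<sigma> + 1) \<le> 1 / 2" using \<nu> by simp
  have s2: "norm \<sigma> \<ge> 1 / 2" "norm \<sigma> \<le> 3 / 2"
    using s1 norm_triangle_ineq4[of "\<sigma> + 1" \<sigma>] norm_triangle_ineq4[of "\<sigma> + 1" 1] by auto
  have e4: "exp R \<ge> 4" using exp_ge_add_one_self[of R] R by linarith
  have ge: "norm (\<sigma> * exp x - 1) \<ge> 1 / 2"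
  proof (cases "\<bar>Re x\<bar> = R")
    case True
    show ?thesis
    proof (cases "Re x \<ge> 0")
      case True
      hence "norm (exp x) \<ge> 4" using \<open>\<bar>Re x\<bar> = R\<close> e4 by simp
      hence "norm \<sigma> * norm (exp x) \<ge> 1 / 2 * 4" using s2 by (intro mult_mono) auto
      thus ?thesis using norm_triangle_ineq2[of "\<sigma> * exp x" 1] by (simp add: norm_mult)
    next
      case False
      hence "Re x = - R" using \<open>\<bar>Re x\<bar> = R\<close> by simp
      hence "norm (exp x) = 1 / exp R" by (simp add: exp_minus inverse_eq_divide)
      also have "\<dots> \<le> 1 / 4" using e4 by (intro divide_left_mono) auto
      finally have "norm \<sigma> * norm (exp x) \<le> 3 / 2 * (1 / 4)" using s2 by (intro mult_mono) auto
      thus ?thesis using norm_triangle_ineq2[of 1 "\<sigma> * exp x"] by (simp add: norm_mult norm_minus_commute)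
    qed
  next
    case False
    define E where "E = exp (Re x)"
    have E: "E > 0" "exp x = of_real E" using x False by (auto simp: E_def)
    have "norm ((\<sigma> + 1) * of_real E) \<le> 1 / 2 * E"
      using s1 E by (simp add: norm_mult)
    moreover have "norm (of_real (E + 1) :: complex) = E + 1" using E unfolding norm_of_real by simp
    moreover have "\<sigma> * exp x - 1 = (\<sigma> + 1) * of_real E - of_real (E + 1)"
      unfolding E by (simp add: algebra_simps)
    ultimately show ?thesis
      using norm_triangle_ineq2[of "of_real (E + 1)" "(\<sigma> + 1) * of_real E"] E(1)
      by (simp only: norm_minus_commute)
  qed
  have D: "kosh_denom \<nu> x = (of_real \<nu> - x) * (\<sigma> * exp x - 1)"
    using nz by (simp add: kosh_denom_def \<sigma>_def right_diff_distrib)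
  have ne: "\<sigma> * exp x - 1 \<noteq> 0" using ge by (intro notI) simp
  show "kosh_denom \<nu> x \<noteq> 0" using D nz ne by simp
  have "kosh_kernel \<nu> x = 1 / (\<sigma> * exp x - 1)"
    unfolding kosh_kernel_def D using nz by simp
  hence "norm (kosh_kernel \<nu> x) = 1 / norm (\<sigma> * exp x - 1)" by (simp add: norm_divide)
  also have "\<dots> \<le> 1 / (1 / 2)" using ge by (intro divide_left_mono) auto
  finally show "norm (kosh_kernel \<nu> x) \<le> 2" by simp
qed

lemma norm_contour_integral_rectpath_le:
  assumes cont: "continuous_on (path_image (rectpath a b)) f"
    and ab: "Re a \<le> Re b" "Im a \<le> Im b"
    and bound: "\<And>z. z \<in> path_image (rectpath a b) \<Longrightarrow> norm (f z) \<le> B" and B: "0 \<le> B"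
  shows "norm (contour_integral (rectpath a b) f) \<le> 2 * B * ((Re b - Re a) + (Im b - Im a))"
proof -
  define a2 a4 where "a2 = Complex (Re b) (Im a)" and "a4 = Complex (Re a) (Im b)"
  have rect: "rectpath a b = linepath a a2 +++ linepath a2 b +++ linepath b a4 +++ linepath a4 a"
    by (simp add: rectpath_def Let_def a2_def a4_def)
  have img: "path_image (rectpath a b) =
      closed_segment a a2 \<union> closed_segment a2 b \<union> closed_segment b a4 \<union> closed_segment a4 a"
    unfolding rect by (simp add: path_image_join Un_assoc)
  have int: "f contour_integrable_on linepath u v" and le: "norm (contour_integral (linepath u v) f) \<le> B * norm (v - u)"
    if "closed_segment u v \<subseteq> path_image (rectpath a b)" for u v
  proof -
    show "f contour_integrable_on linepath u v"
      by (intro contour_integrable_continuous_linepath continuous_on_subset[OF cont that])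
    thus "norm (contour_integral (linepath u v) f) \<le> B * norm (v - u)"
      using that by (intro contour_integral_bound_linepath B bound) auto
  qed
  have s: "closed_segment a a2 \<subseteq> path_image (rectpath a b)" "closed_segment a2 b \<subseteq> path_image (rectpath a b)"
     "closed_segment b a4 \<subseteq> path_image (rectpath a b)" "closed_segment a4 a \<subseteq> path_image (rectpath a b)"
    unfolding img by auto
  have "contour_integral (rectpath a b) f = contour_integral (linepath a a2) f + (contour_integral (linepath a2 b) f +
      (contour_integral (linepath b a4) f + contour_integral (linepath a4 a) f))"
    unfolding rect using int[OF s(1)] int[OF s(2)] int[OF s(3)] int[OF s(4)]
    by (simp add: contour_integrable_joinI)
  also have "norm \<dots> \<le> B * norm (a2 - a) + (B * norm (b - a2) + (B * norm (a4 - b) + B * norm (a - a4)))"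
    by (intro norm_triangle_mono le s)
  finally have le: "norm (contour_integral (rectpath a b) f) \<le>
      B * norm (a2 - a) + (B * norm (b - a2) + (B * norm (a4 - b) + B * norm (a - a4)))" .
  have lens: "norm (a2 - a) = Re b - Re a" "norm (b - a2) = Im b - Im a" "norm (a4 - b) = Re b - Re a" "norm (a - a4) = Im b - Im a"
    using ab by (auto simp: a2_def a4_def cmod_def)
  show ?thesis using le unfolding lens by (simp add: algebra_simps)
qed

text \<open>
  The residue theorem for \<open>y \<mapsto> g(y) / (y - x)\<^sup>n\<^sup>+\<^sup>1\<close>, where \<open>g\<close> is the kernel without its principal part at 0, on
  the square with corners \<open>\<plusminus>R \<plusminus> i R\<close>. On its boundary \<open>\<bar>g\<bar> \<le> 3\<close>, which gives the error term.
\<close>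

lemma kosh_regular_residue_sum:
  assumes p: "p > 0" and x: "x \<in> kosh_regular_set p" and N: "2 * pi * real N > norm x" "2 * pi * real N \<ge> 10 * pi * p" "N > 0"
  defines "M \<equiv> {- int N..int N} - {0}" and "R \<equiv> 2 * pi * real N"
  shows "norm ((deriv ^^ n) (kosh_regular p) x / fact n + (\<Sum>m\<in>M. kosh_fraction p (Suc n) x m))
           \<le> 12 * R / (pi * (R - norm x) ^ Suc n)"
proof -
  define F where "F = (\<lambda>y. kosh_regular p y / (y - x) ^ Suc n)"
  define h where "h = 2 * pi * (real N + 1 / 2)"
  \<comment> \<open>As \<open>\<bar>l\<^sub>m - m\<bar> < 1/2\<close>, this strip contains the poles with \<open>\<bar>m\<bar> \<le> N\<close> and no others.\<close>
  define S where "S = {y. Im y < h} \<inter> {y. Im y > - h}"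
  define a b where "a = Complex (- R) (- R)" and "b = Complex R R"
  let ?A = "kosh_regular_set p"
  define pts where "pts = insert x (kosh_pole p ` M)"
  have R: "R > norm x" "R \<ge> 5 * (2 * pi * p)" using N by (auto simp: R_def)
  have "R \<ge> 2 * 3 * 1" unfolding R_def using N pi_gt3 by (intro mult_mono) auto
  hence R4: "R \<ge> 4" by simp
  have xM: "x \<noteq> kosh_pole p m" if "m \<in> M" for m
    using x that by (auto simp: kosh_regular_set_def M_def)
  have inS: "y \<in> ?A" if "y \<in> S" "y \<notin> kosh_pole p ` M" for y
  proof (rule ccontr)
    assume "y \<notin> ?A"
    then obtain m where m: "m \<noteq> 0" "y = kosh_pole p m"
      by (auto simp: kosh_regular_set_def)
    have "\<bar>Im y\<bar> < h" using that(1) by (auto simp: S_def)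
    moreover have "Im y = 2 * pi * kosh_node p m" unfolding m(2) by simp
    ultimately have "2 * pi * \<bar>kosh_node p m\<bar> < 2 * pi * (real N + 1 / 2)"
      unfolding h_def by (simp add: abs_mult)
    hence "\<bar>kosh_node p m\<bar> < real N + 1 / 2"
      by (subst (asm) mult_less_cancel_left_pos) auto
    hence "\<bar>of_int m\<bar> < real N + 1"
      using kosh_node_approx[OF p, of m] by linarith
    hence "m \<in> M" using m(1) by (auto simp: M_def)
    thus False using that(2) m(2) by blast
  qed
  have hol: "F holomorphic_on S - pts"
    unfolding F_def
    by (intro holomorphic_intros holomorphic_on_subset[OF kosh_regular_holomorphic[OF p]])
       (use inS in \<open>auto simp: pts_def\<close>)
  have img: "path_image (rectpath a b) \<subseteq> {y. (\<bar>Re y\<bar> = R \<or> \<bar>Im y\<bar> = R) \<and> \<bar>Re y\<bar> \<le> R \<and> \<bar>Im y\<bar> \<le> R}"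
    using R4 by (subst path_image_rectpath) (auto simp: a_def b_def)
  have bnd: "kosh_denom (2 * pi * p) y \<noteq> 0 \<and> norm (kosh_kernel (2 * pi * p) y) \<le> 2" if "y \<in> path_image (rectpath a b)" for y
  proof -
    have "exp y = of_real (exp (Re y))" if "\<bar>Im y\<bar> = R"
    proof -
      have "Im y = 2 * pi * real N \<or> Im y = - (2 * pi * real N)" using that by (auto simp: R_def)
      hence "cos (Im y) = 1 \<and> sin (Im y) = 0"
        using cos_2npi[of N] sin_2npi[of N] by (auto simp: mult_ac)
      thus ?thesis by (simp add: complex_eq_iff Re_exp Im_exp)
    qed
    hence "\<bar>Re y\<bar> = R \<or> (\<bar>Im y\<bar> = R \<and> exp y = of_real (exp (Re y)))"
      using img that by blast
    from kosh_kernel_bound[OF _ R(2) R4 this] show ?thesis using p by simp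
  qed
  have ny: "norm y \<ge> R" if "y \<in> path_image (rectpath a b)" for y
    using img that abs_Re_le_cmod[of y] abs_Im_le_cmod[of y] by auto
  have inA: "y \<in> ?A" if "y \<in> path_image (rectpath a b)" for y
    using bnd[OF that] by (simp add: kosh_regular_set_eq[OF p])
  have yx: "norm (y - x) \<ge> R - norm x" if "y \<in> path_image (rectpath a b)" for y
    using ny[OF that] norm_triangle_ineq2[of y x] by simp
  have Fb: "norm (F y) \<le> 3 / (R - norm x) ^ Suc n" if y: "y \<in> path_image (rectpath a b)" for y
  proof -
    have y0: "y \<noteq> 0" using ny[OF y] R4 by auto
    have "norm (kosh_pole_weight p 0 / y) \<le> 1 / 1"
      unfolding norm_divide norm_of_real
      using kosh_weight_bounds[OF p, of "kosh_node p 0"] ny[OF y] R4 by (intro frac_le) auto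
    moreover have "norm (kosh_regular p y) \<le> norm (kosh_kernel (2 * pi * p) y) + norm (kosh_pole_weight p 0 / y)"
      unfolding kosh_regular_eq[OF y0] by (rule norm_triangle_ineq4)
    ultimately have "norm (kosh_regular p y) \<le> 3" using bnd[OF y] by linarith
    thus ?thesis unfolding F_def norm_divide norm_power
      using yx[OF y] R(1) by (intro frac_le power_mono) auto
  qed
  have x_box: "x \<in> box a b"
    using R(1) abs_Re_le_cmod[of x] abs_Im_le_cmod[of x] by (auto simp: in_box_complex_iff a_def b_def)
  have m_box: "kosh_pole p m \<in> box a b" if "m \<in> M" for m
  proof -
    have "kosh_node p m < real N \<and> kosh_node p m > - real N"
    proof (cases "m > 0")
      case True
      thus ?thesis using kosh_node_less[OF p True] kosh_node_pos_iff[OF p, of m] that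
        by (auto simp: M_def)
    next
      case False
      hence "- m > 0" using that by (auto simp: M_def)
      thus ?thesis using kosh_node_less[OF p, of "- m"] kosh_node_pos_iff[OF p, of "- m"] that
        by (auto simp: M_def kosh_node_minus[OF p])
    qed
    hence "2 * pi * kosh_node p m < 2 * pi * real N" "2 * pi * (- real N) < 2 * pi * kosh_node p m"
      by (intro mult_strict_left_mono; simp)+
    thus ?thesis using R4 by (auto simp: in_box_complex_iff a_def b_def R_def)
  qed
  have pb: "pts \<subseteq> box a b" using x_box m_box by (auto simp: pts_def)
  have cboxS: "cbox a b \<subseteq> S"
  proof
    fix y assume "y \<in> cbox a b"
    hence "\<bar>Im y\<bar> \<le> R" by (auto simp: in_cbox_complex_iff a_def b_def)
    moreover have "R < h" by (simp add: R_def h_def)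
    ultimately show "y \<in> S" by (auto simp: S_def)
  qed
  have reab: "Re a \<le> Re b" "Im a \<le> Im b" using R4 by (auto simp: a_def b_def)
  have "contour_integral (rectpath a b) F = 2 * pi * \<i> * (\<Sum>q\<in>pts. winding_number (rectpath a b) q * residue F q)"
  proof (rule Residue_theorem[where S = S])
    show "open S" unfolding S_def by (intro open_Int open_halfspace_Im_lt open_halfspace_Im_gt)
    show "connected S" unfolding S_def
      by (intro convex_connected convex_Int convex_halfspace_Im_lt convex_halfspace_Im_gt)
    show "finite pts" by (auto simp: pts_def M_def)
    show "path_image (rectpath a b) \<subseteq> S - pts"
      using path_image_rectpath_cbox_minus_box[OF reab] pb cboxS by auto
    show "\<forall>z. z \<notin> S \<longrightarrow> winding_number (rectpath a b) z = 0"
      using cboxS by (intro allI impI winding_number_rectpath_outside reab) auto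
  qed (use hol in auto)
  also have "(\<Sum>q\<in>pts. winding_number (rectpath a b) q * residue F q) = (\<Sum>q\<in>pts. residue F q)"
    using pb by (intro sum.cong refl) (auto simp: winding_number_rectpath)
  also have "\<dots> = residue F x + (\<Sum>q\<in>kosh_pole p ` M. residue F q)"
  proof -
    have "finite (kosh_pole p ` M)" by (simp add: M_def)
    moreover have "x \<notin> kosh_pole p ` M" using xM by blast
    ultimately show ?thesis unfolding pts_def by (rule sum.insert)
  qed
  also have "residue F x = (deriv ^^ n) (kosh_regular p) x / fact n"
    unfolding F_def
    by (rule residue_holomorphic_over_power[OF open_kosh_regular_set[OF p] x kosh_regular_holomorphic[OF p]])
  also have "(\<Sum>q\<in>kosh_pole p ` M. residue F q) = (\<Sum>m\<in>M. residue F (kosh_pole p m))"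
  proof (rule sum.reindex_cong[OF _ refl refl])
    show "inj_on (kosh_pole p) M"
      using kosh_node_inj[OF p] by (auto simp: inj_on_def)
  qed
  also have "\<dots> = (\<Sum>m\<in>M. kosh_fraction p (Suc n) x m)"
  proof (rule sum.cong[OF refl])
    fix m assume m: "m \<in> M"
    define x0 where "x0 = kosh_pole p m"
    have m0: "m \<noteq> 0" using m by (simp add: M_def)
    have x00: "x0 \<noteq> 0" using norm_kosh_pole_gt[OF p m0] pi_gt_zero by (auto simp: x0_def)
    have x0x: "x0 \<noteq> x" using xM[OF m] by (simp add: x0_def)
    define T where "T = S - (pts - {x0})"
    show "residue F (kosh_pole p m) = kosh_fraction p (Suc n) x m"
      unfolding x0_def[symmetric]
    proof (rule residue_simple'[of T])
      show "open T" unfolding T_def S_def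
        by (intro open_Diff open_Int open_halfspace_Im_lt open_halfspace_Im_gt finite_imp_closed) (auto simp: pts_def M_def)
      show "x0 \<in> T" using m pb cboxS box_subset_cbox[of a b] by (auto simp: T_def x0_def pts_def)
      show "F holomorphic_on T - {x0}"
        by (rule holomorphic_on_subset[OF hol]) (auto simp: T_def)
      have "((\<lambda>y. (kosh_kernel (2 * pi * p) y * (y - x0) - kosh_pole_weight p 0 / y * (y - x0)) / (y - x) ^ Suc n) \<longlongrightarrow>
          (kosh_pole_weight p m - kosh_pole_weight p 0 / x0 * (x0 - x0)) / (x0 - x) ^ Suc n) (at x0)"
        using x0x x00 kosh_kernel_residue_limit[OF p, of m]
        by (intro tendsto_intros) (auto simp: x0_def)
      moreover have "eventually (\<lambda>y. y \<noteq> 0) (at x0)" by (rule eventually_neq_at_within)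
      hence "eventually (\<lambda>y. (kosh_kernel (2 * pi * p) y * (y - x0) - kosh_pole_weight p 0 / y * (y - x0)) / (y - x) ^ Suc n =
          F y * (y - x0)) (at x0)"
        by eventually_elim (simp add: F_def kosh_regular_eq left_diff_distrib)
      ultimately have "((\<lambda>y. F y * (y - x0)) \<longlongrightarrow> (kosh_pole_weight p m - kosh_pole_weight p 0 / x0 * (x0 - x0)) / (x0 - x) ^ Suc n) (at x0)"
        by (rule Lim_transform_eventually)
      thus "((\<lambda>y. F y * (y - x0)) \<longlongrightarrow> kosh_pole_weight p m / (x0 - x) ^ Suc n) (at x0)" by simp
    qed
  qed
  finally have I: "contour_integral (rectpath a b) F = 2 * pi * \<i> *
     ((deriv ^^ n) (kosh_regular p) x / fact n + (\<Sum>m\<in>M. kosh_fraction p (Suc n) x m))" .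
  have "norm (contour_integral (rectpath a b) F) \<le> 2 * (3 / (R - norm x) ^ Suc n) * ((Re b - Re a) + (Im b - Im a))"
  proof (rule norm_contour_integral_rectpath_le[OF _ reab Fb])
    show "continuous_on (path_image (rectpath a b)) F"
    proof (rule continuous_on_subset[OF holomorphic_on_imp_continuous_on[OF hol]])
      show "path_image (rectpath a b) \<subseteq> S - pts"
        using path_image_rectpath_cbox_minus_box[OF reab] pb cboxS by auto
    qed
    show "0 \<le> 3 / (R - norm x) ^ Suc n" using R(1) by simp
  qed
  also have "(Re b - Re a) + (Im b - Im a) = 4 * R" by (simp add: a_def b_def)
  finally have le: "norm (contour_integral (rectpath a b) F) \<le> 2 * (3 / (R - norm x) ^ Suc n) * (4 * R)" .
  have arith: "Z \<le> 12 * R / (pi * P)" if "2 * pi * Z \<le> 2 * (3 / P) * (4 * R)" "P > 0" for Z P :: real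
    using that by (simp add: field_simps)
  have "norm (2 * pi * \<i>) = 2 * pi" by (simp add: norm_mult)
  with le show ?thesis
    unfolding I norm_mult[of "2 * pi * \<i>"] using R(1) by (intro arith) simp_all
qed

lemma kosh_regular_partial_fractions:
  assumes p: "p > 0" and x: "x \<in> kosh_regular_set p" and n: "n > 0"
  shows "(\<lambda>N. \<Sum>m\<in>{- int N..int N} - {0}. kosh_fraction p (Suc n) x m)
           \<longlonglongrightarrow> - (deriv ^^ n) (kosh_regular p) x / fact n"
proof -
  define S where "S = (\<lambda>N. \<Sum>m\<in>{- int N..int N} - {0}. kosh_fraction p (Suc n) x m)"
  define d where "d = (deriv ^^ n) (kosh_regular p) x / fact n"
  have "filterlim (\<lambda>N. 2 * pi * real N) at_top sequentially"
    by (intro filterlim_tendsto_pos_mult_at_top[OF tendsto_const] filterlim_real_sequentially) auto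
  note R = this
  have "(\<lambda>N. d + S N) \<longlonglongrightarrow> 0"
  proof (rule tendsto_norm_zero_cancel, rule real_tendsto_sandwich[OF always_eventually])
    show "\<forall>N. 0 \<le> norm (d + S N)" by simp
    have "eventually (\<lambda>N. 2 * pi * real N > norm x \<and> 2 * pi * real N \<ge> 10 * pi * p \<and> N > 0) sequentially"
      by (intro eventually_conj eventually_gt_at_top filterlim_at_top_dense[THEN iffD1, OF R, rule_format]
          filterlim_at_top[THEN iffD1, OF R, rule_format])
    thus "eventually (\<lambda>N. norm (d + S N) \<le> 12 * (2 * pi * real N) / (pi * (2 * pi * real N - norm x) ^ Suc n)) sequentially"
      by eventually_elim (use kosh_regular_residue_sum[OF p x] in \<open>auto simp: d_def S_def\<close>)
    have lim: "((\<lambda>R. 12 * R / (pi * (R - norm x) ^ Suc n)) \<longlongrightarrow> 0) at_top"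
    proof (rule tendsto_sandwich)
      show "eventually (\<lambda>R. 0 \<le> 12 * R / (pi * (R - norm x) ^ Suc n)) at_top"
        using eventually_gt_at_top[of "norm x"]
        by eventually_elim (intro divide_nonneg_nonneg mult_nonneg_nonneg, auto intro: order.trans[OF norm_ge_zero less_imp_le])
      show "eventually (\<lambda>R. 12 * R / (pi * (R - norm x) ^ Suc n) \<le> 12 * R / (pi * (R - norm x) ^ 2)) at_top"
        using eventually_gt_at_top[of "norm x + 1"]
      proof eventually_elim
        case (elim R)
        have "(R - norm x) ^ 2 \<le> (R - norm x) ^ Suc n"
          using elim n by (intro power_increasing) auto
        moreover have "R \<ge> 0" using elim norm_ge_zero[of x] by linarith
        ultimately show ?case using elim
          by (intro divide_left_mono mult_left_mono mult_pos_pos) auto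
      qed
      show "((\<lambda>R. 12 * R / (pi * (R - norm x) ^ 2)) \<longlongrightarrow> 0) at_top"
        by real_asymp
    qed auto
    show "(\<lambda>N. 12 * (2 * pi * real N) / (pi * (2 * pi * real N - norm x) ^ Suc n)) \<longlonglongrightarrow> 0"
      by (rule filterlim_compose[OF lim R])
  qed auto
  hence "(\<lambda>N. (d + S N) - d) \<longlonglongrightarrow> 0 - d" by (intro tendsto_intros)
  thus ?thesis by (simp add: S_def d_def)
qed

section \<open>The function Omega as a derivative of the kernel\<close>

definition kosh_nome :: "real \<Rightarrow> complex \<Rightarrow> complex" where
  "kosh_nome \<nu> x = exp (- x) * ((of_real \<nu> - x) / (of_real \<nu> + x))"

lemma norm_kosh_nome_less_1:
  assumes "\<nu> > 0" "Re x > 0"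
  shows "norm (kosh_nome \<nu> x) \<le> exp (- Re x)" "norm (kosh_nome \<nu> x) < 1"
proof -
  have "norm (of_real \<nu> - x) < norm (of_real \<nu> + x)" by (rule norm_diff_less_norm_add[OF assms])
  hence "norm (of_real \<nu> - x) / norm (of_real \<nu> + x) \<le> 1"
    by (intro divide_le_eq_1_pos[THEN iffD2]) (auto intro: le_less_trans[OF norm_ge_zero])
  hence "norm (kosh_nome \<nu> x) \<le> exp (- Re x) * 1"
    unfolding kosh_nome_def norm_mult norm_divide by (intro mult_mono) auto
  thus "norm (kosh_nome \<nu> x) \<le> exp (- Re x)" by simp
  also have "\<dots> < 1" using assms by simp
  finally show "norm (kosh_nome \<nu> x) < 1" .
qed

lemma kosh_nome_holomorphic:
  assumes "\<nu> > 0"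
  shows "kosh_nome \<nu> holomorphic_on {x. Re x > 0}"
proof -
  have "of_real \<nu> + x \<noteq> 0" if "Re x > 0" for x
  proof
    assume "of_real \<nu> + x = 0"
    hence "Re (of_real \<nu> + x) = 0" by simp
    thus False using that assms by simp
  qed
  thus ?thesis unfolding kosh_nome_def[abs_def] by (intro holomorphic_intros) auto
qed

text \<open>
  The geometric series: the kernel is \<open>q / (1 - q)\<close> for the nome \<open>q\<close>, and \<open>\<bar>q\<bar> < 1\<close> on the right half-plane.
\<close>

lemma kosh_kernel_sums:
  assumes \<nu>: "\<nu> > 0" and x: "Re x > 0"
  shows "(\<lambda>n. kosh_nome \<nu> x ^ Suc n) sums kosh_kernel \<nu> x"
proof -
  let ?q = "kosh_nome \<nu> x"
  have "(\<lambda>n. ?q * ?q ^ n) sums (?q * (1 / (1 - ?q)))"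
    by (intro sums_mult geometric_sums norm_kosh_nome_less_1(2)[OF \<nu> x])
  moreover have "?q * (1 / (1 - ?q)) = kosh_kernel \<nu> x"
  proof -
    have nz: "of_real \<nu> + x \<noteq> 0"
      using norm_diff_less_norm_add[OF \<nu> x] by (intro notI) simp
    have D: "kosh_denom \<nu> x \<noteq> 0" using \<nu> x by (intro kosh_denom_nonzero) auto
    have q: "?q * ((of_real \<nu> + x) * exp x) = of_real \<nu> - x"
    proof -
      have "?q * ((of_real \<nu> + x) * exp x) = (exp (- x) * exp x) * ((of_real \<nu> - x) / (of_real \<nu> + x) * (of_real \<nu> + x))"
        unfolding kosh_nome_def by (simp only: mult_ac)
      also have "exp (- x) * exp x = 1" by (simp flip: exp_add)
      finally show ?thesis using nz by simp
    qed
    have "(1 - ?q) * ((of_real \<nu> + x) * exp x) = kosh_denom \<nu> x"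
      unfolding left_diff_distrib q by (simp add: kosh_denom_def)
    hence "?q / (1 - ?q) = (?q * ((of_real \<nu> + x) * exp x)) / kosh_denom \<nu> x"
      using nz by (metis mult_divide_mult_cancel_right no_zero_divisors exp_not_eq_zero)
    thus ?thesis unfolding q kosh_kernel_def by simp
  qed
  ultimately show ?thesis by simp
qed

lemma higher_deriv_sum_lessThan:
  fixes f :: "nat \<Rightarrow> complex \<Rightarrow> complex"
  assumes "\<And>i. f i holomorphic_on S" "open S" "x \<in> S"
  shows "(deriv ^^ m) (\<lambda>y. \<Sum>i<n. f i y) x = (\<Sum>i<n. (deriv ^^ m) (f i) x)"
proof (induction n)
  case (Suc n)
  have "(deriv ^^ m) (\<lambda>y. (\<Sum>i<n. f i y) + f n y) x = (deriv ^^ m) (\<lambda>y. \<Sum>i<n. f i y) x + (deriv ^^ m) (f n) x"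
    by (intro higher_deriv_add[OF _ _ assms(2,3)] holomorphic_on_sum assms(1))
  thus ?case using Suc by simp
qed simp

lemma higher_deriv_kosh_kernel_sums:
  assumes \<nu>: "\<nu> > 0" and x: "Re x > 0"
  shows "(\<lambda>n. (deriv ^^ m) (\<lambda>x. kosh_nome \<nu> x ^ Suc n) x) sums (deriv ^^ m) (kosh_kernel \<nu>) x"
proof -
  have "\<exists>e>0. cball x e \<subseteq> {x. Re x > 0}"
    using open_contains_cball[THEN iffD1, OF open_halfspace_Re_gt[of 0], rule_format, of x] x by simp
  then obtain e where e: "e > 0" "cball x e \<subseteq> {x. Re x > 0}" by blast
  let ?q = "kosh_nome \<nu>"
  have cont: "continuous_on (cball x e) (\<lambda>y. norm (?q y))"
    by (intro continuous_intros continuous_on_subset[OF holomorphic_on_imp_continuous_on[OF kosh_nome_holomorphic[OF \<nu>]] e(2)])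
  obtain y where y: "y \<in> cball x e" "\<And>z. z \<in> cball x e \<Longrightarrow> norm (?q z) \<le> norm (?q y)"
    using continuous_attains_sup[OF compact_cball _ cont] e(1) by auto
  define \<rho> where "\<rho> = norm (?q y)"
  have \<rho>: "\<rho> < 1" "\<rho> \<ge> 0" using norm_kosh_nome_less_1(2)[OF \<nu>, of y] y(1) e(2) by (auto simp: \<rho>_def)
  have sub: "ball x e \<subseteq> {x. Re x > 0}" using e(2) ball_subset_cball by blast
  have hol: "(\<lambda>x. ?q x ^ Suc n) holomorphic_on ball x e" for n
    by (intro holomorphic_intros holomorphic_on_subset[OF kosh_nome_holomorphic[OF \<nu>] sub])
  have "uniform_limit (ball x e) (\<lambda>n y. \<Sum>i<n. ?q y ^ Suc i) (\<lambda>y. suminf (\<lambda>i. ?q y ^ Suc i)) sequentially"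
  proof (rule Weierstrass_m_test_ev)
    show "summable (\<lambda>n. \<rho> ^ Suc n)" using \<rho> by (subst summable_Suc_iff) (simp add: summable_geometric)
    show "eventually (\<lambda>n. \<forall>z\<in>ball x e. norm (?q z ^ Suc n) \<le> \<rho> ^ Suc n) sequentially"
    proof (intro always_eventually allI ballI)
      fix n z assume "z \<in> ball x e"
      hence "norm (?q z) \<le> \<rho>" unfolding \<rho>_def by (intro y(2)) auto
      thus "norm (?q z ^ Suc n) \<le> \<rho> ^ Suc n" unfolding norm_power by (rule power_mono) simp
    qed
  qed
  hence "(\<lambda>n. (deriv ^^ m) (\<lambda>y. \<Sum>i<n. ?q y ^ Suc i) x) \<longlonglongrightarrow> (deriv ^^ m) (\<lambda>y. suminf (\<lambda>i. ?q y ^ Suc i)) x"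
    using e(1) by (intro higher_deriv_complex_uniform_limit[where A = "ball x e"] always_eventually allI holomorphic_on_sum hol) auto
  moreover have "(deriv ^^ m) (\<lambda>y. \<Sum>i<n. ?q y ^ Suc i) x = (\<Sum>i<n. (deriv ^^ m) (\<lambda>y. ?q y ^ Suc i) x)" for n
    using e(1) by (intro higher_deriv_sum_lessThan[OF hol]) auto
  moreover have "(deriv ^^ m) (\<lambda>y. suminf (\<lambda>i. ?q y ^ Suc i)) x = (deriv ^^ m) (kosh_kernel \<nu>) x"
  proof (rule higher_deriv_cong_ev[OF _ refl])
    have "eventually (\<lambda>y. y \<in> ball x e) (nhds x)"
      using e(1) by (intro eventually_nhds_in_open) auto
    thus "eventually (\<lambda>y. suminf (\<lambda>i. ?q y ^ Suc i) = kosh_kernel \<nu> y) (nhds x)"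
    proof eventually_elim
      case (elim y)
      hence "Re y > 0" using sub by auto
      thus ?case by (rule sums_unique[OF kosh_kernel_sums[OF \<nu>], symmetric])
    qed
  qed
  ultimately show ?thesis by (simp add: sums_def)
qed

text \<open>
  The scaling \<open>x \<mapsto> n x\<close> turns \<open>e\<^sup>-\<^sup>x ((\<nu>n - x) / (\<nu>n + x))\<^sup>n\<close> into the \<open>n\<close>-th power of the nome, and the chain rule
  produces the factor \<open>n\<^sup>2\<^sup>K\<^sup>-\<^sup>1\<close> of the \<open>n\<close>-th term.
\<close>

lemma koshliakov_Omega_eq:
  assumes p: "p > 0" and K: "K > 0" and x: "Re x > 0"
  shows "koshliakov_Omega p x (- int K) = - (deriv ^^ (2 * K - 1)) (kosh_kernel (2 * pi * p)) x"
proof -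
  define \<nu> N where "\<nu> = 2 * pi * p" and "N = 2 * K - 1"
  have \<nu>: "\<nu> > 0" using p by (simp add: \<nu>_def)
  have N: "2 * (- int K) + 1 = - int N" "odd N" using K by (auto simp: N_def of_nat_diff)
  have "p_exp p (- (x * of_nat (Suc n))) (of_int (2 * (- int K) + 1)) (Suc n) / of_nat (Suc n) powi (2 * (- int K) + 1) =
      - (deriv ^^ N) (\<lambda>x. kosh_nome \<nu> x ^ Suc n) x" for n
  proof -
    define h where "h = (\<lambda>x::complex. exp (- x) * ((of_real (\<nu> * Suc n) - x) / (of_real (\<nu> * Suc n) + x)) ^ Suc n)"
    have hhol: "h holomorphic_on {x. Re x > 0}"
    proof -
      have "of_real (\<nu> * Suc n) + x \<noteq> 0" if "Re x > 0" for x
      proof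
        assume "of_real (\<nu> * Suc n) + x = 0"
        hence "Re (of_real (\<nu> * Suc n) + x) = 0" by (simp only: zero_complex.sel)
        moreover have "\<nu> * Suc n > 0" using \<nu> by simp
        ultimately show False using that unfolding plus_complex.sel Re_complex_of_real by linarith
      qed
      thus ?thesis unfolding h_def by (intro holomorphic_intros) auto
    qed
    have "p_exp p (- (x * of_nat (Suc n))) (- real N) (Suc n) = (-1) ^ N * (deriv ^^ N) h (x * of_nat (Suc n))"
      unfolding h_def \<nu>_def using p x by (intro p_exp_eq_higher_deriv) auto
    moreover have "(deriv ^^ N) (\<lambda>y. h (of_nat (Suc n) * y)) x = of_nat (Suc n) ^ N * (deriv ^^ N) h (of_nat (Suc n) * x)"
      by (rule higher_deriv_compose_linear[OF hhol open_halfspace_Re_gt open_halfspace_Re_gt]) (use x in auto)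
    moreover have "(\<lambda>y. h (of_nat (Suc n) * y)) = (\<lambda>y. kosh_nome \<nu> y ^ Suc n)"
    proof
      fix y :: complex
      define c where "c = (of_nat (Suc n) :: complex)"
      have c: "c \<noteq> 0" unfolding c_def by (rule of_nat_neq_0)
      have "(of_real (\<nu> * Suc n) - c * y) / (of_real (\<nu> * Suc n) + c * y) = (c * (of_real \<nu> - y)) / (c * (of_real \<nu> + y))"
        unfolding c_def of_real_mult of_real_of_nat_eq by (simp only: algebra_simps)
      also have "\<dots> = (of_real \<nu> - y) / (of_real \<nu> + y)"
        using c by (rule mult_divide_mult_cancel_left)
      moreover have "exp (- (c * y)) = exp (- y) ^ Suc n"
        unfolding c_def exp_of_nat_mult[symmetric] by simp
      ultimately show "h (of_nat (Suc n) * y) = kosh_nome \<nu> y ^ Suc n"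
        unfolding h_def c_def kosh_nome_def power_mult_distrib by (simp only:)
    qed
    ultimately show ?thesis
      unfolding N(1) using N(2) by (simp add: power_int_minus field_simps del: of_nat_Suc)
  qed
  moreover have "(\<lambda>n. - (deriv ^^ N) (\<lambda>x. kosh_nome \<nu> x ^ Suc n) x) sums - (deriv ^^ N) (kosh_kernel \<nu>) x"
    by (intro sums_minus higher_deriv_kosh_kernel_sums \<nu> x)
  ultimately show ?thesis
    unfolding koshliakov_Omega_def N_def[symmetric] \<nu>_def[symmetric] by (simp only: sums_unique[symmetric])
qed

section \<open>The second Koshliakov zeta function\<close>

abbreviation Mellin_integrand :: "(complex \<Rightarrow> complex) \<Rightarrow> complex \<Rightarrow> real \<Rightarrow> complex" where
  "Mellin_integrand f s x \<equiv> f (of_real x) * of_real x powr (s - 1)"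

lemma kosh_kernel_measurable:
  assumes "\<nu> > 0"
  shows "(\<lambda>x. Mellin_integrand (kosh_kernel \<nu>) s x) \<in> borel_measurable lborel_pos"
proof (rule borel_measurable_lborel_pos)
  have D: "kosh_denom \<nu> (of_real x) \<noteq> 0" if "x \<in> {0<..}" for x :: real
    using assms that by (intro kosh_denom_nonzero) auto
  have "continuous_on {0<..} (\<lambda>x. kosh_kernel \<nu> (of_real x))"
    by (rule continuous_on_compose2[OF holomorphic_on_imp_continuous_on[OF kosh_kernel_holomorphic[of \<nu>]]])
       (use D in \<open>auto intro!: continuous_intros\<close>)
  thus "continuous_on {0<..} (\<lambda>x. Mellin_integrand (kosh_kernel \<nu>) s x)"
    by (intro continuous_intros) auto
qed

text \<open>
  The substitution \<open>x \<mapsto> n x\<close> makes the \<open>n\<close>-th term the Mellin transform of the \<open>n\<close>-th power of the nome, and the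
  geometric series may be summed under the integral since \<open>\<Sum> n\<^sup>-\<^sup>\<sigma>\<close> converges for \<open>\<sigma> > 1\<close>.
\<close>

lemma koshliakov_eta_series:
  assumes p: "p > 0" and s: "Re s > 1"
  shows "(\<lambda>n. koshliakov_entire (2 * pi * p) (Suc n) s / of_nat (Suc n) powr s) sums
           (rGamma s * (LINT x|lborel_pos. Mellin_integrand (kosh_kernel (2 * pi * p)) s x))"
    and "integrable lborel_pos (\<lambda>x. Mellin_integrand (kosh_kernel (2 * pi * p)) s x)"
proof -
  define \<nu> where "\<nu> = 2 * pi * p"
  have \<nu>: "\<nu> > 0" using p by (simp add: \<nu>_def)
  define f where "f = (\<lambda>n x. kosh_nome \<nu> (complex_of_real x) ^ Suc n * of_real x powr (s - 1))"
  define g where "g = (\<lambda>n x. exp (- real (Suc n) * x) * x powr (Re s - 1))"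
  have gi: "integrable lborel_pos (g n)" for n
    unfolding g_def using s by (intro integrable_Gamma_kernel_real) auto
  have gI: "(LINT x|lborel_pos. g n x) = Gamma (Re s) * real (Suc n) powr (- Re s)" for n
  proof -
    have "complex_of_real (LINT x|lborel_pos. g n x) = (LINT x|lborel_pos. complex_of_real (g n x))"
      by (rule integral_complex_of_real[symmetric])
    also have "\<dots> = (LINT x|lborel_pos. exp (- (of_real (real (Suc n)) * of_real x)) * complex_of_real x powr (of_real (Re s) - 1))"
    proof (rule Bochner_Integration.integral_cong)
      fix x assume "x \<in> space lborel_pos"
      hence x: "x > 0" by simp
      have "complex_of_real (x powr (Re s - 1)) = complex_of_real x powr (of_real (Re s) - 1)"
        using x powr_of_real[of x "Re s - 1"] by simp
      moreover have "complex_of_real (exp (- real (Suc n) * x)) = exp (- (of_real (real (Suc n)) * of_real x))"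
        by (simp only: exp_of_real[symmetric] of_real_mult of_real_minus mult_minus_left)
      ultimately show "complex_of_real (g n x) = exp (- (of_real (real (Suc n)) * of_real x)) * complex_of_real x powr (of_real (Re s) - 1)"
        unfolding g_def of_real_mult by (simp only:)
    qed simp
    also have "\<dots> = Gamma (of_real (Re s)) * of_real (real (Suc n)) powr (- of_real (Re s))"
      by (rule Gamma_kernel_integral_real) (use s in auto)
    also have "\<dots> = complex_of_real (Gamma (Re s) * real (Suc n) powr (- Re s))"
      using s powr_of_real[of "real (Suc n)" "- Re s"] by (simp add: Gamma_complex_of_real)
    finally show ?thesis by (simp only: of_real_eq_iff)
  qed
  have fm: "f n \<in> borel_measurable lborel_pos" for n
    unfolding f_def
  proof (rule borel_measurable_lborel_pos)
    have "continuous_on {0<..} (\<lambda>x. kosh_nome \<nu> (of_real x))"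
      by (rule continuous_on_compose2[OF holomorphic_on_imp_continuous_on[OF kosh_nome_holomorphic[OF \<nu>]]])
         (auto intro!: continuous_intros)
    thus "continuous_on {0<..} (\<lambda>x. kosh_nome \<nu> (of_real x) ^ Suc n * of_real x powr (s - 1))"
      by (intro continuous_intros) auto
  qed
  have fg: "norm (f n x) \<le> g n x" if "x > 0" for n x
  proof -
    have "norm (kosh_nome \<nu> (of_real x)) \<le> exp (- x)"
      using norm_kosh_nome_less_1(1)[OF \<nu>, of "of_real x"] that by simp
    hence "norm (kosh_nome \<nu> (of_real x)) ^ Suc n \<le> exp (- x) ^ Suc n"
      by (rule power_mono) simp
    also have "\<dots> = exp (- real (Suc n) * x)" by (simp only: exp_of_nat_mult[symmetric] mult_minus_left mult_minus_right)
    finally show ?thesis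
      unfolding f_def g_def norm_mult norm_power using that
      by (intro mult_mono) (auto simp: norm_powr_pos_real powr_def)
  qed
  have fi: "integrable lborel_pos (f n)" for n
    by (rule Bochner_Integration.integrable_bound[OF gi fm]) (intro AE_I2, use order.trans[OF fg abs_ge_self] in auto)
  have k: "(\<lambda>n. f n x) sums (Mellin_integrand (kosh_kernel \<nu>) s x)" if "x > 0" for x
    unfolding f_def using that by (intro sums_mult2 kosh_kernel_sums \<nu>) auto
  have AE: "AE x in lborel_pos. summable (\<lambda>n. norm (f n x))"
  proof (rule AE_I2)
    fix x assume "x \<in> space lborel_pos"
    hence x: "x > 0" by simp
    have "summable (\<lambda>n. norm (kosh_nome \<nu> (of_real x)) ^ n * (norm (kosh_nome \<nu> (of_real x)) * norm (of_real x powr (s - 1))))"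
      using norm_kosh_nome_less_1(2)[OF \<nu>, of "of_real x"] x by (intro summable_mult2 summable_geometric) auto
    thus "summable (\<lambda>n. norm (f n x))" by (simp add: f_def norm_mult norm_power mult_ac)
  qed
  have sum: "summable (\<lambda>n. LINT x|lborel_pos. norm (f n x))"
  proof (rule summable_comparison_test')
    have "summable (\<lambda>n. real (Suc n) powr (- Re s))"
      using summable_real_powr_iff[of "- Re s"] s by (subst summable_Suc_iff) auto
    thus "summable (\<lambda>n. Gamma (Re s) * real (Suc n) powr (- Re s))" by (rule summable_mult)
    fix n
    have "(LINT x|lborel_pos. norm (f n x)) \<le> (LINT x|lborel_pos. g n x)"
      by (rule integral_mono) (use fi gi fg in auto)
    thus "norm (LINT x|lborel_pos. norm (f n x)) \<le> Gamma (Re s) * real (Suc n) powr (- Re s)"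
      unfolding gI by simp
  qed
  have eq: "(LINT x|lborel_pos. (\<Sum>n. f n x)) = (LINT x|lborel_pos. Mellin_integrand (kosh_kernel \<nu>) s x)"
    by (rule Bochner_Integration.integral_cong) (use k in \<open>auto simp: sums_iff\<close>)
  have "integrable lborel_pos (\<lambda>x. \<Sum>n. f n x)"
    by (rule integrable_suminf[OF fi AE sum])
  also have "?this \<longleftrightarrow> integrable lborel_pos (\<lambda>x. Mellin_integrand (kosh_kernel \<nu>) s x)"
    by (rule Bochner_Integration.integrable_cong) (use k in \<open>auto simp: sums_iff\<close>)
  finally show "integrable lborel_pos (\<lambda>x. Mellin_integrand (kosh_kernel (2 * pi * p)) s x)"
    unfolding \<nu>_def .
  have "(\<lambda>n. LINT x|lborel_pos. f n x) sums (LINT x|lborel_pos. Mellin_integrand (kosh_kernel \<nu>) s x)"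
    unfolding eq[symmetric] by (rule sums_integral[OF fi AE sum])
  hence "(\<lambda>n. rGamma s * (LINT x|lborel_pos. f n x)) sums (rGamma s * (LINT x|lborel_pos. Mellin_integrand (kosh_kernel \<nu>) s x))"
    by (rule sums_mult)
  also have "(\<lambda>n. rGamma s * (LINT x|lborel_pos. f n x)) = (\<lambda>n. koshliakov_entire \<nu> (Suc n) s / of_nat (Suc n) powr s)"
  proof
    fix n
    define c where "c = real (Suc n)"
    have c: "c > 0" by (simp add: c_def)
    have "koshliakov_entire \<nu> (Suc n) s = koshliakov_integral \<nu> (Suc n) s"
      using koshliakov_entire_eq[OF \<nu>, of "Suc n" s] koshliakov_integral_eq[OF \<nu>, of "Suc n" s] s by simp
    also have "\<dots> = rGamma s * (LINT x|lborel_pos. of_real (exp (- x) * ((c * \<nu> - x) / (c * \<nu> + x)) ^ Suc n) * of_real x powr (s - 1))"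
      unfolding koshliakov_integral_def integral_lborel_pos c_def by (simp add: rGamma_inverse_Gamma divide_inverse)
    also have "(LINT x|lborel_pos. of_real (exp (- x) * ((c * \<nu> - x) / (c * \<nu> + x)) ^ Suc n) * of_real x powr (s - 1)) =
       of_real c * (LINT y|lborel_pos. of_real (exp (- (c * y)) * ((c * \<nu> - c * y) / (c * \<nu> + c * y)) ^ Suc n) * of_real (c * y) powr (s - 1))"
      by (rule integral_lborel_pos_scale[OF c])
    also have "(LINT y|lborel_pos. of_real (exp (- (c * y)) * ((c * \<nu> - c * y) / (c * \<nu> + c * y)) ^ Suc n) * of_real (c * y) powr (s - 1)) =
      (LINT y|lborel_pos. of_real c powr (s - 1) * f n y)"
    proof (rule Bochner_Integration.integral_cong)
      fix y assume "y \<in> space lborel_pos"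
      hence y: "y > 0" by simp
      have "(c * \<nu> - c * y) / (c * \<nu> + c * y) = (c * (\<nu> - y)) / (c * (\<nu> + y))"
        by (simp only: right_diff_distrib distrib_left)
      also have "\<dots> = (\<nu> - y) / (\<nu> + y)" using c by (intro mult_divide_mult_cancel_left) auto
      finally have 1: "(c * \<nu> - c * y) / (c * \<nu> + c * y) = (\<nu> - y) / (\<nu> + y)" .
      have 2: "exp (- (c * y)) = exp (- y) ^ Suc n"
        unfolding c_def by (simp only: exp_of_nat_mult[symmetric] mult_minus_right)
      have 3: "complex_of_real (c * y) powr (s - 1) = of_real c powr (s - 1) * of_real y powr (s - 1)"
        using c y unfolding of_real_mult by (intro powr_times_real) auto
      have 4: "complex_of_real (exp (- y) ^ Suc n * ((\<nu> - y) / (\<nu> + y)) ^ Suc n) = kosh_nome \<nu> (of_real y) ^ Suc n"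
        unfolding kosh_nome_def power_mult_distrib[symmetric] of_real_power
        by (simp only: of_real_mult of_real_divide of_real_add of_real_diff exp_of_real[symmetric] of_real_minus)
      show "of_real (exp (- (c * y)) * ((c * \<nu> - c * y) / (c * \<nu> + c * y)) ^ Suc n) * of_real (c * y) powr (s - 1) = of_real c powr (s - 1) * f n y"
        unfolding 1 2 3 4 f_def by (simp only: mult_ac)
    qed simp
    also have "\<dots> = of_real c powr (s - 1) * (LINT y|lborel_pos. f n y)"
      by (rule integral_mult_right_zero)
    also have "rGamma s * (of_real c * (of_real c powr (s - 1) * (LINT y|lborel_pos. f n y))) =
        (of_real c * of_real c powr (s - 1)) * (rGamma s * (LINT y|lborel_pos. f n y))"
      by (simp only: mult_ac)
    also have "complex_of_real c * of_real c powr (s - 1) = of_real c powr s"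
      using c powr_add[of "of_real c" 1 "s - 1"] by simp
    finally show "rGamma s * (LINT x|lborel_pos. f n x) = koshliakov_entire \<nu> (Suc n) s / of_nat (Suc n) powr s"
      using c by (simp add: c_def del: of_nat_Suc)
  qed
  finally show "(\<lambda>n. koshliakov_entire (2 * pi * p) (Suc n) s / of_nat (Suc n) powr s) sums
           (rGamma s * (LINT x|lborel_pos. Mellin_integrand (kosh_kernel (2 * pi * p)) s x))"
    unfolding \<nu>_def .
qed

text \<open>
  The difference of the two functions is meromorphic and vanishes on an open set, so it vanishes off a sparse
  set; at each remaining point either both functions have a pole, and then the value 0, or both are
  continuous.
\<close>

lemma nicely_meromorphic_eqI:
  assumes f: "f nicely_meromorphic_on A" and g: "g nicely_meromorphic_on A"
    and A: "open A" "connected A" and S: "open S" "S \<noteq> {}" "S \<subseteq> A"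
    and eq: "\<And>z. z \<in> S \<Longrightarrow> f z = g z" and z: "z \<in> A"
  shows "f z = g z"
proof -
  have mero: "f meromorphic_on A" "g meromorphic_on A"
    using f g by (auto simp: nicely_meromorphic_on_def)
  have "(\<lambda>z. f z - g z) meromorphic_on A"
    by (intro meromorphic_intros mero)
  from meromorphic_imp_constant_or_avoid[OF this A, of 0]
  have "\<forall>\<^sub>\<approx>z\<in>A. f z - g z = 0"
  proof
    assume *: "\<forall>\<^sub>\<approx>z\<in>A. f z - g z \<noteq> 0"
    obtain w where w: "w \<in> S" using S by auto
    have "eventually (\<lambda>z. f z - g z \<noteq> 0) (at w)"
      using * w S by (auto simp: eventually_cosparse_open_eq[OF A(1)])
    moreover have "eventually (\<lambda>z. z \<in> S) (at w)"
      using w S by (intro eventually_at_in_open') auto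
    ultimately have "eventually (\<lambda>z. False) (at w)"
      by eventually_elim (use eq in auto)
    thus ?thesis by simp
  qed
  hence ev: "eventually (\<lambda>z. f z = g z) (at z)"
    using z by (auto simp: eventually_cosparse_open_eq[OF A(1)])
  show ?thesis
  proof (cases "is_pole f z")
    case True
    hence "is_pole g z" using is_pole_cong[OF ev refl] by simp
    have "\<not> f \<midarrow>z\<rightarrow> f z" "\<not> g \<midarrow>z\<rightarrow> g z"
      using True \<open>is_pole g z\<close> not_tendsto_and_filterlim_at_infinity[of "at z"] unfolding is_pole_def by auto
    thus ?thesis using f g z unfolding nicely_meromorphic_on_def by metis
  next
    case False
    hence "\<not> is_pole g z" using is_pole_cong[OF ev refl] by simp
    hence "f \<midarrow>z\<rightarrow> f z" "g \<midarrow>z\<rightarrow> g z"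
      using False f g z unfolding nicely_meromorphic_on_def by blast+
    moreover have "f \<midarrow>z\<rightarrow> g z" using \<open>g \<midarrow>z\<rightarrow> g z\<close> ev by (subst tendsto_cong[OF ev])
    ultimately show ?thesis using LIM_unique by blast
  qed
qed

definition kosh_taylor :: "real \<Rightarrow> nat \<Rightarrow> complex" where
  "kosh_taylor p m = (deriv ^^ m) (kosh_regular p) 0 / fact m"

lemma ball_0_pi_subset: "p > 0 \<Longrightarrow> ball 0 pi \<subseteq> kosh_regular_set p"
  by (simp add: kosh_regular_set_eq)

lemma kosh_taylor_sums:
  assumes "p > 0" "norm x < pi"
  shows "(\<lambda>m. kosh_taylor p m * x ^ m) sums kosh_regular p x"
  using holomorphic_power_series[OF holomorphic_on_subset[OF kosh_regular_holomorphic ball_0_pi_subset], of p x] assms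
  by (simp add: kosh_taylor_def)

lemma summable_kosh_taylor:
  assumes "p > 0"
  shows "summable (\<lambda>m. norm (kosh_taylor p m))"
proof -
  have "summable (\<lambda>m. kosh_taylor p m * 2 ^ m)"
    using kosh_taylor_sums[OF assms, of 2] pi_gt3 by (auto simp: sums_iff)
  hence "summable (\<lambda>m. norm (kosh_taylor p m * 1 ^ m))"
    by (rule powser_insidea) simp
  thus ?thesis by simp
qed

text \<open>This is \<open>rGamma s / (s + m)\<close> with its removable singularity at \<open>s = - m\<close> filled in.\<close>

definition rGamma_quotient :: "nat \<Rightarrow> complex \<Rightarrow> complex" where
  "rGamma_quotient m s = pochhammer s m * rGamma (s + of_nat m + 1)"

lemma rGamma_quotient_mult: "(s + of_nat m) * rGamma_quotient m s = rGamma s"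
  using pochhammer_rGamma[of s "Suc m"] by (simp add: rGamma_quotient_def pochhammer_Suc algebra_simps)

lemma rGamma_quotient_minus_nat:
  "rGamma_quotient m (- of_nat N) = (if m = N then (-1) ^ N * fact N else 0)"
proof (cases "m = N")
  case True
  have "pochhammer (- of_nat N :: complex) N = (-1) ^ N * fact N"
    by (subst pochhammer_minus) (simp add: pochhammer_fact)
  thus ?thesis using True by (simp add: rGamma_quotient_def)
next
  case False
  have "(- of_nat N + of_nat m) * rGamma_quotient m (- of_nat N) = 0"
    unfolding rGamma_quotient_mult by (simp add: rGamma_eq_zero_iff)
  moreover have "- of_nat N + of_nat m \<noteq> (0 :: complex)" using False by (simp add: add_eq_0_iff2)
  ultimately show ?thesis using False by simp
qed

lemma rGamma_quotient_holomorphic: "rGamma_quotient m holomorphic_on S"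
proof -
  have "(\<lambda>s. \<Prod>i<m. s + of_nat i) holomorphic_on S" by (intro holomorphic_intros)
  moreover have "(\<lambda>s. rGamma (s + of_nat m + 1)) holomorphic_on S"
    by (intro holomorphic_intros)
  ultimately have "(\<lambda>s. (\<Prod>i<m. s + of_nat i) * rGamma (s + of_nat m + 1)) holomorphic_on S"
    by (rule holomorphic_on_mult)
  thus ?thesis by (simp add: rGamma_quotient_def[abs_def] pochhammer_prod atLeast0LessThan)
qed

definition kosh_eta_local :: "real \<Rightarrow> complex \<Rightarrow> complex" where
  "kosh_eta_local p s = (\<Sum>m. kosh_taylor p m * rGamma_quotient m s)"

text \<open>
  The quotient \<open>rGamma s / (s + m)\<close> is at most \<open>\<bar>rGamma s\<bar>\<close> as soon as \<open>\<bar>s + m\<bar> \<ge> 1\<close>, which holds on a given disc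
  for all large \<open>m\<close>; and the Taylor series of \<open>kosh_regular\<close> at 0 converges absolutely at 1.
\<close>

lemma kosh_eta_local_holomorphic:
  assumes p: "p > 0"
  shows "kosh_eta_local p holomorphic_on UNIV"
proof (rule holomorphic_uniform_sequence[where f = "\<lambda>n s. \<Sum>m<n. kosh_taylor p m * rGamma_quotient m s"])
  show "(\<lambda>s. \<Sum>m<n. kosh_taylor p m * rGamma_quotient m s) holomorphic_on UNIV" for n
    by (intro holomorphic_intros rGamma_quotient_holomorphic)
  fix z :: complex
  have "compact (rGamma ` cball z 1)"
    by (intro compact_continuous_image compact_cball holomorphic_on_imp_continuous_on holomorphic_intros)
  then obtain G where G: "\<And>s. s \<in> cball z 1 \<Longrightarrow> norm (rGamma s) \<le> G"
    by (metis bounded_iff compact_imp_bounded imageI)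
  obtain M :: nat where M: "real M \<ge> norm z + 2" using real_arch_simple by blast
  have "uniform_limit (cball z 1) (\<lambda>n s. \<Sum>m<n. kosh_taylor p m * rGamma_quotient m s)
      (\<lambda>s. \<Sum>m. kosh_taylor p m * rGamma_quotient m s) sequentially"
  proof (rule Weierstrass_m_test_ev)
    show "summable (\<lambda>m. norm (kosh_taylor p m) * G)"
      by (intro summable_mult2 summable_kosh_taylor p)
    show "eventually (\<lambda>m. \<forall>s\<in>cball z 1. norm (kosh_taylor p m * rGamma_quotient m s) \<le> norm (kosh_taylor p m) * G) sequentially"
      using eventually_ge_at_top[of M]
    proof eventually_elim
      case (elim m)
      show ?case
      proof
        fix s assume s: "s \<in> cball z 1"
        have "norm s \<le> norm z + 1" using s norm_triangle_ineq2[of s z] by (simp add: dist_norm norm_minus_commute)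
        moreover have "real m \<ge> norm z + 2" using M elim by linarith
        moreover have "norm (of_nat m :: complex) \<le> norm (s + of_nat m) + norm s"
          using norm_triangle_ineq4[of "s + of_nat m" s] by simp
        ultimately have ge: "norm (s + of_nat m) \<ge> 1" by simp
        have "1 * norm (rGamma_quotient m s) \<le> norm (s + of_nat m) * norm (rGamma_quotient m s)"
          using ge by (intro mult_right_mono) auto
        also have "\<dots> = norm (rGamma s)" by (simp only: norm_mult[symmetric] rGamma_quotient_mult)
        also have "\<dots> \<le> G" by (rule G[OF s])
        finally show "norm (kosh_taylor p m * rGamma_quotient m s) \<le> norm (kosh_taylor p m) * G"
          unfolding norm_mult by (intro mult_left_mono) auto
      qed
    qed
  qed
  thus "\<exists>d>0. cball z d \<subseteq> UNIV \<and> uniform_limit (cball z d) (\<lambda>n s. \<Sum>m<n. kosh_taylor p m * rGamma_quotient m s)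
      (kosh_eta_local p) sequentially"
    unfolding kosh_eta_local_def[abs_def] by (intro exI[of _ 1]) auto
qed auto

text \<open>
  At \<open>s = - N\<close> the factor \<open>rGamma s\<close> vanishes, and only the term \<open>m = N\<close> has a pole to compensate for it.
\<close>

lemma kosh_eta_local_minus_nat:
  "kosh_eta_local p (- of_nat N) = (-1) ^ N * (deriv ^^ N) (kosh_regular p) 0"
proof -
  have "kosh_eta_local p (- of_nat N) = (\<Sum>m. if m = N then kosh_taylor p N * ((-1) ^ N * fact N) else 0)"
    unfolding kosh_eta_local_def rGamma_quotient_minus_nat by (rule suminf_cong) auto
  also have "\<dots> = kosh_taylor p N * ((-1) ^ N * fact N)"
    using sums_single[of N "\<lambda>_. kosh_taylor p N * ((-1) ^ N * fact N)"] by (simp add: sums_iff)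
  finally show ?thesis by (simp add: kosh_taylor_def)
qed

abbreviation lborel_unit :: "real measure" where
  "lborel_unit \<equiv> restrict_space lborel {0<..1}"

lemma powr_integral_unit:
  assumes "Re s > 0"
  shows "integrable lborel_unit (\<lambda>x. complex_of_real x powr (s - 1))"
    and "(LINT x|lborel_unit. complex_of_real x powr (s - 1)) = 1 / s"
proof -
  have "(\<lambda>x. x powr (Re s - 1)) absolutely_integrable_on {0<..1}"
    by (intro nonnegative_absolutely_integrable_1 integrable_on_powr_from_0') (use assms in auto)
  hence "integrable lborel (\<lambda>x. indicator {0<..1} x *\<^sub>R x powr (Re s - 1))"
    unfolding set_integrable_def by (subst (asm) integrable_completion) auto
  hence int: "integrable lborel (\<lambda>x. indicator {0<..1} x *\<^sub>R complex_of_real x powr (s - 1))"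
  proof (rule Bochner_Integration.integrable_bound)
    have "(\<lambda>x. indicator {0<..1} x *\<^sub>R complex_of_real x powr (s - 1)) \<in> borel_measurable borel"
      by (intro borel_measurable_continuous_on_indicator) (auto intro!: continuous_intros)
    thus "(\<lambda>x. indicator {0<..1} x *\<^sub>R complex_of_real x powr (s - 1)) \<in> borel_measurable lborel" by simp
    show "AE x in lborel. norm (indicator {0<..1} x *\<^sub>R complex_of_real x powr (s - 1)) \<le> norm (indicator {0<..1} x *\<^sub>R x powr (Re s - 1))"
      by (intro AE_I2) (auto simp: indicator_def norm_powr_pos_real powr_def)
  qed
  thus "integrable lborel_unit (\<lambda>x. complex_of_real x powr (s - 1))"
    by (subst integrable_restrict_space) auto
  have "(LINT x|lborel_unit. complex_of_real x powr (s - 1)) = (LINT x:{0<..1}|lborel. complex_of_real x powr (s - 1))"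
    by (subst integral_restrict_space) (auto simp: set_lebesgue_integral_def)
  also have "\<dots> = integral {0<..1} (\<lambda>x. complex_of_real x powr (s - 1))"
    using int by (intro set_borel_integral_eq_integral) (simp add: set_integrable_def)
  finally have I: "(LINT x|lborel_unit. complex_of_real x powr (s - 1)) = integral {0<..1} (\<lambda>x. complex_of_real x powr (s - 1))" .
  have "((\<lambda>t. complex_of_real t powr (s - 1)) has_integral (of_real 1 powr s / s - of_real 0 powr s / s)) {0..1}"
    using assms by (intro fundamental_theorem_of_calculus_interior)
      (auto intro!: continuous_intros derivative_eq_intros has_vector_derivative_real_field)
  hence "((\<lambda>t. complex_of_real t powr (s - 1)) has_integral (1 / s)) {0..1}" by simp
  also have "?this \<longleftrightarrow> ((\<lambda>t. complex_of_real t powr (s - 1)) has_integral (1 / s)) {0<..1}"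
  proof (rule has_integral_spike_set_eq)
    show "negligible {x \<in> {0..1} - {0<..1}. complex_of_real x powr (s - 1) \<noteq> 0}"
      by (rule negligible_subset[of "{0::real}"]) auto
    show "negligible {x \<in> {0<..1} - {0..1}. complex_of_real x powr (s - 1) \<noteq> 0}"
      by (rule negligible_subset[of "{}"]) auto
  qed
  finally have "((\<lambda>t. complex_of_real t powr (s - 1)) has_integral (1 / s)) {0<..1}" .
  hence "integral {0<..1} (\<lambda>x. complex_of_real x powr (s - 1)) = 1 / s" by (rule integral_unique)
  with I show "(LINT x|lborel_unit. complex_of_real x powr (s - 1)) = 1 / s" by simp
qed

text \<open>
  Integrating the Taylor series term by term against \<open>x\<^sup>s\<^sup>-\<^sup>1\<close> gives the terms \<open>1 / (s + m)\<close>.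
\<close>

lemma kosh_regular_integral_unit:
  assumes p: "p > 0" and s: "Re s > 0"
  shows "integrable lborel_unit (\<lambda>x. Mellin_integrand (kosh_regular p) s x)"
    and "rGamma s * (LINT x|lborel_unit. Mellin_integrand (kosh_regular p) s x) = kosh_eta_local p s"
proof -
  define f where "f = (\<lambda>m x. kosh_taylor p m * complex_of_real x powr (s + of_nat m - 1))"
  have sm: "Re (s + of_nat m) > 0" for m using s by (simp add: add_pos_nonneg)
  have fi: "integrable lborel_unit (f m)" for m
    unfolding f_def by (intro integrable_mult_right powr_integral_unit sm)
  have f_eq: "f m x = kosh_taylor p m * of_real x ^ m * of_real x powr (s - 1)" if "x > 0" for m x
  proof -
    have "complex_of_real x powr (s + of_nat m - 1) = of_real x powr of_nat m * of_real x powr (s - 1)"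
      unfolding powr_add[symmetric] by (simp add: algebra_simps)
    also have "complex_of_real x powr of_nat m = of_real x ^ m" using that by (intro powr_nat') auto
    finally show ?thesis by (simp add: f_def)
  qed
  have k: "(\<lambda>m. f m x) sums (Mellin_integrand (kosh_regular p) s x)" if "x > 0" "x \<le> 1" for x
    unfolding f_eq[OF that(1)] using that pi_gt3 by (intro sums_mult2 kosh_taylor_sums p) auto
  have nle: "norm (f m x) \<le> norm (kosh_taylor p m) * x powr (Re s - 1)" if "x > 0" "x \<le> 1" for x m
  proof -
    have "norm (f m x) = norm (kosh_taylor p m) * x ^ m * x powr (Re s - 1)"
      unfolding f_eq[OF that(1)] using that(1) by (simp add: norm_mult norm_power norm_powr_pos_real powr_def)
    also have "\<dots> \<le> norm (kosh_taylor p m) * 1 * x powr (Re s - 1)"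
      using that by (intro mult_right_mono mult_left_mono power_le_one) auto
    finally show ?thesis by simp
  qed
  have xs: "integrable lborel_unit (\<lambda>x. x powr (Re s - 1))"
  proof -
    have "integrable lborel_unit (\<lambda>x. norm (complex_of_real x powr (s - 1)))"
      by (intro integrable_norm powr_integral_unit s)
    also have "?this \<longleftrightarrow> ?thesis"
      by (rule Bochner_Integration.integrable_cong) (auto simp: space_restrict_space norm_powr_pos_real powr_def)
    finally show ?thesis .
  qed
  have AE: "AE x in lborel_unit. summable (\<lambda>m. norm (f m x))"
  proof (rule AE_I2)
    fix x assume "x \<in> space lborel_unit"
    hence x: "x > 0" "x \<le> 1" by (auto simp: space_restrict_space)
    show "summable (\<lambda>m. norm (f m x))"
      by (rule summable_comparison_test'[OF summable_mult2[OF summable_kosh_taylor[OF p]], of 0])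
         (use nle[OF x] in auto)
  qed
  have sum: "summable (\<lambda>m. LINT x|lborel_unit. norm (f m x))"
  proof (rule summable_comparison_test'[OF summable_mult2[OF summable_kosh_taylor[OF p]], of 0])
    fix m
    have "(LINT x|lborel_unit. norm (f m x)) \<le> (LINT x|lborel_unit. norm (kosh_taylor p m) * x powr (Re s - 1))"
      by (rule integral_mono) (use fi xs nle in \<open>auto simp: space_restrict_space\<close>)
    also have "\<dots> = norm (kosh_taylor p m) * (LINT x|lborel_unit. x powr (Re s - 1))"
      by (rule integral_mult_right_zero)
    finally show "norm (LINT x|lborel_unit. norm (f m x)) \<le> norm (kosh_taylor p m) * (LINT x|lborel_unit. x powr (Re s - 1))"
      by simp
  qed
  have eq: "(LINT x|lborel_unit. (\<Sum>m. f m x)) = (LINT x|lborel_unit. Mellin_integrand (kosh_regular p) s x)"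
    by (rule Bochner_Integration.integral_cong) (use k in \<open>auto simp: sums_iff space_restrict_space\<close>)
  have "integrable lborel_unit (\<lambda>x. \<Sum>m. f m x)"
    by (rule integrable_suminf[OF fi AE sum])
  also have "?this \<longleftrightarrow> integrable lborel_unit (\<lambda>x. Mellin_integrand (kosh_regular p) s x)"
    by (rule Bochner_Integration.integrable_cong) (use k in \<open>auto simp: sums_iff space_restrict_space\<close>)
  finally show "integrable lborel_unit (\<lambda>x. Mellin_integrand (kosh_regular p) s x)" .
  have "(\<lambda>m. rGamma s * (LINT x|lborel_unit. f m x)) sums (rGamma s * (LINT x|lborel_unit. Mellin_integrand (kosh_regular p) s x))"
    unfolding eq[symmetric] by (intro sums_mult sums_integral[OF fi AE sum])
  also have "(\<lambda>m. rGamma s * (LINT x|lborel_unit. f m x)) = (\<lambda>m. kosh_taylor p m * rGamma_quotient m s)"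
  proof
    fix m
    have "s + of_nat m \<noteq> 0" using sm[of m] by (metis less_irrefl zero_complex.sel(1))
    hence "rGamma s / (s + of_nat m) = rGamma_quotient m s"
      using rGamma_quotient_mult[of s m] by (metis nonzero_mult_div_cancel_left)
    thus "rGamma s * (LINT x|lborel_unit. f m x) = kosh_taylor p m * rGamma_quotient m s"
      unfolding f_def integral_mult_right_zero powr_integral_unit(2)[OF sm]
      by (simp add: mult.commute[of "rGamma s"] times_divide_eq_right[symmetric] del: times_divide_eq_right)
  qed
  finally show "rGamma s * (LINT x|lborel_unit. Mellin_integrand (kosh_regular p) s x) = kosh_eta_local p s"
    by (simp add: kosh_eta_local_def sums_iff)
qed

abbreviation lborel_tail :: "real measure" where
  "lborel_tail \<equiv> restrict_space lborel {1<..}"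

definition kosh_eta_tail :: "real \<Rightarrow> complex \<Rightarrow> complex" where
  "kosh_eta_tail \<nu> s = (LINT x|lborel_tail. Mellin_integrand (kosh_kernel \<nu>) s x)"

lemma kosh_eta_tail_holomorphic:
  assumes \<nu>: "\<nu> > 0"
  shows "kosh_eta_tail \<nu> holomorphic_on UNIV"
  unfolding kosh_eta_tail_def[abs_def]
proof (rule holomorphic_on_integral)
  show "(\<lambda>s. Mellin_integrand (kosh_kernel \<nu>) s x) holomorphic_on UNIV" if "x \<in> space lborel_tail" for x
    using that by (intro holomorphic_intros) (auto simp: space_restrict_space)
  have tail: "restrict_space lborel_pos {1<..} = lborel_tail"
    by (subst restrict_restrict_space) (auto intro!: arg_cong2[where f = restrict_space])
  show "(\<lambda>x. Mellin_integrand (kosh_kernel \<nu>) s x) \<in> borel_measurable lborel_tail" for s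
    unfolding tail[symmetric] by (rule measurable_restrict_space1[OF kosh_kernel_measurable[OF \<nu>]])
  fix s :: complex
  define M where "M = \<bar>Re s\<bar> + 1"
  show "\<exists>e>0. \<exists>g. ball s e \<subseteq> UNIV \<and> integrable lborel_tail g \<and>
      (\<forall>w\<in>ball s e. \<forall>x\<in>space lborel_tail. norm (Mellin_integrand (kosh_kernel \<nu>) w x) \<le> g x)"
  proof (intro exI conjI ballI)
    have "integrable lborel_pos (\<lambda>x. exp (- 1 * x) * x powr (M + 1 - 1))"
      by (rule integrable_Gamma_kernel_real) (auto simp: M_def)
    moreover have S: "{1<..} \<in> sets lborel_pos"
      unfolding sets_restrict_space by (rule image_eqI[of _ _ "{1<..}"]) auto
    ultimately have "integrable lborel_pos (\<lambda>x. indicator {1<..} x *\<^sub>R (exp (- 1 * x) * x powr (M + 1 - 1)))"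
      by (intro integrable_mult_indicator)
    moreover have "{1<..} \<inter> space lborel_pos \<in> sets lborel_pos" using S by (simp only: sets.Int_space_eq2)
    ultimately have "integrable (restrict_space lborel_pos {1<..}) (\<lambda>x. exp (- 1 * x) * x powr (M + 1 - 1))"
      using integrable_restrict_space[of "{1<..}" lborel_pos] by blast
    thus "integrable lborel_tail (\<lambda>x. (exp (- 1 * x) * x powr (M + 1 - 1)) * (1 / (1 - exp (- 1))))"
      unfolding tail by (rule integrable_mult_left)
    fix w x assume w: "w \<in> ball s 1" and "x \<in> space lborel_tail"
    hence x: "x > 1" by (simp add: space_restrict_space)
    let ?q = "kosh_nome \<nu> (of_real x)"
    have q: "norm ?q \<le> exp (- x)" using norm_kosh_nome_less_1(1)[OF \<nu>, of "of_real x"] x by simp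
    have q1: "norm ?q \<le> exp (- 1)" using q x by (smt (verit) exp_le_cancel_iff)
    have e1: "exp (- 1) < (1 :: real)" by simp
    have nq: "norm ?q < 1" using q1 e1 by linarith
    have "kosh_kernel \<nu> (of_real x) = ?q * (1 / (1 - ?q))"
    proof -
      have "(\<lambda>n. ?q * ?q ^ n) sums (?q * (1 / (1 - ?q)))"
        by (intro sums_mult geometric_sums nq)
      moreover have "(\<lambda>n. ?q * ?q ^ n) sums kosh_kernel \<nu> (of_real x)"
        using kosh_kernel_sums[OF \<nu>, of "of_real x"] x by simp
      ultimately show ?thesis using sums_unique2 by blast
    qed
    hence "norm (kosh_kernel \<nu> (of_real x)) = norm ?q * (1 / norm (1 - ?q))" by (simp add: norm_mult norm_divide)
    also have "\<dots> \<le> exp (- x) * (1 / (1 - exp (- 1)))"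
    proof (intro mult_mono q divide_left_mono mult_pos_pos)
      show "1 - exp (- 1) \<le> norm (1 - ?q)" using norm_triangle_ineq2[of 1 ?q] q1 by simp
      thus "0 < norm (1 - ?q)" using e1 by linarith
    qed (use e1 in auto)
    finally have kb: "norm (kosh_kernel \<nu> (of_real x)) \<le> exp (- x) * (1 / (1 - exp (- 1)))" .
    have "Re w \<le> M" using w abs_Re_le_cmod[of "s - w"] by (auto simp: M_def dist_norm)
    hence pb: "norm (complex_of_real x powr (w - 1)) \<le> x powr M"
      using x by (subst norm_powr_pos_real) (auto simp: powr_def intro!: mult_right_mono)
    have "norm (Mellin_integrand (kosh_kernel \<nu>) w x) \<le> (exp (- x) * (1 / (1 - exp (- 1)))) * x powr M"
      unfolding norm_mult by (rule mult_mono[OF kb pb]) (use e1 in auto)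
    thus "norm (Mellin_integrand (kosh_kernel \<nu>) w x) \<le> (exp (- 1 * x) * x powr (M + 1 - 1)) * (1 / (1 - exp (- 1)))"
      by (simp add: mult_ac)
  qed auto
qed auto

text \<open>
  The continuation of the zeta function, by Riemann's method: the Mellin integral of the kernel is split at 1,
  where the part over \<open>(1, \<infinity>)\<close> is entire and the part over \<open>(0, 1]\<close> is integrated termwise.
\<close>

definition kosh_eta_meromorphic :: "real \<Rightarrow> complex \<Rightarrow> complex" where
  "kosh_eta_meromorphic p s = rGamma s * (kosh_eta_tail (2 * pi * p) s + kosh_pole_weight p 0 / (s - 1)) + kosh_eta_local p s"

lemma kosh_eta_meromorphic_eq:
  assumes p: "p > 0" and s: "Re s > 1"
  shows "rGamma s * (LINT x|lborel_pos. Mellin_integrand (kosh_kernel (2 * pi * p)) s x) = kosh_eta_meromorphic p s"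
proof -
  let ?k = "\<lambda>x. Mellin_integrand (kosh_kernel (2 * pi * p)) s x"
  have int: "set_integrable lborel {0<..} ?k"
    using koshliakov_eta_series(2)[OF p s] by (simp add: integrable_lborel_pos)
  have I1: "set_integrable lborel {0<..1} ?k" and I2: "set_integrable lborel {1<..} ?k"
    by (rule set_integrable_subset[OF int]; force)+
  have "(LINT x|lborel_pos. ?k x) = (LINT x:{0<..1} \<union> {1<..}|lborel. ?k x)"
    unfolding integral_lborel_pos[symmetric] by (rule arg_cong[where f = "\<lambda>S. set_lebesgue_integral lborel S ?k"]) auto
  also have "\<dots> = (LINT x:{0<..1}|lborel. ?k x) + (LINT x:{1<..}|lborel. ?k x)"
    by (rule set_integral_Un[OF _ I1 I2]) auto
  also have "(LINT x:{1<..}|lborel. ?k x) = kosh_eta_tail (2 * pi * p) s"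
    unfolding kosh_eta_tail_def by (subst integral_restrict_space) (auto simp: set_lebesgue_integral_def)
  also have "(LINT x:{0<..1}|lborel. ?k x) = (LINT x|lborel_unit. ?k x)"
    by (subst integral_restrict_space) (auto simp: set_lebesgue_integral_def)
  also have "\<dots> = (LINT x|lborel_unit. Mellin_integrand (kosh_regular p) s x + kosh_pole_weight p 0 * of_real x powr ((s - 1) - 1))"
  proof (rule Bochner_Integration.integral_cong)
    fix x assume "x \<in> space lborel_unit"
    hence x: "x > 0" by (simp add: space_restrict_space)
    have "complex_of_real x powr ((s - 1) - 1) = of_real x powr (s - 1) / of_real x"
      using x powr_diff[of "of_real x" "s - 1" "1::complex"] by simp
    thus "?k x = Mellin_integrand (kosh_regular p) s x + kosh_pole_weight p 0 * of_real x powr ((s - 1) - 1)"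
      using x by (simp add: kosh_regular_eq left_diff_distrib)
  qed simp
  also have "\<dots> = (LINT x|lborel_unit. Mellin_integrand (kosh_regular p) s x) + kosh_pole_weight p 0 * (1 / (s - 1))"
  proof -
    have s0: "Re s > 0" "Re (s - 1) > 0" using s by auto
    note int = kosh_regular_integral_unit(1)[OF p s0(1)]
      integrable_mult_right[OF powr_integral_unit(1)[OF s0(2)], of "kosh_pole_weight p 0"]
    show ?thesis
      unfolding Bochner_Integration.integral_add[OF int] integral_mult_right_zero powr_integral_unit(2)[OF s0(2)] ..
  qed
  finally show ?thesis
    using kosh_regular_integral_unit(2)[OF p, of s] s
    by (simp add: kosh_eta_meromorphic_def algebra_simps)
qed

lemma koshliakov_eta_eq:
  assumes p: "p > 0" and s: "s \<noteq> 1"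
  shows "koshliakov_eta p s = kosh_eta_meromorphic p s"
proof -
  define H where "H = kosh_eta_meromorphic p"
  have \<nu>: "2 * pi * p > 0" using p by simp
  have ana: "H analytic_on - {1}"
  proof -
    have "H holomorphic_on - {1}"
      unfolding H_def kosh_eta_meromorphic_def[abs_def]
      by (intro holomorphic_intros holomorphic_on_subset[OF kosh_eta_tail_holomorphic[OF \<nu>]]
          holomorphic_on_subset[OF kosh_eta_local_holomorphic[OF p]]) auto
    thus ?thesis by (subst analytic_on_open) auto
  qed
  have mero: "H meromorphic_on UNIV"
    unfolding H_def kosh_eta_meromorphic_def[abs_def]
    by (intro meromorphic_intros analytic_on_imp_meromorphic_on)
       (use kosh_eta_tail_holomorphic[OF \<nu>] kosh_eta_local_holomorphic[OF p] in
         \<open>auto simp: analytic_on_open intro!: analytic_intros holomorphic_intros\<close>)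
  define R where "R = remove_sings H"
  have R: "R nicely_meromorphic_on UNIV" unfolding R_def by (rule remove_sings_nicely_meromorphic[OF mero])
  have RH: "R z = H z" if "z \<noteq> 1" for z
    unfolding R_def by (rule remove_sings_at_analytic) (rule analytic_on_subset[OF ana], use that in auto)
  have ser: "R z = (\<Sum>n. koshliakov_entire (2 * pi * p) (Suc n) z / of_nat (Suc n) powr z)" if z: "Re z > 1" for z
  proof -
    have "z \<noteq> 1" using z by auto
    thus ?thesis
      using koshliakov_eta_series(1)[OF p z] kosh_eta_meromorphic_eq[OF p z] RH by (simp add: H_def sums_iff)
  qed
  have "koshliakov_eta p = R"
    unfolding koshliakov_eta_def
  proof (rule the_equality)
    show "R nicely_meromorphic_on UNIV \<and> (\<forall>s. Re s > 1 \<longrightarrow> R s = (\<Sum>n. koshliakov_entire (2 * pi * p) (Suc n) s / of_nat (Suc n) powr s))"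
      using R ser by blast
    fix f assume f: "f nicely_meromorphic_on UNIV \<and> (\<forall>s. Re s > 1 \<longrightarrow> f s = (\<Sum>n. koshliakov_entire (2 * pi * p) (Suc n) s / of_nat (Suc n) powr s))"
    show "f = R"
    proof
      fix z
      show "f z = R z"
      proof (rule nicely_meromorphic_eqI[of f UNIV R "{s. Re s > 1}"])
        have "2 \<in> {s::complex. Re s > 1}" by simp
        thus "{s::complex. Re s > 1} \<noteq> {}" by blast
      qed (use f R ser in \<open>auto simp: open_halfspace_Re_gt\<close>)
    qed
  qed
  thus ?thesis using RH[OF s] by (simp add: H_def)
qed

lemma koshliakov_eta_minus_nat:
  assumes p: "p > 0"
  shows "koshliakov_eta p (- of_nat N) = (-1) ^ N * (deriv ^^ N) (kosh_regular p) 0"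
proof -
  have "- of_nat N \<noteq> (1 :: complex)"
  proof
    assume "- of_nat N = (1 :: complex)"
    hence "Re (- of_nat N) = Re 1" by (simp only:)
    thus False by simp
  qed
  moreover have "rGamma (- of_nat N :: complex) = 0" by (simp add: rGamma_eq_zero_iff)
  ultimately show ?thesis
    using koshliakov_eta_eq[OF p] kosh_eta_local_minus_nat[of p N]
    by (simp add: kosh_eta_meromorphic_def)
qed

section \<open>The Eisenstein series as a double sum over the nodes\<close>

lemma summable_on_int_inverse_square:
  "(\<lambda>m::int. 1 / (1 + \<bar>real_of_int m\<bar>)\<^sup>2) summable_on UNIV"
proof -
  let ?g = "\<lambda>m::int. 1 / (1 + \<bar>real_of_int m\<bar>)\<^sup>2"
  have "summable (\<lambda>n. 1 / (real n)\<^sup>2)"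
    using inverse_power_summable[of 2, where ?'a = real] by (simp add: inverse_eq_divide)
  hence "summable (\<lambda>n. 1 / (real (Suc n))\<^sup>2)"
    by (subst summable_Suc_iff)
  hence s: "(\<lambda>n. 1 / (1 + real n)\<^sup>2) summable_on UNIV"
    by (intro norm_summable_imp_summable_on) (simp add: add.commute)
  have "?g summable_on range int"
    using s by (subst summable_on_reindex) (auto simp: o_def)
  moreover have "?g summable_on range (\<lambda>n. - int n)"
    using s by (subst summable_on_reindex) (auto simp: o_def inj_on_def)
  ultimately have "?g summable_on (range int \<union> range (\<lambda>n. - int n))"
    by (rule summable_on_union)
  also have "range int \<union> range (\<lambda>n. - int n) = UNIV"
    by (auto simp: image_iff) (metis int_cases2)
  finally show ?thesis .
qed

lemma summable_on_product_nonneg: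
  fixes f :: "'a \<Rightarrow> real" and g :: "'b \<Rightarrow> real"
  assumes "f summable_on A" "g summable_on B" "\<And>x. f x \<ge> 0" "\<And>y. g y \<ge> 0"
  shows "(\<lambda>(x, y). f x * g y) summable_on A \<times> B"
proof (rule summable_on_SigmaI)
  show "((\<lambda>y. case (x, y) of (x, y) \<Rightarrow> f x * g y) has_sum (f x * infsum g B)) B" for x
    using assms(2) by (auto intro!: has_sum_cmult_right has_sum_infsum)
  show "(\<lambda>x. f x * infsum g B) summable_on A"
    using assms(1) by (rule summable_on_cmult_left)
qed (use assms in auto)

lemma symmetric_partial_sums_tendsto:
  fixes f :: "int \<Rightarrow> complex"
  assumes "f summable_on (- {0})"
  shows "(\<lambda>N. \<Sum>m\<in>{- int N..int N} - {0}. f m) \<longlonglongrightarrow> infsum f (- {0})"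
proof -
  have "(sum f \<longlongrightarrow> infsum f (- {0})) (finite_subsets_at_top (- {0}))"
    using has_sum_infsum[OF assms] by (simp add: has_sum_def)
  moreover have "filterlim (\<lambda>N. {- int N..int N} - {0}) (finite_subsets_at_top (- {0})) sequentially"
    unfolding filterlim_finite_subsets_at_top
  proof (intro allI impI)
    fix X :: "int set" assume X: "finite X \<and> X \<subseteq> - {0}"
    define M where "M = Max (insert 0 (abs ` X))"
    have M: "\<bar>m\<bar> \<le> M" if "m \<in> X" for m
      unfolding M_def using X that by (intro Max_ge) auto
    show "\<forall>\<^sub>F N in sequentially. finite ({- int N..int N} - {0}) \<and> X \<subseteq> {- int N..int N} - {0} \<and> {- int N..int N} - {0} \<subseteq> - {0}"
      using eventually_ge_at_top[of "nat M"]
    proof eventually_elim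
      case (elim N)
      have "X \<subseteq> {- int N..int N} - {0}"
      proof
        fix m assume m: "m \<in> X"
        hence "\<bar>m\<bar> \<le> int N" using M[OF m] elim by linarith
        moreover have "m \<noteq> 0" using m X by auto
        ultimately show "m \<in> {- int N..int N} - {0}" by auto
      qed
      thus ?case by auto
    qed
  qed
  ultimately show ?thesis by (rule filterlim_compose)
qed

lemma infsum_int_split_0:
  fixes f :: "int \<Rightarrow> complex"
  assumes "f summable_on UNIV"
  shows "infsum f UNIV = f 0 + infsum f (- {0})"
proof -
  have "infsum f ({0} \<union> - {0}) = infsum f {0} + infsum f (- {0})"
    by (rule infsum_Un_disjoint) (auto intro: summable_on_subset[OF assms])
  thus ?thesis by simp
qed

lemma higher_deriv_const_divide:
  assumes "x \<noteq> 0"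
  shows "(deriv ^^ n) (\<lambda>x. c / x) x = c * (-1) ^ n * fact n / (x :: complex) ^ Suc n"
  using assms
proof (induction n arbitrary: x)
  case (Suc n)
  have "((deriv ^^ n) (\<lambda>x. c / x) has_field_derivative c * (-1) ^ Suc n * fact (Suc n) / x ^ Suc (Suc n)) (at x)"
  proof (rule has_field_derivative_transform_within_open[where S = "- {0}"])
    define k where "k = c * (-1) ^ n * fact n"
    have "((\<lambda>x. x ^ Suc n) has_field_derivative of_nat (Suc n) * x ^ n) (at x)"
      using DERIV_power[OF DERIV_ident, of "Suc n" x UNIV] by simp
    from DERIV_divide[OF DERIV_const this, of k]
    have "((\<lambda>x. k / x ^ Suc n) has_field_derivative (0 * x ^ Suc n - k * (of_nat (Suc n) * x ^ n)) / (x ^ Suc n * x ^ Suc n)) (at x)"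
      using Suc.prems by simp
    also have "(0 * x ^ Suc n - k * (of_nat (Suc n) * x ^ n)) / (x ^ Suc n * x ^ Suc n) = (- k * of_nat (Suc n)) * x ^ n / (x ^ Suc (Suc n) * x ^ n)"
      by (simp add: mult_ac)
    also have "\<dots> = (- k * of_nat (Suc n)) / x ^ Suc (Suc n)"
      by (rule mult_divide_mult_cancel_right) (use Suc.prems in simp)
    also have "- k * of_nat (Suc n) = c * (-1) ^ Suc n * fact (Suc n)"
      by (simp only: k_def fact_Suc power_Suc of_nat_mult) (simp add: algebra_simps)
    finally show "((\<lambda>x. c * (-1) ^ n * fact n / x ^ Suc n) has_field_derivative c * (-1) ^ Suc n * fact (Suc n) / x ^ Suc (Suc n)) (at x)"
      unfolding k_def .
  qed (use Suc in auto)
  thus ?case by (simp add: DERIV_imp_deriv)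
qed simp

text \<open>
  The symmetric partial sums of the partial fraction expansion, rewritten as an unordered sum.
\<close>

lemma higher_deriv_kosh_regular:
  assumes p: "p > 0" and K: "K > 0" and x: "x \<in> kosh_regular_set p"
    and sum: "(\<lambda>m. kosh_fraction p (2 * K) x m) summable_on - {0}"
  shows "- (deriv ^^ (2 * K - 1)) (kosh_regular p) x =
     fact (2 * K - 1) * (\<Sum>\<^sub>\<infinity>m\<in>-{0}. kosh_fraction p (2 * K) x m)"
proof -
  have "Suc (2 * K - 1) = 2 * K" "2 * K - 1 > 0" using K by auto
  hence "- (deriv ^^ (2 * K - 1)) (kosh_regular p) x / fact (2 * K - 1) =
      (\<Sum>\<^sub>\<infinity>m\<in>-{0}. kosh_fraction p (2 * K) x m)"
    using kosh_regular_partial_fractions[OF p x, of "2 * K - 1"] symmetric_partial_sums_tendsto[OF sum]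
    by (intro LIMSEQ_unique) simp_all
  thus ?thesis by (simp add: field_simps)
qed

text \<open>
  The principal part of the kernel at 0, which \<open>kosh_regular\<close> omits, contributes the term \<open>m = 0\<close>.
\<close>

lemma koshliakov_Omega_infsum:
  assumes p: "p > 0" and K: "K > 0" and x: "Re x > 0"
    and sum: "(\<lambda>m. kosh_fraction p (2 * K) x m) summable_on UNIV"
  shows "koshliakov_Omega p x (- int K) =
     fact (2 * K - 1) * (\<Sum>\<^sub>\<infinity>m. kosh_fraction p (2 * K) x m)"
proof -
  define N where "N = 2 * K - 1"
  have N: "odd N" "Suc N = 2 * K" using K by (auto simp: N_def)
  let ?w = "kosh_pole_weight p 0"
  have sub: "{x. Re x > 0} \<subseteq> kosh_regular_set p"
    using kosh_denom_nonzero[of "2 * pi * p"] p by (auto simp: kosh_regular_set_eq)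
  have reg: "kosh_regular p holomorphic_on {x. Re x > 0}"
    by (rule holomorphic_on_subset[OF kosh_regular_holomorphic[OF p] sub])
  have inv: "(\<lambda>x. ?w / x) holomorphic_on {x. Re x > 0}"
    by (intro holomorphic_intros) auto
  have x0: "x \<noteq> 0" using x by auto
  have "(deriv ^^ N) (kosh_kernel (2 * pi * p)) x = (deriv ^^ N) (\<lambda>x. kosh_regular p x + ?w / x) x"
  proof (rule higher_deriv_cong_ev[OF _ refl])
    have "eventually (\<lambda>y. y \<in> {x. Re x > 0}) (nhds x)"
      using x by (intro eventually_nhds_in_open open_halfspace_Re_gt) auto
    thus "eventually (\<lambda>y. kosh_kernel (2 * pi * p) y = kosh_regular p y + ?w / y) (nhds x)"
    proof eventually_elim
      case (elim y)
      hence "y \<noteq> 0" by auto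
      thus ?case by (simp add: kosh_regular_eq)
    qed
  qed
  also have "\<dots> = (deriv ^^ N) (kosh_regular p) x + (deriv ^^ N) (\<lambda>x. ?w / x) x"
    by (rule higher_deriv_add[OF reg inv open_halfspace_Re_gt]) (use x in auto)
  also have "(deriv ^^ N) (\<lambda>x. ?w / x) x = - (fact N * (?w / (kosh_pole p 0 - x) ^ (2 * K)))"
    using higher_deriv_const_divide[OF x0, of N ?w] N p by simp
  finally have "koshliakov_Omega p x (- int K) = - (deriv ^^ N) (kosh_regular p) x + fact N * (?w / (kosh_pole p 0 - x) ^ (2 * K))"
    unfolding koshliakov_Omega_eq[OF p K x] N_def[symmetric] by simp
  also have "- (deriv ^^ N) (kosh_regular p) x = fact N * (\<Sum>\<^sub>\<infinity>m\<in>-{0}. kosh_fraction p (2 * K) x m)"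
    unfolding N_def
    by (rule higher_deriv_kosh_regular[OF p K _ summable_on_subset[OF sum]]) (use sub x in auto)
  finally show ?thesis
    unfolding infsum_int_split_0[OF sum] N_def by (simp only: distrib_left add.commute)
qed

definition kosh_lattice_term :: "real \<Rightarrow> nat \<Rightarrow> complex \<Rightarrow> int \<times> int \<Rightarrow> complex" where
  "kosh_lattice_term p K z = (\<lambda>(a, b). kosh_pole_weight p a * kosh_pole_weight p b /
     (of_real (kosh_node p a) * z + of_real (kosh_node p b)) ^ (2 * K))"

text \<open>
  The imaginary part of \<open>a z + b\<close> controls \<open>a\<close>, and then \<open>b = (a z + b) - a z\<close> is controlled as well.
\<close>

lemma lattice_norm_lower_bound:
  assumes "Im z > 0"
  obtains M where "M > 0" "\<And>a b :: real. \<bar>a\<bar> + \<bar>b\<bar> \<le> M * norm (of_real a * z + of_real b)"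
proof
  define M where "M = 1 / Im z + (1 + norm z / Im z)"
  show "M > 0" unfolding M_def using assms by (intro add_pos_pos add_pos_nonneg) auto
  fix a b :: real
  define Y where "Y = norm (of_real a * z + of_real b)"
  have "\<bar>a\<bar> * Im z = \<bar>Im (of_real a * z + of_real b)\<bar>" using assms by (simp add: abs_mult)
  also have "\<dots> \<le> Y" unfolding Y_def by (rule abs_Im_le_cmod)
  finally have a: "\<bar>a\<bar> \<le> Y / Im z" using assms by (simp add: field_simps)
  have "\<bar>b\<bar> = norm ((of_real a * z + of_real b) - of_real a * z)" by simp
  also have "\<dots> \<le> Y + \<bar>a\<bar> * norm z"
    unfolding Y_def by (rule order.trans[OF norm_triangle_ineq4]) (simp add: norm_mult)
  also have "\<dots> \<le> Y + (Y / Im z) * norm z" by (intro add_left_mono mult_right_mono a) simp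
  finally have "\<bar>a\<bar> + \<bar>b\<bar> \<le> Y / Im z + (Y + (Y / Im z) * norm z)" using a by linarith
  also have "\<dots> = M * Y" by (simp add: M_def algebra_simps)
  finally show "\<bar>a\<bar> + \<bar>b\<bar> \<le> M * norm (of_real a * z + of_real b)" unfolding Y_def .
qed

text \<open>
  Since \<open>\<bar>m\<bar> \<le> 2 \<bar>l\<^sub>m\<bar>\<close>, the terms are \<open>O(t\<^sup>-\<^sup>2\<^sup>K)\<close> with \<open>t = \<bar>a\<bar> + \<bar>b\<bar> \<ge> 1\<close>. For \<open>K \<ge> 2\<close> this is \<open>O(t\<^sup>-\<^sup>4)\<close>, and
  \<open>(1 + \<bar>a\<bar>) (1 + \<bar>b\<bar>) \<le> (2t)\<^sup>2\<close> compares it with a product of two convergent series.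
\<close>

lemma kosh_lattice_summable:
  assumes p: "p > 0" and K: "K > 1" and z: "Im z > 0"
  shows "kosh_lattice_term p K z summable_on - {(0, 0)}"
proof -
  obtain M where M: "M > 0" "\<And>a b :: real. \<bar>a\<bar> + \<bar>b\<bar> \<le> M * norm (of_real a * z + of_real b)"
    using lattice_norm_lower_bound[OF z] by blast
  \<comment> \<open>The factor 16 comes from \<open>(2t)\<^sup>2 (2t)\<^sup>2\<close>, and \<open>2M\<close> from \<open>t \<le> 2M \<bar>l\<^sub>a z + l\<^sub>b\<bar>\<close>.\<close>
  define c where "c = 16 * (2 * M) ^ (2 * K)"
  define g where "g = (\<lambda>m::int. 1 / (1 + \<bar>real_of_int m\<bar>)\<^sup>2)"
  have "(\<lambda>(a, b). g a * g b) summable_on UNIV \<times> UNIV"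
    unfolding g_def by (intro summable_on_product_nonneg summable_on_int_inverse_square) auto
  hence "(\<lambda>(a, b). g a * g b) summable_on - {(0, 0)}"
    by (rule summable_on_subset) auto
  hence "(\<lambda>x. c * (case x of (a, b) \<Rightarrow> g a * g b)) summable_on - {(0, 0)}"
    by (rule summable_on_cmult_right)
  hence "(\<lambda>x. norm (kosh_lattice_term p K z x)) summable_on - {(0, 0)}"
  proof (rule Infinite_Sum.abs_summable_on_comparison_test'[where g = "\<lambda>x. c * (case x of (a, b) \<Rightarrow> g a * g b)"])
    fix x :: "int \<times> int" assume x: "x \<in> - {(0, 0)}"
    obtain a b where ab: "x = (a, b)" by (cases x)
    define Y where "Y = norm (of_real (kosh_node p a) * z + of_real (kosh_node p b))"
    define t where "t = \<bar>real_of_int a\<bar> + \<bar>real_of_int b\<bar>"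
    have node: "\<bar>real_of_int m\<bar> \<le> 2 * \<bar>kosh_node p m\<bar>" for m
    proof (cases "m = 0")
      case False
      hence "\<bar>real_of_int m\<bar> \<ge> 1" by linarith
      thus ?thesis using kosh_node_approx[OF p, of m] by linarith
    qed (use p in simp)
    have t1: "t \<ge> 1" using x ab by (auto simp: t_def)
    have "t \<le> 2 * (\<bar>kosh_node p a\<bar> + \<bar>kosh_node p b\<bar>)"
      using node[of a] node[of b] by (simp add: t_def)
    also have "\<dots> \<le> 2 * (M * Y)" unfolding Y_def by (intro mult_left_mono M) simp
    finally have tY: "t \<le> 2 * M * Y" by simp
    have Y: "Y > 0"
    proof (rule ccontr)
      assume "\<not> Y > 0"
      hence "2 * M * Y \<le> 0" using M(1) by (intro mult_nonneg_nonpos) auto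
      thus False using tY t1 by linarith
    qed
    have A: "(1 + \<bar>real_of_int a\<bar>)\<^sup>2 * (1 + \<bar>real_of_int b\<bar>)\<^sup>2 \<le> 16 * t ^ (2 * K)"
    proof -
      have "(1 + \<bar>real_of_int a\<bar>)\<^sup>2 * (1 + \<bar>real_of_int b\<bar>)\<^sup>2 \<le> (2 * t)\<^sup>2 * (2 * t)\<^sup>2"
        using t1 by (intro mult_mono power_mono) (auto simp: t_def)
      also have "\<dots> = 16 * t ^ 4" by (simp add: power_mult_distrib flip: power_add)
      also have "\<dots> \<le> 16 * t ^ (2 * K)" using t1 K by (intro mult_left_mono power_increasing) auto
      finally show ?thesis .
    qed
    also have "\<dots> \<le> 16 * (2 * M * Y) ^ (2 * K)" using tY t1 by (intro mult_left_mono power_mono) auto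
    also have "\<dots> = c * Y ^ (2 * K)" by (simp add: c_def power_mult_distrib)
    finally have le: "(1 + \<bar>real_of_int a\<bar>)\<^sup>2 * (1 + \<bar>real_of_int b\<bar>)\<^sup>2 \<le> c * Y ^ (2 * K)" .
    have pos: "(1 + \<bar>real_of_int a\<bar>)\<^sup>2 * (1 + \<bar>real_of_int b\<bar>)\<^sup>2 > 0" by (intro mult_pos_pos zero_less_power) auto
    have w: "norm (kosh_pole_weight p m) \<le> 1" for m
      unfolding norm_of_real using kosh_weight_bounds[OF p, of "kosh_node p m"] by simp
    have "norm (kosh_lattice_term p K z x) = norm (kosh_pole_weight p a) * norm (kosh_pole_weight p b) / Y ^ (2 * K)"
      by (simp only: kosh_lattice_term_def ab prod.case norm_divide norm_mult norm_power Y_def)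
    also have "\<dots> \<le> 1 * 1 / Y ^ (2 * K)" using Y by (intro divide_right_mono mult_mono w) auto
    also have "\<dots> \<le> c / ((1 + \<bar>real_of_int a\<bar>)\<^sup>2 * (1 + \<bar>real_of_int b\<bar>)\<^sup>2)"
    proof -
      have "1 * 1 / Y' \<le> c / P" if "P \<le> c * Y'" "P > 0" "Y' > 0" for P Y' :: real
        using that by (simp add: field_simps)
      thus ?thesis using le pos Y by simp
    qed
    also have "\<dots> = c * (case x of (a, b) \<Rightarrow> g a * g b)" by (simp add: ab g_def)
    finally show "norm (kosh_lattice_term p K z x) \<le> c * (case x of (a, b) \<Rightarrow> g a * g b)" .
  qed
  thus ?thesis by (rule Infinite_Sum.abs_summable_summable)
qed

definition kosh_lattice_sum :: "real \<Rightarrow> nat \<Rightarrow> complex \<Rightarrow> complex" where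
  "kosh_lattice_sum p K z = infsum (kosh_lattice_term p K z) (- {(0, 0)})"

text \<open>
  \<open>l\<^sub>a (-1/z) + l\<^sub>b = (l\<^sub>b z + l\<^sub>-\<^sub>a) / z\<close>, and \<open>(a, b) \<mapsto> (b, -a)\<close> permutes the index set and preserves the weights.
\<close>

lemma kosh_lattice_sum_modular:
  assumes p: "p > 0" and z: "Im z > 0"
  shows "kosh_lattice_sum p K (- 1 / z) = z ^ (2 * K) * kosh_lattice_sum p K z"
proof -
  have z0: "z \<noteq> 0" using z by auto
  have "kosh_lattice_sum p K (- 1 / z) = (\<Sum>\<^sub>\<infinity>x\<in>-{(0, 0)}. z ^ (2 * K) * kosh_lattice_term p K z x)"
    unfolding kosh_lattice_sum_def
  proof (rule infsum_reindex_bij_witness[of _ "\<lambda>(a, b). (- b, a)" "\<lambda>(a, b). (b, - a)"])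
    fix x :: "int \<times> int"
    obtain a b where ab: "x = (a, b)" by (cases x)
    define A B where "A = complex_of_real (kosh_node p a)" and "B = complex_of_real (kosh_node p b)"
    have "A * (- 1 / z) + B = (B * z - A) / z" using z0 by (simp add: field_simps)
    hence "(A * (- 1 / z) + B) ^ (2 * K) = (B * z + - A) ^ (2 * K) / z ^ (2 * K)"
      by (simp add: power_divide)
    thus "z ^ (2 * K) * kosh_lattice_term p K z (case x of (a, b) \<Rightarrow> (b, - a)) = kosh_lattice_term p K (- 1 / z) x"
      by (simp add: ab kosh_lattice_term_def kosh_node_minus[OF p] kosh_weight_def A_def B_def mult_ac)
  qed auto
  also have "\<dots> = z ^ (2 * K) * kosh_lattice_sum p K z"
    unfolding kosh_lattice_sum_def by (rule infsum_cmult_right')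
  finally show ?thesis .
qed

text \<open>
  The pairs with \<open>a > 0\<close> and those with \<open>a < 0\<close> contribute equally, because the exponent is even. These are
  the two halves that the Eisenstein series records by its factor 2, and \<open>a = 0\<close> gives its constant term.
\<close>

lemma kosh_lattice_sum_split:
  assumes p: "p > 0" and K: "K > 1" and z: "Im z > 0"
  shows "kosh_lattice_sum p K z =
     2 * infsum (kosh_lattice_term p K z) ({0<..} \<times> UNIV) +
     kosh_pole_weight p 0 * (\<Sum>\<^sub>\<infinity>m\<in>-{0}. kosh_pole_weight p m / of_real (kosh_node p m) ^ (2 * K))"
proof -
  let ?T = "kosh_lattice_term p K z"
  let ?P = "{0<..} \<times> UNIV :: (int \<times> int) set" and ?Q = "{..<0} \<times> UNIV :: (int \<times> int) set"
    and ?Z = "Pair 0 ` (- {0}) :: (int \<times> int) set"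
  have sum: "?T summable_on S" if "S \<subseteq> - {(0, 0)}" for S
    by (rule summable_on_subset[OF kosh_lattice_summable[OF p K z] that])
  have "- {(0, 0)} = ?P \<union> (?Q \<union> ?Z)" by (auto simp: image_iff)
  hence "kosh_lattice_sum p K z = infsum ?T (?P \<union> (?Q \<union> ?Z))"
    by (simp add: kosh_lattice_sum_def)
  also have "\<dots> = infsum ?T ?P + infsum ?T (?Q \<union> ?Z)"
    by (rule infsum_Un_disjoint) (auto intro!: sum)
  also have "infsum ?T (?Q \<union> ?Z) = infsum ?T ?Q + infsum ?T ?Z"
    by (rule infsum_Un_disjoint) (auto intro!: sum)
  also have "infsum ?T ?Q = infsum ?T ?P"
  proof (rule infsum_reindex_bij_witness[of _ "\<lambda>(a, b). (- a, - b)" "\<lambda>(a, b). (- a, - b)"])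
    fix x :: "int \<times> int"
    obtain a b where ab: "x = (a, b)" by (cases x)
    define A B where "A = complex_of_real (kosh_node p a)" and "B = complex_of_real (kosh_node p b)"
    have "(- A * z + - B) ^ (2 * K) = (- (A * z + B)) ^ (2 * K)" by (rule arg_cong[where f = "\<lambda>x. x ^ (2 * K)"]) simp
    hence "(- A * z + - B) ^ (2 * K) = (A * z + B) ^ (2 * K)" by (simp only: power_mult power2_minus)
    thus "?T (case x of (a, b) \<Rightarrow> (- a, - b)) = ?T x"
      by (simp only: ab kosh_lattice_term_def kosh_node_minus[OF p] kosh_weight_def A_def B_def of_real_minus prod.case power2_minus)
  qed auto
  also have "infsum ?T ?Z = (\<Sum>\<^sub>\<infinity>m\<in>-{0}. ?T (0, m))"
    by (subst infsum_reindex) (auto simp: inj_on_def o_def)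
  also have "\<dots> = (\<Sum>\<^sub>\<infinity>m\<in>-{0}. kosh_pole_weight p 0 * (kosh_pole_weight p m / of_real (kosh_node p m) ^ (2 * K)))"
    by (intro infsum_cong) (use p in \<open>simp add: kosh_lattice_term_def\<close>)
  also have "\<dots> = kosh_pole_weight p 0 * (\<Sum>\<^sub>\<infinity>m\<in>-{0}. kosh_pole_weight p m / of_real (kosh_node p m) ^ (2 * K))"
    by (rule infsum_cmult_right')
  finally show ?thesis by simp
qed

text \<open>
  The partial fraction expansion at \<open>x = 0\<close>. Its absolute convergence is inherited from the lattice sum, taken at
  \<open>z = \<i>\<close>, by restriction to the pairs with \<open>a = 0\<close>.
\<close>

lemma koshliakov_eta_infsum:
  assumes p: "p > 0" and K: "K > 1"
  shows "koshliakov_eta p (1 - of_nat (2 * K)) = fact (2 * K - 1) / (2 * of_real pi * \<i>) ^ (2 * K) *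
     (\<Sum>\<^sub>\<infinity>m\<in>-{0}. kosh_pole_weight p m / of_real (kosh_node p m) ^ (2 * K))"
proof -
  let ?w = "kosh_pole_weight p" and ?l = "\<lambda>m. complex_of_real (kosh_node p m)"
  let ?c = "(2 * of_real pi * \<i>) ^ (2 * K) :: complex"
  have w0: "?w 0 \<noteq> 0" using kosh_weight_bounds(1)[OF p, of "kosh_node p 0"] by simp
  have "kosh_lattice_term p K \<i> summable_on (Pair 0 ` (- {0}))"
    by (rule summable_on_subset[OF kosh_lattice_summable[OF p K]]) auto
  hence "(\<lambda>m. kosh_lattice_term p K \<i> (0, m)) summable_on - {0}"
    by (subst (asm) summable_on_reindex) (auto simp: inj_on_def o_def)
  hence "(\<lambda>m. (1 / (?w 0 * ?c)) * kosh_lattice_term p K \<i> (0, m)) summable_on - {0}"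
    by (rule summable_on_cmult_right)
  also have "(\<lambda>m. (1 / (?w 0 * ?c)) * kosh_lattice_term p K \<i> (0, m)) = (\<lambda>m. kosh_fraction p (2 * K) 0 m)"
    using w0 p by (simp add: kosh_lattice_term_def fun_eq_iff power_mult_distrib)
  finally have sum: "(\<lambda>m. kosh_fraction p (2 * K) 0 m) summable_on - {0}" .
  have "1 - of_nat (2 * K) = - (of_nat (2 * K - 1) :: complex)" using K by (simp add: of_nat_diff)
  hence "koshliakov_eta p (1 - of_nat (2 * K)) = - (deriv ^^ (2 * K - 1)) (kosh_regular p) 0"
    using koshliakov_eta_minus_nat[OF p, of "2 * K - 1"] K by simp
  also have "\<dots> = fact (2 * K - 1) * (\<Sum>\<^sub>\<infinity>m\<in>-{0}. kosh_fraction p (2 * K) 0 m)"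
  proof (rule higher_deriv_kosh_regular[OF p _ _ sum])
    show "0 \<in> kosh_regular_set p" using ball_0_pi_subset[OF p] by auto
  qed (use K in auto)
  also have "(\<lambda>m. kosh_fraction p (2 * K) 0 m) = (\<lambda>m. (1 / ?c) * (?w m / ?l m ^ (2 * K)))"
    by (simp add: fun_eq_iff power_mult_distrib)
  also have "(\<Sum>\<^sub>\<infinity>m\<in>-{0}. (1 / ?c) * (?w m / ?l m ^ (2 * K))) = (1 / ?c) * (\<Sum>\<^sub>\<infinity>m\<in>-{0}. ?w m / ?l m ^ (2 * K))"
    by (rule infsum_cmult_right')
  finally show ?thesis by simp
qed

text \<open>
  At \<open>x = - 2\<pi>i l\<^sub>a z\<close> the partial fractions have the denominators \<open>2\<pi>i (l\<^sub>a z + l\<^sub>b)\<close>, so the series over the roots is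
  the part \<open>a > 0\<close> of the lattice sum.
\<close>

lemma koshliakov_Omega_suminf:
  assumes p: "p > 0" and K: "K > 1" and z: "Im z > 0"
  shows "(\<Sum>j. kosh_pole_weight p (int j + 1) *
            koshliakov_Omega p (- 2 * of_real (kosh_node p (int j + 1)) * of_real pi * \<i> * z) (- int K)) =
         fact (2 * K - 1) / (2 * of_real pi * \<i>) ^ (2 * K) * infsum (kosh_lattice_term p K z) ({0<..} \<times> UNIV)"
proof -
  let ?w = "kosh_pole_weight p" and ?l = "\<lambda>m. complex_of_real (kosh_node p m)"
  let ?c = "(2 * of_real pi * \<i>) ^ (2 * K) :: complex"
  let ?T = "kosh_lattice_term p K z"
  define A where "A = fact (2 * K - 1) / ?c"
  have sumP: "?T summable_on ({0<..} \<times> UNIV)"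
    by (rule summable_on_subset[OF kosh_lattice_summable[OF p K z]]) auto
  have suma: "(\<lambda>b. ?T (a, b)) summable_on UNIV" if "a > 0" for a
    using summable_on_SigmaD1[of "\<lambda>a b. ?T (a, b)" "{0<..}" "\<lambda>_. UNIV" a] sumP that by simp
  have term_eq: "?w a * koshliakov_Omega p (- 2 * ?l a * of_real pi * \<i> * z) (- int K) = A * (\<Sum>\<^sub>\<infinity>b. ?T (a, b))"
    if a: "a > 0" for a
  proof -
    define x where "x = - 2 * ?l a * of_real pi * \<i> * z"
    have l: "kosh_node p a > 0" using kosh_node_pos_iff[OF p] a by simp
    have w: "?w a \<noteq> 0" using kosh_weight_bounds(1)[OF p, of "kosh_node p a"] by simp
    have "Re x = 2 * kosh_node p a * pi * Im z" by (simp add: x_def)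
    hence x: "Re x > 0" using l z by simp
    have eq: "kosh_fraction p (2 * K) x b = (1 / (?w a * ?c)) * ?T (a, b)" for b
    proof -
      have "kosh_pole p b - x = (2 * of_real pi * \<i>) * (?l a * z + ?l b)"
        by (simp add: x_def algebra_simps)
      hence "(kosh_pole p b - x) ^ (2 * K) = ?c * (?l a * z + ?l b) ^ (2 * K)"
        by (simp only: power_mult_distrib)
      thus ?thesis using w by (simp add: kosh_lattice_term_def)
    qed
    have "koshliakov_Omega p x (- int K) = fact (2 * K - 1) * (\<Sum>\<^sub>\<infinity>b. kosh_fraction p (2 * K) x b)"
    proof (rule koshliakov_Omega_infsum[OF p _ x])
      show "(\<lambda>b. kosh_fraction p (2 * K) x b) summable_on UNIV"
        unfolding eq by (intro summable_on_cmult_right suma a)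
    qed (use K in auto)
    also have "(\<Sum>\<^sub>\<infinity>b. kosh_fraction p (2 * K) x b) = (1 / (?w a * ?c)) * (\<Sum>\<^sub>\<infinity>b. ?T (a, b))"
      unfolding eq by (rule infsum_cmult_right')
    finally show ?thesis using w by (simp add: x_def A_def)
  qed
  have "((\<lambda>a. \<Sum>\<^sub>\<infinity>b. ?T (a, b)) has_sum infsum ?T ({0<..} \<times> UNIV)) {0<..}"
    by (rule has_sum_SigmaD[OF has_sum_infsum[OF sumP]]) (intro has_sum_infsum suma, simp)
  hence "((\<lambda>a. A * (\<Sum>\<^sub>\<infinity>b. ?T (a, b))) has_sum A * infsum ?T ({0<..} \<times> UNIV)) {0<..}"
    by (rule has_sum_cmult_right)
  also have "?this \<longleftrightarrow> ((\<lambda>j. A * (\<Sum>\<^sub>\<infinity>b. ?T (int j + 1, b))) has_sum A * infsum ?T ({0<..} \<times> UNIV)) UNIV"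
    by (rule has_sum_reindex_bij_witness[of _ "\<lambda>j. int j + 1" "\<lambda>a. nat (a - 1)"]) auto
  finally have "(\<lambda>j. A * (\<Sum>\<^sub>\<infinity>b. ?T (int j + 1, b))) sums (A * infsum ?T ({0<..} \<times> UNIV))"
    by (rule has_sum_imp_sums)
  hence "(\<Sum>j. A * (\<Sum>\<^sub>\<infinity>b. ?T (int j + 1, b))) = A * infsum ?T ({0<..} \<times> UNIV)"
    by (rule sums_unique[symmetric])
  moreover have "?w (int j + 1) * koshliakov_Omega p (- 2 * ?l (int j + 1) * of_real pi * \<i> * z) (- int K) =
      A * (\<Sum>\<^sub>\<infinity>b. ?T (int j + 1, b))" for j
    by (rule term_eq) simp
  ultimately show ?thesis by (simp only: A_def)
qed

definition p_Eisenstein_numerator :: "real \<Rightarrow> nat \<Rightarrow> complex \<Rightarrow> complex" where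
  "p_Eisenstein_numerator p K z =
     fact (2 * K - 1) / (2 * of_real pi * \<i>) ^ (2 * K) / kosh_pole_weight p 0 * kosh_lattice_sum p K z"

text \<open>
  The constant \<open>2 (1 + 1 / (\<pi>p))\<close> is \<open>2 / w\<^sub>0\<close>, which is what makes the two parts of the Eisenstein series
  proportional to the two parts of the lattice sum.
\<close>

lemma p_Eisenstein_eq:
  assumes p: "p > 0" and K: "K > 1" and z: "Im z > 0"
  shows "p_Eisenstein p (2 * K) z =
     (let e = koshliakov_eta p (1 - of_nat (2 * K))
      in if e = 0 then p_Eisenstein_numerator p K z else p_Eisenstein_numerator p K z / e)"
proof -
  let ?w = "kosh_pole_weight p"
  define e where "e = koshliakov_eta p (1 - of_nat (2 * K))"
  define C where "C = 2 * (1 + 1 / (complex_of_real pi * of_real p))"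
  define S where "S = (\<Sum>j. ?w (int j + 1) *
            koshliakov_Omega p (- 2 * of_real (kosh_node p (int j + 1)) * of_real pi * \<i> * z) (- int K))"
  define I where "I = infsum (kosh_lattice_term p K z) ({0<..} \<times> UNIV)"
  define J where "J = (\<Sum>\<^sub>\<infinity>m\<in>-{0}. ?w m / complex_of_real (kosh_node p m) ^ (2 * K))"
  define A where "A = fact (2 * K - 1) / (2 * of_real pi * \<i> :: complex) ^ (2 * K)"
  have w0: "?w 0 \<noteq> 0" using kosh_weight_bounds(1)[OF p, of "kosh_node p 0"] by simp
  have "?w 0 = of_real (1 / (1 + 1 / (pi * p)))"
    using kosh_weight_0[OF p] p by simp
  hence C: "C = 2 / ?w 0"
    by (simp add: C_def)
  have S: "S = A * I" unfolding S_def A_def I_def by (rule koshliakov_Omega_suminf[OF p K z])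
  have e: "e = A * J" unfolding e_def A_def J_def by (rule koshliakov_eta_infsum[OF p K])
  have G: "kosh_lattice_sum p K z = 2 * I + ?w 0 * J"
    unfolding I_def J_def by (rule kosh_lattice_sum_split[OF p K z])
  have num: "e + C * S = p_Eisenstein_numerator p K z"
    unfolding p_Eisenstein_numerator_def A_def[symmetric] G e S C using w0 by (simp add: field_simps)
  have "p_Eisenstein p (2 * K) z = (if e = 0 then e + C * S else 1 + C / e * S)"
    unfolding p_Eisenstein_def Let_def e_def[symmetric] C_def S_def koshliakov_root_eq[OF p] kosh_weight_def by simp
  also have "\<dots> = (if e = 0 then e + C * S else (e + C * S) / e)"
    by (simp add: add_divide_distrib)
  finally show ?thesis unfolding num Let_def e_def[symmetric] .
qed

theorem theorem2p16:
  fixes p :: real and k :: nat and z :: complex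
  assumes "p > 0" and "k > 1" and "Im z > 0"
  shows "p_Eisenstein p (2 * k) (- 1 / z) = z ^ (2 * k) * p_Eisenstein p (2 * k) z"
proof -
  have "Im (- 1 / z) = Im z / (norm z)\<^sup>2"
    by (simp add: Im_divide cmod_power2)
  moreover have "z \<noteq> 0" using assms by auto
  ultimately have "Im (- 1 / z) > 0" using assms by simp
  moreover have "p_Eisenstein_numerator p k (- 1 / z) = z ^ (2 * k) * p_Eisenstein_numerator p k z"
    unfolding p_Eisenstein_numerator_def kosh_lattice_sum_modular[OF assms(1,3)] by (simp only: mult_ac)
  ultimately show ?thesis
    unfolding p_Eisenstein_eq[OF assms] by (subst p_Eisenstein_eq[OF assms(1,2)]) (simp_all add: Let_def)
qed

end
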